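(* Let $(E\to M,[\cdot,\cdot],\langle\cdot,\cdot\rangle,\rho)$ be a strongly anchored almost Courant algebroid. For $\alpha\in\Omega^p_M(\ker\rho)$ and $\psi_0,\dots,\psi_p\in\Gamma(E)$ put $$\langle \mathcal{D}\alpha,\psi_0\wedge\dots\wedge\psi_p\rangle=\sum_{i=0}^p(-1)^i\rho(\psi_i)\langle\alpha,\psi_0\wedge\dots\hat\psi_i\dots\wedge\psi_p\rangle+\sum_{i<j}(-1)^{i+j}\langle\alpha,[\psi_i,\psi_j]\wedge\psi_0\wedge\dots\hat\psi_i\dots\hat\psi_j\dots\wedge\psi_p\rangle .$$ Then this defines an exterior covariant derivative, i.e. the right-hand side is $C^\infty(M)$-linear in the occurring $\psi_i\in\Gamma(E)$ (and so defines $\mathcal{D}\alpha\in\Gamma(\wedge^{p+1}E)$). Moreover $\mathcal{D}$ maps $\Omega^p_M(\ker\rho)$ to $\Omega^{p+1}_M(\ker\rho)$ and fulfills the Leibniz rule $$\mathcal{D}(\alpha\wedge\beta)=(\mathcal{D}\alpha)\wedge\beta+(-1)^{|\alpha|}\alpha\wedge\mathcal{D}\beta$$ for all (homogeneous) $\alpha,\beta\in\Omega^\bullet_M(\ker\rho)$, where $|\alpha|$ is the degree of $\alpha$.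
   Context: A strongly anchored almost Courant algebroid is a smooth vector bundle $E\to M$ over a smooth manifold with an $\mathbb{R}$-bilinear (not necessarily skew-symmetric) bracket $[\cdot,\cdot]:\Gamma(E)\otimes\Gamma(E)\to\Gamma(E)$, a symmetric non-degenerate bilinear form $\langle\cdot,\cdot\rangle$ on the fibres of $E$ (smooth, i.e. a bundle map $E\otimes E\to\mathbb{R}\times M$), and a vector bundle morphism $\rho:E\to TM$ (the anchor), such that for all $\phi,\psi\in\Gamma(E)$, $f\in C^\infty(M)$: (1) $\rho[\phi,\psi]=[\rho(\phi),\rho(\psi)]_{TM}$; (2) $[\phi,f\psi]=\rho(\phi)[f]\,\psi+f[\phi,\psi]$; (3) $[\psi,\psi]=\tfrac12\rho^*d\langle\psi,\psi\rangle$; (4) $\rho(\phi)\langle\psi,\psi\rangle=2\langle[\phi,\psi],\psi\rangle$. Here $d$ is the de Rham differential, and $E^*$ is identified with $E$ via $\langle\cdot,\cdot\rangle$, so $\rho^*:T^*M\to E$, and elements of $\Gamma(\wedge^pE)$ are regarded as alternating $C^\infty(M)$-multilinear $p$-forms on $\Gamma(E)$; $\langle\alpha,\psi_1\wedge\dots\wedge\psi_p\rangle$ denotes evaluation of $\alpha\in\Gamma(\wedge^pE)$ on $\psi_1,\dots,\psi_p$. $\Omega^p_M(\ker\rho)$ is the space of smooth sections of $\wedge^pE$ lying in the kernel of $\tilde\rho:\wedge^pE\to TM\otimes\wedge^{p-1}E$, $\tilde\rho(\psi_1\wedge\dots\wedge\psi_p)=\sum_i(-1)^{i-1}\rho(\psi_i)\otimes\psi_1\wedge\dots\hat\psi_i\dots\wedge\psi_p$;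 $\Omega^0_M(\ker\rho)=C^\infty(M)$. A hat denotes omission. *)

theory Defs
  imports "HOL-Analysis.Analysis"
begin

text \<open>
  The model spaces are types of class \<open>real_inner\<close> with a finite orthonormal basis, i.e. copies of
  \<open>\<real>\<^sup>n\<close> with \<open>n = card B\<close>. The class \<open>euclidean_space\<close> is not used because it excludes
  \<open>n = 0\<close> (zero-dimensional manifolds, bundles of rank zero).
\<close>

definition is_Rn :: "'a::real_inner itself \<Rightarrow> bool" where
  "is_Rn _ \<longleftrightarrow> (\<exists>B::'a set. finite B \<and> span B = UNIV \<and>
     (\<forall>u\<in>B. \<forall>v\<in>B. u \<bullet> v = (if u = v then 1 else 0)))"

lemma is_Rn_euclidean_space: "is_Rn TYPE('a::euclidean_space)"
  unfolding is_Rn_def by (intro exI[of _ Basis]) (auto simp: inner_Basis span_Basis)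

text \<open>Both notions are meant for an open set \<open>S\<close> in a finite-dimensional domain.\<close>

primrec Ck_on :: "nat \<Rightarrow> 'a::real_normed_vector set \<Rightarrow> ('a \<Rightarrow> 'b::real_normed_vector) \<Rightarrow> bool" where
  "Ck_on 0 S f \<longleftrightarrow> continuous_on S f"
| "Ck_on (Suc k) S f \<longleftrightarrow> (\<forall>x\<in>S. f differentiable (at x)) \<and>
     (\<forall>v. Ck_on k S (\<lambda>x. frechet_derivative f (at x) v))"

definition smooth_on :: "'a::real_normed_vector set \<Rightarrow> ('a \<Rightarrow> 'b::real_normed_vector) \<Rightarrow> bool" where
  "smooth_on S f \<longleftrightarrow> (\<forall>k. Ck_on k S f)"

text \<open>
  The manifold is the whole type \<open>'m\<close>; a chart is a pair of an open domain and a coordinate map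
  whose values outside the domain are irrelevant. The atlas need not be maximal.
\<close>

locale smooth_manifold =
  fixes atlas :: "('m::{t2_space,second_countable_topology} set \<times> ('m \<Rightarrow> 'b::real_inner)) set"
  assumes model_space: "is_Rn TYPE('b)"
    and chart: "(U, \<phi>) \<in> atlas \<Longrightarrow>
      open U \<and> open (\<phi> ` U) \<and> homeomorphism U (\<phi> ` U) \<phi> (inv_into U \<phi>)"
    and charts_cover: "\<exists>(U, \<phi>)\<in>atlas. x \<in> U"
    and charts_compatible: "(U, \<phi>) \<in> atlas \<Longrightarrow> (V, \<psi>) \<in> atlas \<Longrightarrow>
      smooth_on (\<phi> ` (U \<inter> V)) (\<psi> \<circ> inv_into U \<phi>)"
begin

definition smooth_map_on :: "'m set \<Rightarrow> ('m \<Rightarrow> 'c::real_normed_vector) \<Rightarrow> bool" where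
  "smooth_map_on W f \<longleftrightarrow> (\<forall>(U, \<phi>)\<in>atlas. smooth_on (\<phi> ` (U \<inter> W)) (f \<circ> inv_into U \<phi>))"

definition smooth_functions :: "('m \<Rightarrow> real) set" where
  "smooth_functions = {f. smooth_map_on UNIV f}"

text \<open>
  Tangent vectors are derivations at \<open>x\<close> of the algebra of smooth functions. They are set to 0 on
  functions that are not smooth, so that equality in HOL is equality of tangent vectors.
\<close>

definition tangent_space :: "'m \<Rightarrow> (('m \<Rightarrow> real) \<Rightarrow> real) set" where
  "tangent_space x = {X.
     (\<forall>f. f \<notin> smooth_functions \<longrightarrow> X f = 0) \<and>
     (\<forall>a. \<forall>f\<in>smooth_functions. \<forall>h\<in>smooth_functions. X (\<lambda>y. a * f y + h y) = a * X f + X h) \<and>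
     (\<forall>f\<in>smooth_functions. \<forall>h\<in>smooth_functions. X (\<lambda>y. f y * h y) = f x * X h + h x * X f)}"

definition lie_bracket ::
  "('m \<Rightarrow> ('m \<Rightarrow> real) \<Rightarrow> real) \<Rightarrow> ('m \<Rightarrow> ('m \<Rightarrow> real) \<Rightarrow> real) \<Rightarrow> 'm \<Rightarrow> ('m \<Rightarrow> real) \<Rightarrow> real" where
  "lie_bracket X Y x f =
     (if f \<in> smooth_functions then X x (\<lambda>y. Y y f) - Y x (\<lambda>y. X y f) else 0)"

definition differential :: "('m \<Rightarrow> real) \<Rightarrow> 'm \<Rightarrow> (('m \<Rightarrow> real) \<Rightarrow> real) \<Rightarrow> real" where
  "differential f x X = X f"

end

text \<open>
  The total space is \<open>{(x, v). v \<in> E x}\<close>, where each fibre \<open>E x\<close> is a linear subspace of a real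
  vector space \<open>'v\<close> that carries no further structure; topology and smooth structure come from the
  local trivialisations \<open>(U, \<tau>)\<close>, i.e. \<open>(x, v) \<mapsto> (x, \<tau> x v)\<close> from the part of the total space
  over \<open>U\<close> to \<open>U \<times> 'f\<close>. As \<open>'f\<close> is finite-dimensional, a transition map is smooth iff it is
  smooth in \<open>x\<close> on each fixed vector.
\<close>

locale smooth_vector_bundle = smooth_manifold atlas
  for atlas :: "('m::{t2_space,second_countable_topology} set \<times> ('m \<Rightarrow> 'b::real_inner)) set" +
  fixes E :: "'m \<Rightarrow> 'v::real_vector set"
    and triv :: "('m set \<times> ('m \<Rightarrow> 'v \<Rightarrow> 'f::real_inner)) set"
  assumes model_fibre: "is_Rn TYPE('f)"
    and fibre_subspace: "subspace (E x)"
    and triv_open: "(U, \<tau>) \<in> triv \<Longrightarrow> open U"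
    and triv_bij: "(U, \<tau>) \<in> triv \<Longrightarrow> x \<in> U \<Longrightarrow> bij_betw (\<tau> x) (E x) UNIV"
    and triv_linear: "(U, \<tau>) \<in> triv \<Longrightarrow> x \<in> U \<Longrightarrow> v \<in> E x \<Longrightarrow> w \<in> E x \<Longrightarrow>
      \<tau> x (a *\<^sub>R v + w) = a *\<^sub>R \<tau> x v + \<tau> x w"
    and triv_cover: "\<exists>(U, \<tau>)\<in>triv. x \<in> U"
    and triv_compatible: "(U, \<tau>) \<in> triv \<Longrightarrow> (V, \<sigma>) \<in> triv \<Longrightarrow>
      smooth_map_on (U \<inter> V) (\<lambda>x. \<sigma> x (inv_into (E x) (\<tau> x) s))"
begin

definition sections :: "('m \<Rightarrow> 'v) set" where
  "sections = {\<psi>. (\<forall>x. \<psi> x \<in> E x) \<and> (\<forall>(U, \<tau>)\<in>triv. smooth_map_on U (\<lambda>x. \<tau> x (\<psi> x)))}"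

end

text \<open>
  \<open>p\<close>-forms on \<open>V\<close> are functions of lists of length \<open>p\<close> over \<open>V\<close>, and 0 on all other lists.
\<close>

definition alternating_forms :: "'v::real_vector set \<Rightarrow> nat \<Rightarrow> ('v list \<Rightarrow> real) set" where
  "alternating_forms V p = {a.
     (\<forall>vs. \<not> (length vs = p \<and> set vs \<subseteq> V) \<longrightarrow> a vs = 0) \<and>
     (\<forall>vs i c. \<forall>v\<in>V. \<forall>w\<in>V. length vs = p \<and> set vs \<subseteq> V \<and> i < p \<longrightarrow>
        a (vs[i := c *\<^sub>R v + w]) = c * a (vs[i := v]) + a (vs[i := w])) \<and>
     (\<forall>vs i j. length vs = p \<and> set vs \<subseteq> V \<and> i < j \<and> j < p \<and> vs ! i = vs ! j \<longrightarrow> a vs = 0)}"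

definition omit :: "nat set \<Rightarrow> 'a list \<Rightarrow> 'a list" where
  "omit I xs = nths xs (- I)"

text \<open>
  The wedge product of a \<open>p\<close>-form and a \<open>q\<close>-form is the sum over all \<open>(p, q)\<close>-shuffles, without
  normalising factor. A shuffle is given by the set \<open>I\<close> of positions that go to the first factor;
  sets \<open>I\<close> of the wrong size contribute 0. In particular, a wedge product of 1-forms evaluates to
  a determinant.
\<close>

definition shuffle_sign :: "nat set \<Rightarrow> real" where
  "shuffle_sign I = (-1) ^ card {(i, j). i \<in> I \<and> j \<notin> I \<and> j < i}"

definition wedge :: "('v list \<Rightarrow> real) \<Rightarrow> ('v list \<Rightarrow> real) \<Rightarrow> 'v list \<Rightarrow> real" where
  "wedge a b vs = (\<Sum>I\<in>Pow {..<length vs}. shuffle_sign I * a (nths vs I) * b (omit I vs))"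

text \<open>
  Smoothness of the fibre metric and of the anchor is stated for the local frames given by the
  trivialisations; for the anchor it says that the image of a local frame consists of smooth vector
  fields, where a vector field is smooth iff it maps smooth functions to smooth functions.
\<close>

locale metric_anchored_bundle = smooth_vector_bundle atlas E triv
  for atlas :: "('m::{t2_space,second_countable_topology} set \<times> ('m \<Rightarrow> 'b::real_inner)) set"
    and E :: "'m \<Rightarrow> 'v::real_vector set"
    and triv :: "('m set \<times> ('m \<Rightarrow> 'v \<Rightarrow> 'f::real_inner)) set" +
  fixes g :: "'m \<Rightarrow> 'v \<Rightarrow> 'v \<Rightarrow> real"
    and \<rho> :: "'m \<Rightarrow> 'v \<Rightarrow> ('m \<Rightarrow> real) \<Rightarrow> real"
  assumes metric_linear: "u \<in> E x \<Longrightarrow> v \<in> E x \<Longrightarrow> w \<in> E x \<Longrightarrow>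
      g x (a *\<^sub>R u + v) w = a * g x u w + g x v w"
    and metric_sym: "u \<in> E x \<Longrightarrow> v \<in> E x \<Longrightarrow> g x u v = g x v u"
    and metric_nondegenerate: "u \<in> E x \<Longrightarrow> (\<forall>v\<in>E x. g x u v = 0) \<Longrightarrow> u = 0"
    and metric_smooth: "(U, \<tau>) \<in> triv \<Longrightarrow>
      smooth_map_on U (\<lambda>x. g x (inv_into (E x) (\<tau> x) s) (inv_into (E x) (\<tau> x) t))"
    and anchor_tangent: "u \<in> E x \<Longrightarrow> \<rho> x u \<in> tangent_space x"
    and anchor_linear: "u \<in> E x \<Longrightarrow> v \<in> E x \<Longrightarrow> \<rho> x (a *\<^sub>R u + v) f = a * \<rho> x u f + \<rho> x v f"
    and anchor_smooth: "(U, \<tau>) \<in> triv \<Longrightarrow> f \<in> smooth_functions \<Longrightarrow>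
      smooth_map_on U (\<lambda>x. \<rho> x (inv_into (E x) (\<tau> x) s) f)"
begin

text \<open>The dual \<open>\<rho>\<^sup>*\<close> of the anchor at \<open>x\<close>, with the dual of \<open>E x\<close> identified with \<open>E x\<close> by \<open>g\<close>.\<close>

definition anchor_dual :: "'m \<Rightarrow> ((('m \<Rightarrow> real) \<Rightarrow> real) \<Rightarrow> real) \<Rightarrow> 'v" where
  "anchor_dual x \<xi> = (THE u. u \<in> E x \<and> (\<forall>v\<in>E x. g x u v = \<xi> (\<rho> x v)))"

text \<open>
  The fibre of the \<open>p\<close>-th exterior power of \<open>E\<close> at \<open>x\<close> is identified, by means of \<open>g\<close>, with the
  space of alternating \<open>p\<close>-forms on \<open>E x\<close>.
\<close>

definition form_sections :: "nat \<Rightarrow> ('m \<Rightarrow> 'v list \<Rightarrow> real) set" where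
  "form_sections p = {\<alpha>. (\<forall>x. \<alpha> x \<in> alternating_forms (E x) p) \<and>
     (\<forall>(U, \<tau>)\<in>triv. \<forall>ss. length ss = p \<longrightarrow>
        smooth_map_on U (\<lambda>x. \<alpha> x (map (inv_into (E x) (\<tau> x)) ss)))}"

definition flat :: "'m \<Rightarrow> 'v \<Rightarrow> 'v list \<Rightarrow> real" where
  "flat x v ws = (if length ws = 1 \<and> set ws \<subseteq> E x then g x v (hd ws) else 0)"

primrec decomposable :: "'m \<Rightarrow> 'v list \<Rightarrow> 'v list \<Rightarrow> real" where
  "decomposable x [] = (\<lambda>ws. if ws = [] then 1 else 0)"
| "decomposable x (v # vs) = wedge (flat x v) (decomposable x vs)"

text \<open>
  An element \<open>X \<otimes> b\<close> of the tensor product of the tangent space with a space of forms is represented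
  by the function \<open>(f, ws) \<mapsto> X f * b ws\<close>; the induced linear map from the tensor product into
  functions of two arguments is injective. The map \<open>anchor_tilde\<close> is the linear extension of its
  values on decomposable elements, given by \<open>anchor_tilde_decomposable\<close>.
\<close>

definition anchor_tilde_decomposable :: "'m \<Rightarrow> 'v list \<Rightarrow> ('m \<Rightarrow> real) \<Rightarrow> 'v list \<Rightarrow> real" where
  "anchor_tilde_decomposable x vs f ws =
     (\<Sum>i<length vs. (-1) ^ i * (\<rho> x (vs ! i) f * decomposable x (omit {i} vs) ws))"

definition anchor_tilde :: "'m \<Rightarrow> nat \<Rightarrow> ('v list \<Rightarrow> real) \<Rightarrow> ('m \<Rightarrow> real) \<Rightarrow> 'v list \<Rightarrow> real" where
  "anchor_tilde x p a = (THE t. \<exists>cs. (\<forall>(c, vs)\<in>set cs. length vs = p \<and> set vs \<subseteq> E x) \<and>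
     a = (\<lambda>ws. \<Sum>(c, vs)\<leftarrow>cs. c * decomposable x vs ws) \<and>
     t = (\<lambda>f ws. \<Sum>(c, vs)\<leftarrow>cs. c * anchor_tilde_decomposable x vs f ws))"

definition Omega_ker :: "nat \<Rightarrow> ('m \<Rightarrow> 'v list \<Rightarrow> real) set" where
  "Omega_ker p = {\<alpha> \<in> form_sections p. \<forall>x. anchor_tilde x p (\<alpha> x) = (\<lambda>f ws. 0)}"

definition eval_form :: "('m \<Rightarrow> 'v list \<Rightarrow> real) \<Rightarrow> ('m \<Rightarrow> 'v) list \<Rightarrow> 'm \<Rightarrow> real" where
  "eval_form \<alpha> \<psi>s x = \<alpha> x (map (\<lambda>\<psi>. \<psi> x) \<psi>s)"

end

locale strongly_anchored_almost_courant_algebroid = metric_anchored_bundle atlas E triv g \<rho>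
  for atlas :: "('m::{t2_space,second_countable_topology} set \<times> ('m \<Rightarrow> 'b::real_inner)) set"
    and E :: "'m \<Rightarrow> 'v::real_vector set"
    and triv :: "('m set \<times> ('m \<Rightarrow> 'v \<Rightarrow> 'f::real_inner)) set"
    and g :: "'m \<Rightarrow> 'v \<Rightarrow> 'v \<Rightarrow> real"
    and \<rho> :: "'m \<Rightarrow> 'v \<Rightarrow> ('m \<Rightarrow> real) \<Rightarrow> real" +
  fixes br :: "('m \<Rightarrow> 'v) \<Rightarrow> ('m \<Rightarrow> 'v) \<Rightarrow> 'm \<Rightarrow> 'v"
  assumes bracket_section: "\<phi> \<in> sections \<Longrightarrow> \<psi> \<in> sections \<Longrightarrow> br \<phi> \<psi> \<in> sections"
    and bracket_linear_left: "\<phi> \<in> sections \<Longrightarrow> \<eta> \<in> sections \<Longrightarrow> \<psi> \<in> sections \<Longrightarrow>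
      br (\<lambda>x. a *\<^sub>R \<phi> x + \<eta> x) \<psi> = (\<lambda>x. a *\<^sub>R br \<phi> \<psi> x + br \<eta> \<psi> x)"
    and bracket_linear_right: "\<phi> \<in> sections \<Longrightarrow> \<psi> \<in> sections \<Longrightarrow> \<eta> \<in> sections \<Longrightarrow>
      br \<phi> (\<lambda>x. a *\<^sub>R \<psi> x + \<eta> x) = (\<lambda>x. a *\<^sub>R br \<phi> \<psi> x + br \<phi> \<eta> x)"
    and anchor_bracket: "\<phi> \<in> sections \<Longrightarrow> \<psi> \<in> sections \<Longrightarrow>
      \<rho> x (br \<phi> \<psi> x) = lie_bracket (\<lambda>y. \<rho> y (\<phi> y)) (\<lambda>y. \<rho> y (\<psi> y)) x"
    and bracket_Leibniz: "\<phi> \<in> sections \<Longrightarrow> \<psi> \<in> sections \<Longrightarrow> f \<in> smooth_functions \<Longrightarrow>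
      br \<phi> (\<lambda>x. f x *\<^sub>R \<psi> x) = (\<lambda>x. \<rho> x (\<phi> x) f *\<^sub>R \<psi> x + f x *\<^sub>R br \<phi> \<psi> x)"
    and bracket_self: "\<psi> \<in> sections \<Longrightarrow>
      br \<psi> \<psi> x = (1/2) *\<^sub>R anchor_dual x (differential (\<lambda>y. g y (\<psi> y) (\<psi> y)) x)"
    and bracket_metric: "\<phi> \<in> sections \<Longrightarrow> \<psi> \<in> sections \<Longrightarrow>
      \<rho> x (\<phi> x) (\<lambda>y. g y (\<psi> y) (\<psi> y)) = 2 * g x (br \<phi> \<psi> x) (\<psi> x)"
begin

definition D_rhs :: "('m \<Rightarrow> 'v list \<Rightarrow> real) \<Rightarrow> ('m \<Rightarrow> 'v) list \<Rightarrow> 'm \<Rightarrow> real" where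
  "D_rhs \<alpha> \<psi>s x =
     (\<Sum>i<length \<psi>s. (-1) ^ i * \<rho> x ((\<psi>s ! i) x) (eval_form \<alpha> (omit {i} \<psi>s))) +
     (\<Sum>(i, j)\<in>{(i, j). i < j \<and> j < length \<psi>s}.
        (-1) ^ (i + j) * eval_form \<alpha> (br (\<psi>s ! i) (\<psi>s ! j) # omit {i, j} \<psi>s) x)"

definition D :: "nat \<Rightarrow> ('m \<Rightarrow> 'v list \<Rightarrow> real) \<Rightarrow> 'm \<Rightarrow> 'v list \<Rightarrow> real" where
  "D p \<alpha> = (THE \<omega>. \<omega> \<in> form_sections (Suc p) \<and>
     (\<forall>\<psi>s. length \<psi>s = Suc p \<and> set \<psi>s \<subseteq> sections \<longrightarrow> eval_form \<omega> \<psi>s = D_rhs \<alpha> \<psi>s))"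

end

end

theory Submission
  imports Defs
begin

text \<open>
  Write \<open>\<nabla>f\<close> for the value of the dual \<open>\<rho>\<^sup>*\<close> of the anchor on \<open>df\<close>, so that \<open>\<langle>\<nabla>f, \<psi>\<rangle> = \<rho>(\<psi>) f\<close>; it is
  called \<open>anchor_gradient\<close> below. A form is annihilated by the extended anchor iff it vanishes as
  soon as one of its arguments is a \<open>\<nabla>f\<close> (\<open>Omega_ker_iff\<close>). The bracket fails to be skew by a
  gradient, \<open>[\<phi>, \<psi>] + [\<psi>, \<phi>] = \<nabla>\<langle>\<phi>, \<psi>\<rangle>\<close>, hence the defining formula of \<open>\<D>\<close> behaves on such forms as it
  does on a Lie algebroid.

  All algebraic statements follow from Cartan's formula \<open>\<iota>(\<phi>) \<D> = L(\<phi>) - \<D> \<iota>(\<phi>)\<close> (\<open>D_rhs_Cons\<close>)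
  by induction on the number of arguments, since contraction by a section preserves the kernel:
  \<^item> \<open>\<D>\<alpha>\<close> vanishes if its first two arguments agree, because \<open>\<alpha>\<close> is then evaluated on
    \<open>[\<phi>, \<phi>] = \<nabla>\<langle>\<phi>, \<phi>\<rangle> / 2\<close> (\<open>D_rhs_repeat_head\<close>).
  \<^item> \<open>\<D>\<alpha>\<close> is function-linear in every argument but the first by the Leibniz rule of the bracket, and
    in the first one by exchanging it with the second (\<open>D_rhs_linear\<close>).
  \<^item> The product rule holds because \<open>L(\<phi>)\<close> is a derivation and \<open>\<iota>(\<phi>)\<close> an antiderivation of the wedge
    product (\<open>D_rhs_wedge\<close>).

  Function-linearity makes \<open>\<D>\<alpha>\<close> a form on every fibre. With bump functions, vectors and local frames
  extend to global sections; this gives uniqueness, existence and smoothness (\<open>D_form_form_section\<close>).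

  For the kernel, let \<open>s = [\<phi>, \<psi>] + [\<psi>, \<phi>]\<close>. Then \<open>\<rho>(s) = 0\<close>, and \<open>[s, \<eta>]\<close> is again a gradient
  at every point, because \<open>[\<eta>, \<nabla>h] = \<nabla>(\<rho>(\<eta>) h)\<close> by compatibility of the bracket with metric and anchor
  (\<open>bracket_gradient\<close>). By Cartan's formula \<open>\<D>\<alpha>\<close> vanishes on \<open>s\<close>, and every \<open>\<nabla>f\<close> is, at a given point,
  a combination of such sections (\<open>D_Omega_ker\<close>).
\<close>

section \<open>Smooth functions on open sets of a normed space\<close>

lemma frechet_derivative_cong_open:
  assumes "open S" "x \<in> S" "\<And>y. y \<in> S \<Longrightarrow> f y = h y"
  shows "frechet_derivative f (at x) = frechet_derivative h (at x)"
    and "f differentiable (at x) \<longleftrightarrow> h differentiable (at x)"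
proof -
  have "(f has_derivative D) (at x) \<longleftrightarrow> (h has_derivative D) (at x)" for D
    using has_derivative_transform_within_open[OF _ assms(1,2)] assms(3) by metis
  then show "frechet_derivative f (at x) = frechet_derivative h (at x)"
    "f differentiable (at x) \<longleftrightarrow> h differentiable (at x)"
    by (simp_all add: frechet_derivative_def differentiable_def)
qed

lemma Ck_on_cong:
  assumes "open S" "\<And>y. y \<in> S \<Longrightarrow> f y = h y"
  shows "Ck_on k S f \<longleftrightarrow> Ck_on k S h"
  using assms(2)
proof (induction k arbitrary: f h)
  case 0
  then show ?case by (simp cong: continuous_on_cong)
next
  case (Suc k)
  show ?case
    using frechet_derivative_cong_open[OF assms(1) _ Suc.prems]
      Suc.IH[of "\<lambda>x. frechet_derivative f (at x) v" "\<lambda>x. frechet_derivative h (at x) v" for v]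
    by simp
qed

lemma Ck_on_subset: "Ck_on k S f \<Longrightarrow> T \<subseteq> S \<Longrightarrow> Ck_on k T f"
  by (induction k arbitrary: f) (auto intro: continuous_on_subset)

lemma Ck_on_local:
  assumes "\<And>x. x \<in> S \<Longrightarrow> \<exists>T. open T \<and> x \<in> T \<and> Ck_on k T f"
  shows "Ck_on k S f"
  using assms
proof (induction k arbitrary: f)
  case 0
  have "isCont f x" if "x \<in> S" for x
    using 0[OF that] by (auto simp: continuous_on_eq_continuous_at)
  then show ?case by (simp add: continuous_at_imp_continuous_on)
next
  case (Suc k)
  have "f differentiable (at x)" if "x \<in> S" for x
    using Suc.prems[OF that] by auto
  moreover have "Ck_on k S (\<lambda>x. frechet_derivative f (at x) v)" for v
    by (rule Suc.IH) (use Suc.prems in fastforce)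
  ultimately show ?case by simp
qed

lemma Ck_on_SucD: "Ck_on (Suc k) S f \<Longrightarrow> Ck_on k S f"
proof (induction k arbitrary: f)
  case 0
  then show ?case
    by (auto intro!: continuous_at_imp_continuous_on differentiable_imp_continuous_within)
next
  case (Suc k)
  then show ?case by (metis Ck_on.simps(2))
qed

lemma Ck_on_const: "Ck_on k S (\<lambda>x. c)"
  by (induction k arbitrary: c) auto

lemma Ck_on_SucI:
  assumes "open S" "\<And>x. x \<in> S \<Longrightarrow> (f has_derivative D x) (at x)" "\<And>v. Ck_on k S (\<lambda>x. D x v)"
  shows "Ck_on (Suc k) S f"
proof -
  have "frechet_derivative f (at x) = D x" if "x \<in> S" for x
    using assms(2)[OF that] frechet_derivative_at by metis
  then have "Ck_on k S (\<lambda>x. frechet_derivative f (at x) v)" for v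
    using assms(3)[of v] Ck_on_cong[OF assms(1), of "\<lambda>x. frechet_derivative f (at x) v" "\<lambda>x. D x v" k]
    by simp
  then show ?thesis
    using assms(2) by (auto simp: differentiable_def)
qed

lemma Ck_on_SucE:
  assumes "Ck_on (Suc k) S f"
  obtains D where "\<And>x. x \<in> S \<Longrightarrow> (f has_derivative D x) (at x)" "\<And>v. Ck_on k S (\<lambda>x. D x v)"
  using assms that[of "\<lambda>x. frechet_derivative f (at x)"] by (auto simp: frechet_derivative_works)

lemma Ck_on_add:
  assumes "open S" "Ck_on k S f" "Ck_on k S h"
  shows "Ck_on k S (\<lambda>x. f x + h x)"
  using assms(2,3)
proof (induction k arbitrary: f h)
  case 0
  then show ?case by (auto intro: continuous_intros)
next
  case (Suc k)
  obtain Df Dh where "\<And>x. x \<in> S \<Longrightarrow> (f has_derivative Df x) (at x)" "\<And>v. Ck_on k S (\<lambda>x. Df x v)"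
    and "\<And>x. x \<in> S \<Longrightarrow> (h has_derivative Dh x) (at x)" "\<And>v. Ck_on k S (\<lambda>x. Dh x v)"
    using Suc.prems by (metis Ck_on_SucE)
  then show ?case
    by (intro Ck_on_SucI[OF assms(1), where D = "\<lambda>x v. Df x v + Dh x v"])
      (auto intro: has_derivative_add Suc.IH)
qed

text \<open>One product rule serves the products of functions, of a function and a vector field, and
  the inner product.\<close>

lemma Ck_on_bilinear:
  assumes "bounded_bilinear pr" "open S" "Ck_on k S f" "Ck_on k S h"
  shows "Ck_on k S (\<lambda>x. pr (f x) (h x))"
  using assms(3,4)
proof (induction k arbitrary: f h)
  case 0
  then show ?case by (auto intro: bounded_bilinear.continuous_on[OF assms(1)])
next
  case (Suc k)
  obtain Df Dh where D: "\<And>x. x \<in> S \<Longrightarrow> (f has_derivative Df x) (at x)" "\<And>v. Ck_on k S (\<lambda>x. Df x v)"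
    "\<And>x. x \<in> S \<Longrightarrow> (h has_derivative Dh x) (at x)" "\<And>v. Ck_on k S (\<lambda>x. Dh x v)"
    using Suc.prems by (metis Ck_on_SucE)
  show ?case
  proof (rule Ck_on_SucI[OF assms(2), where D = "\<lambda>x v. pr (f x) (Dh x v) + pr (Df x v) (h x)"])
    show "((\<lambda>x. pr (f x) (h x)) has_derivative (\<lambda>v. pr (f x) (Dh x v) + pr (Df x v) (h x))) (at x)"
      if "x \<in> S" for x
      using bounded_bilinear.FDERIV[OF assms(1) D(1)[OF that] D(3)[OF that]] .
    show "Ck_on k S (\<lambda>x. pr (f x) (Dh x v) + pr (Df x v) (h x))" for v
      using Suc.prems[THEN Ck_on_SucD] D(2,4)
      by (intro Ck_on_add[OF assms(2)] Suc.IH) auto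
  qed
qed

lemma Ck_on_compose_real:
  fixes f :: "'a::real_normed_vector \<Rightarrow> real"
  assumes H: "\<And>n t. (H n has_real_derivative H (Suc n) t) (at t)"
    and "open S" "Ck_on k S f"
  shows "Ck_on k S (\<lambda>x. H n (f x))"
  using assms(3)
proof (induction k arbitrary: n)
  case 0
  have "continuous_on UNIV (H n)"
    using H by (meson DERIV_isCont continuous_at_imp_continuous_on)
  then show ?case
    using 0 by (auto intro: continuous_on_compose2)
next
  case (Suc k)
  obtain Df where D: "\<And>x. x \<in> S \<Longrightarrow> (f has_derivative Df x) (at x)" "\<And>v. Ck_on k S (\<lambda>x. Df x v)"
    using Suc.prems by (metis Ck_on_SucE)
  show ?case
  proof (rule Ck_on_SucI[OF assms(2), where D = "\<lambda>x v. H (Suc n) (f x) * Df x v"])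
    show "((\<lambda>x. H n (f x)) has_derivative (\<lambda>v. H (Suc n) (f x) * Df x v)) (at x)" if "x \<in> S" for x
      using has_derivative_compose[OF D(1)[OF that] H[of n "f x", unfolded has_field_derivative_def]]
      by simp
    show "Ck_on k S (\<lambda>x. H (Suc n) (f x) * Df x v)" for v
      using Suc D(2) Ck_on_SucD
      by (intro Ck_on_bilinear[OF bounded_bilinear_mult assms(2)]) blast+
  qed
qed

lemma Ck_on_inverse:
  fixes f :: "'a::real_normed_vector \<Rightarrow> real"
  assumes "open S" "Ck_on k S f" "\<And>x. x \<in> S \<Longrightarrow> f x \<noteq> 0"
  shows "Ck_on k S (\<lambda>x. inverse (f x))"
  using assms(2)
proof (induction k)
  case 0
  then show ?case using assms(3) by (auto intro: continuous_intros)
next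
  case (Suc k)
  obtain Df where D: "\<And>x. x \<in> S \<Longrightarrow> (f has_derivative Df x) (at x)" "\<And>v. Ck_on k S (\<lambda>x. Df x v)"
    using Suc.prems by (metis Ck_on_SucE)
  have I: "Ck_on k S (\<lambda>x. inverse (f x))"
    using Suc Ck_on_SucD by blast
  show ?case
  proof (rule Ck_on_SucI[OF assms(1), where D = "\<lambda>x v. (inverse (f x) * Df x v * inverse (f x)) * (-1)"])
    show "((\<lambda>x. inverse (f x)) has_derivative (\<lambda>v. (inverse (f x) * Df x v * inverse (f x)) * (-1))) (at x)"
      if "x \<in> S" for x
      using Deriv.has_derivative_inverse[OF assms(3)[OF that] D(1)[OF that]] by simp
    show "Ck_on k S (\<lambda>x. (inverse (f x) * Df x v * inverse (f x)) * (-1))" for v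
      by (intro Ck_on_bilinear[OF bounded_bilinear_mult assms(1)] I D(2) Ck_on_const)
  qed
qed

text \<open>All derivatives of \<open>t \<mapsto> exp (- 1 / t)\<close> have the form \<open>p (1 / t) * exp (- 1 / t)\<close> with a
  polynomial \<open>p\<close>, and all such functions extend by 0 to the negative half-line.\<close>

definition flat_fun :: "real poly \<Rightarrow> real \<Rightarrow> real" where
  "flat_fun p t = (if t \<le> 0 then 0 else poly p (inverse t) * exp (- inverse t))"

definition flat_step :: "real poly \<Rightarrow> real poly" where
  "flat_step p = [:0, 0, 1:] * (p - pderiv p)"

lemma poly_times_exp_tendsto_0: "((\<lambda>s::real. poly p s * exp (- s)) \<longlongrightarrow> 0) at_top"
proof -
  have "((\<lambda>s::real. \<Sum>i\<le>degree p. coeff p i * (s ^ i / exp s)) \<longlongrightarrow> (\<Sum>i\<le>degree p. coeff p i * 0)) at_top"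
    by (intro tendsto_intros tendsto_power_div_exp_0)
  then show ?thesis
    by (simp add: poly_altdef exp_minus sum_distrib_right divide_inverse mult.assoc)
qed

lemma flat_fun_tendsto_0: "(flat_fun p \<longlongrightarrow> 0) (at_right 0)"
proof -
  have "((\<lambda>t. poly p (inverse t) * exp (- inverse t)) \<longlongrightarrow> 0) (at_right (0::real))"
    using filterlim_compose[OF poly_times_exp_tendsto_0 filterlim_inverse_at_top_right] .
  then show ?thesis
    by (rule Lim_transform_eventually) (auto simp: flat_fun_def eventually_at_right_less
        intro!: eventually_mono[OF eventually_at_right_less])
qed

lemma flat_fun_derivative: "(flat_fun p has_real_derivative flat_fun (flat_step p) t) (at t)"
proof -
  consider "t < 0" | "t = 0" | "t > 0" by linarith
  then show ?thesis
  proof cases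
    case 1
    have "((\<lambda>_. 0) has_real_derivative 0) (at t)" by simp
    moreover have "\<forall>\<^sub>F y in nhds t. (0::real) = flat_fun p y"
      using 1 eventually_nhds_in_open[of "{..<0}" t] by (auto simp: flat_fun_def elim!: eventually_mono)
    ultimately show ?thesis
      using 1 by (simp add: DERIV_cong_ev[OF refl _ refl] flat_fun_def)
  next
    case 3
    have "((\<lambda>t. poly p (inverse t) * exp (- inverse t)) has_real_derivative
        flat_fun (flat_step p) t) (at t)"
      using 3 by (auto intro!: derivative_eq_intros
          simp: flat_fun_def flat_step_def field_simps power2_eq_square)
    moreover have "\<forall>\<^sub>F y in nhds t. poly p (inverse y) * exp (- inverse y) = flat_fun p y"
      using 3 eventually_nhds_in_open[of "{0<..}" t] by (auto simp: flat_fun_def elim!: eventually_mono)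
    ultimately show ?thesis
      by (simp add: DERIV_cong_ev[OF refl _ refl])
  next
    case 2
    have zero: "flat_fun q 0 = 0" for q
      by (simp add: flat_fun_def)
    have eq: "flat_fun p h / h = flat_fun (pCons 0 p) h" for h
      by (auto simp: flat_fun_def field_simps)
    have "(flat_fun (pCons 0 p) \<longlongrightarrow> 0) (at_left 0)"
      by (rule tendsto_eventually) (auto simp: flat_fun_def eventually_at_filter)
    then have "(flat_fun (pCons 0 p) \<longlongrightarrow> 0) (at 0)"
      using flat_fun_tendsto_0 by (simp add: filterlim_at_split)
    then show ?thesis
      using 2 by (simp add: has_field_derivative_iff zero eq)
  qed
qed

lemma smooth_on_cong:
  "open S \<Longrightarrow> (\<And>y. y \<in> S \<Longrightarrow> f y = h y) \<Longrightarrow> smooth_on S f \<longleftrightarrow> smooth_on S h"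
  using Ck_on_cong unfolding smooth_on_def by blast

lemma smooth_on_subset: "smooth_on S f \<Longrightarrow> T \<subseteq> S \<Longrightarrow> smooth_on T f"
  using Ck_on_subset unfolding smooth_on_def by blast

lemma smooth_on_local:
  assumes "\<And>x. x \<in> S \<Longrightarrow> \<exists>T. open T \<and> x \<in> T \<and> smooth_on T f"
  shows "smooth_on S f"
  unfolding smooth_on_def by (intro allI Ck_on_local) (use assms smooth_on_def in blast)

lemma smooth_on_const: "smooth_on S (\<lambda>x. c)"
  by (simp add: smooth_on_def Ck_on_const)

lemma smooth_on_add:
  "open S \<Longrightarrow> smooth_on S f \<Longrightarrow> smooth_on S h \<Longrightarrow> smooth_on S (\<lambda>x. f x + h x)"
  by (simp add: smooth_on_def Ck_on_add)

lemma smooth_on_bilinear: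
  "bounded_bilinear pr \<Longrightarrow> open S \<Longrightarrow> smooth_on S f \<Longrightarrow> smooth_on S h \<Longrightarrow>
    smooth_on S (\<lambda>x. pr (f x) (h x))"
  by (simp add: smooth_on_def Ck_on_bilinear)

lemma smooth_on_inverse:
  fixes f :: "'a::real_normed_vector \<Rightarrow> real"
  shows "open S \<Longrightarrow> smooth_on S f \<Longrightarrow> (\<And>x. x \<in> S \<Longrightarrow> f x \<noteq> 0) \<Longrightarrow> smooth_on S (\<lambda>x. inverse (f x))"
  by (simp add: smooth_on_def Ck_on_inverse)

lemma smooth_on_flat_fun:
  fixes f :: "'a::real_normed_vector \<Rightarrow> real"
  assumes "open S" "smooth_on S f"
  shows "smooth_on S (\<lambda>x. flat_fun 1 (f x))"
proof -
  define H where "H n = flat_fun ((flat_step ^^ n) 1)" for n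
  have "(H n has_real_derivative H (Suc n) t) (at t)" for n t
    using flat_fun_derivative unfolding H_def by simp
  then have "smooth_on S (\<lambda>x. H 0 (f x))"
    using assms Ck_on_compose_real unfolding smooth_on_def by blast
  then show ?thesis by (simp add: H_def)
qed

section \<open>Finite-dimensional inner product spaces\<close>

definition orthonormal_basis :: "'a::real_inner set \<Rightarrow> bool" where
  "orthonormal_basis B \<longleftrightarrow> finite B \<and> span B = UNIV \<and>
     (\<forall>u\<in>B. \<forall>v\<in>B. u \<bullet> v = (if u = v then 1 else 0))"

lemma orthonormal_basis_coordinate:
  assumes "orthonormal_basis B" "a \<in> B"
  shows "(\<Sum>b\<in>B. c b *\<^sub>R b) \<bullet> a = c a"
proof -
  have "(\<Sum>b\<in>B. c b *\<^sub>R b) \<bullet> a = (\<Sum>b\<in>B. if b = a then c a else 0)"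
    unfolding inner_sum_left using assms by (intro sum.cong) (auto simp: orthonormal_basis_def)
  then show ?thesis using assms by (simp add: orthonormal_basis_def)
qed

lemma orthonormal_basis_expand:
  assumes "orthonormal_basis B"
  shows "v = (\<Sum>b\<in>B. (v \<bullet> b) *\<^sub>R b)"
proof -
  have fin: "finite B" and sp: "v \<in> span B"
    using assms by (auto simp: orthonormal_basis_def)
  from sp obtain c where v: "v = (\<Sum>b\<in>B. c b *\<^sub>R b)"
    unfolding span_finite[OF fin] by auto
  have "v \<bullet> b = c b" if "b \<in> B" for b
    unfolding v by (rule orthonormal_basis_coordinate[OF assms that])
  then show ?thesis
    by (subst (1) v) (auto intro!: sum.cong)
qed

lemma orthonormal_basis_independent:
  assumes "orthonormal_basis B"
  shows "independent B"
proof (rule independent_if_scalars_zero)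
  show "finite B" using assms by (simp add: orthonormal_basis_def)
  fix f x assume z: "(\<Sum>b\<in>B. f b *\<^sub>R b) = 0" and x: "x \<in> B"
  then show "f x = 0" using orthonormal_basis_coordinate[OF assms x, of f] by simp
qed

lemma orthonormal_basis_injective_surjective:
  fixes M :: "'f::real_inner \<Rightarrow> 'f"
  assumes "orthonormal_basis (B :: 'f set)" "linear M" "inj M"
  shows "surj M"
proof -
  interpret finite_dimensional_vector_space "scaleR :: real \<Rightarrow> 'f \<Rightarrow> 'f" B
    using assms(1) orthonormal_basis_independent[OF assms(1)]
    by unfold_locales (auto simp: orthonormal_basis_def dependent_raw_def[symmetric] span_raw_def[symmetric])
  show ?thesis using linear_inj_imp_surj assms(2,3) by (simp add: linear_def)
qed

text \<open>The ball is a closed subset of a box, which is a Minkowski sum of segments and thus compact. The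
  dimension may be 0, so that the type need not be a \<open>euclidean_space\<close>.\<close>

lemma compact_cball_orthonormal_basis:
  fixes c :: "'a::real_inner"
  assumes "orthonormal_basis (B :: 'a set)"
  shows "compact (cball c r)"
proof -
  define box where "box A = {(\<Sum>b\<in>A. t b *\<^sub>R b) | t. \<forall>b\<in>A. \<bar>t b\<bar> \<le> r}" for A :: "'a set"
  have "compact (box A)" if "finite A" for A
    using that
  proof induction
    case empty
    then show ?case by (simp add: box_def)
  next
    case (insert a A)
    have "compact ((\<lambda>t. t *\<^sub>R a) ` {-r..r})"
      by (intro compact_continuous_image continuous_intros) simp
    then have "compact {x + y |x y. x \<in> (\<lambda>t. t *\<^sub>R a) ` {-r..r} \<and> y \<in> box A}"
      using insert.IH by (rule compact_sums)
    also have "{x + y |x y. x \<in> (\<lambda>t. t *\<^sub>R a) ` {-r..r} \<and> y \<in> box A} = box (insert a A)"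
    proof (intro equalityI subsetI)
      fix z assume "z \<in> {x + y |x y. x \<in> (\<lambda>t. t *\<^sub>R a) ` {-r..r} \<and> y \<in> box A}"
      then obtain s y where s: "\<bar>s\<bar> \<le> r" "y \<in> box A" "z = s *\<^sub>R a + y"
        by force
      then obtain t where st: "\<bar>s\<bar> \<le> r" "\<forall>b\<in>A. \<bar>t b\<bar> \<le> r" "z = s *\<^sub>R a + (\<Sum>b\<in>A. t b *\<^sub>R b)"
        by (auto simp: box_def)
      have "z = (\<Sum>b\<in>insert a A. (t(a := s)) b *\<^sub>R b)"
        using insert.hyps st(3) by (simp add: sum.insert) (auto intro!: sum.cong)
      then show "z \<in> box (insert a A)"
        unfolding box_def using st(1,2) by (intro CollectI exI[of _ "t(a := s)"]) auto
    next
      fix z assume "z \<in> box (insert a A)"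
      then obtain t where t: "\<forall>b\<in>insert a A. \<bar>t b\<bar> \<le> r" "z = (\<Sum>b\<in>insert a A. t b *\<^sub>R b)"
        by (auto simp: box_def)
      have "t a *\<^sub>R a \<in> (\<lambda>t. t *\<^sub>R a) ` {-r..r}"
        using t(1) by (auto simp: abs_le_iff)
      moreover have "(\<Sum>b\<in>A. t b *\<^sub>R b) \<in> box A"
        using t(1) by (auto simp: box_def)
      ultimately show "z \<in> {x + y |x y. x \<in> (\<lambda>t. t *\<^sub>R a) ` {-r..r} \<and> y \<in> box A}"
        using t(2) insert.hyps by auto
    qed
    finally show ?case .
  qed
  then have "compact (box B)" using assms by (simp add: orthonormal_basis_def)
  moreover have "cball 0 r \<subseteq> box B"
  proof
    fix v :: 'a assume "v \<in> cball 0 r"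
    then have v: "norm v \<le> r" by simp
    have "\<bar>v \<bullet> b\<bar> \<le> r" if "b \<in> B" for b
    proof -
      have "norm b = 1" using assms that by (simp add: orthonormal_basis_def norm_eq_sqrt_inner)
      then show ?thesis using Cauchy_Schwarz_ineq2[of v b] v by simp
    qed
    then show "v \<in> box B"
      unfolding box_def using orthonormal_basis_expand[OF assms, of v] by blast
  qed
  ultimately have "compact (cball (0::'a) r)"
    using compact_Int_closed[OF _ closed_cball] by (metis inf.absorb_iff2)
  then have "compact ((+) c ` cball 0 r)" by (rule compact_translation)
  then show ?thesis by simp
qed

section \<open>Smooth functions on a manifold\<close>

context smooth_manifold
begin

lemma chart_open_image:
  assumes "(U, \<phi>) \<in> atlas" "open W"
  shows "open (\<phi> ` (U \<inter> W))"
proof -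
  have h: "homeomorphism U (\<phi> ` U) \<phi> (inv_into U \<phi>)" "open (\<phi> ` U)"
    using chart[OF assms(1)] by auto
  have "openin (top_of_set (\<phi> ` U)) (\<phi> ` (U \<inter> W))"
    using homeomorphism_imp_open_map[OF h(1)] openin_open_Int[OF assms(2)] by blast
  then show ?thesis using h(2) openin_open_trans by blast
qed

lemma chart_inj: "(U, \<phi>) \<in> atlas \<Longrightarrow> inj_on \<phi> U"
  using chart homeomorphism_apply1 by (metis inj_on_inverseI)

lemma smooth_map_on_local:
  assumes "\<And>x. x \<in> W \<Longrightarrow>
    \<exists>W' f'. open W' \<and> x \<in> W' \<and> smooth_map_on W' f' \<and> (\<forall>y\<in>W'. f y = f' y)"
  shows "smooth_map_on W f"
  unfolding smooth_map_on_def
proof clarify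
  fix U \<phi> assume c: "(U, \<phi>) \<in> atlas"
  show "smooth_on (\<phi> ` (U \<inter> W)) (f \<circ> inv_into U \<phi>)"
  proof (rule smooth_on_local)
    fix y assume "y \<in> \<phi> ` (U \<inter> W)"
    then obtain x where x: "x \<in> U" "x \<in> W" "y = \<phi> x" by auto
    obtain W' f' where W': "open W'" "x \<in> W'" "smooth_map_on W' f'" "\<forall>y\<in>W'. f y = f' y"
      using assms[OF x(2)] by metis
    have o: "open (\<phi> ` (U \<inter> W'))" using chart_open_image[OF c W'(1)] .
    have "smooth_on (\<phi> ` (U \<inter> W')) (f' \<circ> inv_into U \<phi>)"
      using W'(3) c unfolding smooth_map_on_def by auto
    moreover have "(f \<circ> inv_into U \<phi>) z = (f' \<circ> inv_into U \<phi>) z" if "z \<in> \<phi> ` (U \<inter> W')" for z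
      using that W'(4) chart_inj[OF c] by auto
    ultimately have "smooth_on (\<phi> ` (U \<inter> W')) (f \<circ> inv_into U \<phi>)"
      using smooth_on_cong[OF o] by blast
    then show "\<exists>T. open T \<and> y \<in> T \<and> smooth_on T (f \<circ> inv_into U \<phi>)"
      using o x W'(2) by blast
  qed
qed

lemma smooth_map_on_cong:
  assumes "open W" "smooth_map_on W h" "\<And>x. x \<in> W \<Longrightarrow> f x = h x"
  shows "smooth_map_on W f"
  by (rule smooth_map_on_local) (use assms in blast)

lemma smooth_map_on_subset: "smooth_map_on W f \<Longrightarrow> W' \<subseteq> W \<Longrightarrow> smooth_map_on W' f"
  unfolding smooth_map_on_def by (fast intro: smooth_on_subset)

lemma smooth_map_on_const: "smooth_map_on W (\<lambda>x. c)"
  unfolding smooth_map_on_def by (auto simp: o_def smooth_on_const)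

lemma smooth_map_on_add:
  assumes "open W" "smooth_map_on W f" "smooth_map_on W h"
  shows "smooth_map_on W (\<lambda>x. f x + h x)"
  using assms(2,3) smooth_on_add[OF chart_open_image[OF _ assms(1)]]
  unfolding smooth_map_on_def o_def by fast

lemma smooth_map_on_bilinear:
  assumes "bounded_bilinear pr" "open W" "smooth_map_on W f" "smooth_map_on W h"
  shows "smooth_map_on W (\<lambda>x. pr (f x) (h x))"
  using assms(3,4) smooth_on_bilinear[OF assms(1) chart_open_image[OF _ assms(2)]]
  unfolding smooth_map_on_def o_def by fast

lemmas smooth_map_on_mult = smooth_map_on_bilinear[OF bounded_bilinear_mult]
  and smooth_map_on_scaleR = smooth_map_on_bilinear[OF bounded_bilinear_scaleR]
  and smooth_map_on_inner = smooth_map_on_bilinear[OF bounded_bilinear_inner]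

lemma smooth_map_on_sum:
  assumes "open W" "\<And>i. i \<in> I \<Longrightarrow> smooth_map_on W (f i)"
  shows "smooth_map_on W (\<lambda>x. \<Sum>i\<in>I. f i x)"
  using assms(2)
proof (induction I rule: infinite_finite_induct)
  case (insert i I)
  then show ?case by (simp add: smooth_map_on_add[OF assms(1)])
qed (simp_all add: smooth_map_on_const)

lemma smooth_map_on_power:
  fixes f :: "'m \<Rightarrow> real"
  assumes "open W" "smooth_map_on W f"
  shows "smooth_map_on W (\<lambda>x. f x ^ n)"
  by (induction n) (simp_all add: smooth_map_on_const smooth_map_on_mult[OF assms])

lemma smooth_map_on_inverse:
  fixes f :: "'m \<Rightarrow> real"
  assumes "open W" "smooth_map_on W f" "\<And>x. x \<in> W \<Longrightarrow> f x \<noteq> 0"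
  shows "smooth_map_on W (\<lambda>x. inverse (f x))"
  unfolding smooth_map_on_def
proof clarify
  fix U \<phi> assume c: "(U, \<phi>) \<in> atlas"
  then have "smooth_on (\<phi> ` (U \<inter> W)) (f \<circ> inv_into U \<phi>)"
    using assms(2) unfolding smooth_map_on_def by auto
  moreover have "(f \<circ> inv_into U \<phi>) y \<noteq> 0" if "y \<in> \<phi> ` (U \<inter> W)" for y
    using that assms(3) chart_inj[OF c] by auto
  ultimately show "smooth_on (\<phi> ` (U \<inter> W)) ((\<lambda>x. inverse (f x)) \<circ> inv_into U \<phi>)"
    using smooth_on_inverse[OF chart_open_image[OF c assms(1)]] by (simp add: o_def)
qed

lemma chart_smooth: "(U, \<phi>) \<in> atlas \<Longrightarrow> smooth_map_on U \<phi>"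
  unfolding smooth_map_on_def
  using charts_compatible by (auto simp: Int_commute)

text \<open>The bump function is \<open>exp (- 1 / (r\<^sup>2 - |\<phi> x - \<phi> x\<^sub>0|\<^sup>2))\<close>, up to a factor, in a chart
  \<open>\<phi>\<close> around \<open>x\<^sub>0\<close>. Its extension by 0 is smooth because the preimage of a closed ball is compact,
  hence closed as the manifold is Hausdorff.\<close>

lemma bump_function:
  assumes "open W" "x\<^sub>0 \<in> W"
  obtains \<theta> K where "\<theta> \<in> smooth_functions" "\<theta> x\<^sub>0 = 1" "closed K" "K \<subseteq> W"
    "\<And>x. x \<notin> K \<Longrightarrow> \<theta> x = 0"
proof -
  obtain U \<phi> where c: "(U, \<phi>) \<in> atlas" and xU: "x\<^sub>0 \<in> U" using charts_cover[of x\<^sub>0] by auto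
  have U: "open U" and hom: "homeomorphism U (\<phi> ` U) \<phi> (inv_into U \<phi>)"
    using chart[OF c] by auto
  have "open (\<phi> ` (U \<inter> W))" using chart_open_image[OF c assms(1)] .
  then obtain r where r: "r > 0" "cball (\<phi> x\<^sub>0) r \<subseteq> \<phi> ` (U \<inter> W)"
    using open_contains_cball xU assms(2) by blast
  define K where "K = inv_into U \<phi> ` cball (\<phi> x\<^sub>0) r"
  obtain B :: "'b set" where "orthonormal_basis B"
    using model_space unfolding is_Rn_def orthonormal_basis_def by blast
  then have "compact (cball (\<phi> x\<^sub>0) r)" by (rule compact_cball_orthonormal_basis)
  moreover have "continuous_on (cball (\<phi> x\<^sub>0) r) (inv_into U \<phi>)"
    using homeomorphism_cont2[OF hom] r(2) by (auto intro: continuous_on_subset)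
  ultimately have "closed K"
    unfolding K_def using compact_continuous_image compact_imp_closed by blast
  have KUW: "K \<subseteq> U \<inter> W"
    using r(2) chart_inj[OF c] by (auto simp: K_def)
  have Kdist: "x \<in> K" if "x \<in> U" "norm (\<phi> x - \<phi> x\<^sub>0) \<le> r" for x
    using that chart_inj[OF c] unfolding K_def
    by (intro image_eqI[of _ _ "\<phi> x"]) (auto simp: dist_norm norm_minus_commute)
  define h where "h x = r\<^sup>2 - (\<phi> x - \<phi> x\<^sub>0) \<bullet> (\<phi> x - \<phi> x\<^sub>0)" for x
  define \<theta>' where "\<theta>' x = (if x \<in> U then flat_fun 1 (h x) else 0)" for x
  define \<theta> where "\<theta> x = inverse (\<theta>' x\<^sub>0) * \<theta>' x" for x
  have zero: "\<theta>' x = 0" if "x \<notin> K" for x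
  proof (cases "x \<in> U")
    case True
    with that Kdist have "r < norm (\<phi> x - \<phi> x\<^sub>0)" by force
    then have "r\<^sup>2 < (norm (\<phi> x - \<phi> x\<^sub>0))\<^sup>2"
      using r(1) by (intro power_strict_mono) auto
    then have "h x \<le> 0" by (simp add: h_def power2_norm_eq_inner)
    then show ?thesis by (simp add: \<theta>'_def flat_fun_def)
  qed (simp add: \<theta>'_def)
  have sU: "smooth_map_on U (\<lambda>x. flat_fun 1 (h x))"
  proof -
    have d: "smooth_map_on U (\<lambda>x. \<phi> x + (- \<phi> x\<^sub>0))"
      by (intro smooth_map_on_add U chart_smooth c smooth_map_on_const)
    have "smooth_map_on U (\<lambda>x. r\<^sup>2 + (-1) * ((\<phi> x + (- \<phi> x\<^sub>0)) \<bullet> (\<phi> x + (- \<phi> x\<^sub>0))))"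
      by (intro smooth_map_on_add smooth_map_on_mult smooth_map_on_inner U d smooth_map_on_const)
    then have "smooth_map_on U h" by (simp add: h_def[abs_def])
    then show ?thesis
      using smooth_on_flat_fun[OF chart_open_image[OF _ U]]
      unfolding smooth_map_on_def o_def by fast
  qed
  have "smooth_map_on UNIV \<theta>'"
  proof (rule smooth_map_on_local)
    fix x
    show "\<exists>W' f'. open W' \<and> x \<in> W' \<and> smooth_map_on W' f' \<and> (\<forall>y\<in>W'. \<theta>' y = f' y)"
    proof (cases "x \<in> K")
      case True
      then show ?thesis
        using U sU KUW by (intro exI[of _ U] exI[of _ "\<lambda>x. flat_fun 1 (h x)"]) (auto simp: \<theta>'_def)
    next
      case False
      then show ?thesis
        using \<open>closed K\<close> zero smooth_map_on_const
        by (intro exI[of _ "- K"] exI[of _ "\<lambda>_. 0"]) auto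
    qed
  qed
  then have "\<theta> \<in> smooth_functions"
    unfolding smooth_functions_def \<theta>_def
    by (auto intro!: smooth_map_on_mult smooth_map_on_const)
  moreover have "\<theta>' x\<^sub>0 \<noteq> 0" using xU r(1) by (simp add: \<theta>'_def h_def flat_fun_def)
  then have "\<theta> x\<^sub>0 = 1" by (simp add: \<theta>_def)
  ultimately show ?thesis
    using that[of \<theta> K] \<open>closed K\<close> KUW zero by (auto simp: \<theta>_def)
qed

lemma smooth_function_continuous:
  assumes "f \<in> smooth_functions"
  shows "continuous_on UNIV f"
proof -
  have "isCont f x" for x
  proof -
    obtain U \<phi> where c: "(U, \<phi>) \<in> atlas" "x \<in> U" using charts_cover[of x] by auto
    have U: "open U" and hom: "homeomorphism U (\<phi> ` U) \<phi> (inv_into U \<phi>)"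
      using chart[OF c(1)] by auto
    have "smooth_on (\<phi> ` U) (f \<circ> inv_into U \<phi>)"
      using assms c(1) unfolding smooth_functions_def smooth_map_on_def by auto
    then have "continuous_on (\<phi> ` U) (f \<circ> inv_into U \<phi>)"
      unfolding smooth_on_def by (metis Ck_on.simps(1))
    then have "continuous_on U ((f \<circ> inv_into U \<phi>) \<circ> \<phi>)"
      by (rule continuous_on_compose[OF homeomorphism_cont1[OF hom]])
    then have "continuous_on U f"
      by (rule continuous_on_eq) (use chart_inj[OF c(1)] in auto)
    then show ?thesis using U c(2) by (simp add: continuous_on_eq_continuous_at)
  qed
  then show ?thesis by (simp add: continuous_at_imp_continuous_on)
qed

lemma smooth_functions_const: "(\<lambda>x. c) \<in> smooth_functions"
  by (simp add: smooth_functions_def smooth_map_on_const)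

lemma smooth_functions_add:
  "f \<in> smooth_functions \<Longrightarrow> h \<in> smooth_functions \<Longrightarrow> (\<lambda>x. f x + h x) \<in> smooth_functions"
  by (simp add: smooth_functions_def smooth_map_on_add)

lemma smooth_functions_mult:
  "f \<in> smooth_functions \<Longrightarrow> h \<in> smooth_functions \<Longrightarrow> (\<lambda>x. f x * h x) \<in> smooth_functions"
  by (simp add: smooth_functions_def smooth_map_on_mult)

lemma smooth_functions_sum:
  "(\<And>i. i \<in> I \<Longrightarrow> f i \<in> smooth_functions) \<Longrightarrow> (\<lambda>x. \<Sum>i\<in>I. f i x) \<in> smooth_functions"
  by (simp add: smooth_functions_def smooth_map_on_sum)

context
  fixes x X assumes X: "X \<in> tangent_space x"
begin

lemma tangent_not_smooth: "f \<notin> smooth_functions \<Longrightarrow> X f = 0"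
  using X by (simp add: tangent_space_def)

lemma tangent_linear:
  "f \<in> smooth_functions \<Longrightarrow> h \<in> smooth_functions \<Longrightarrow> X (\<lambda>y. a * f y + h y) = a * X f + X h"
  using X unfolding tangent_space_def by blast

lemma tangent_add:
  "f \<in> smooth_functions \<Longrightarrow> h \<in> smooth_functions \<Longrightarrow> X (\<lambda>y. f y + h y) = X f + X h"
  using tangent_linear[of f h 1] by simp

lemma tangent_mult:
  "f \<in> smooth_functions \<Longrightarrow> h \<in> smooth_functions \<Longrightarrow> X (\<lambda>y. f y * h y) = f x * X h + h x * X f"
  using X by (simp add: tangent_space_def)

lemma tangent_const: "X (\<lambda>y. c) = 0"
proof -
  have one: "X (\<lambda>y. 1) = 0"
    using tangent_mult[OF smooth_functions_const smooth_functions_const, of 1 1] by simp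
  have "X (\<lambda>y. 0) = 0"
    using tangent_add[OF smooth_functions_const smooth_functions_const, of 0 0] by simp
  then show ?thesis
    using one tangent_linear[OF smooth_functions_const smooth_functions_const, of c 1 0] by simp
qed

lemma tangent_cmult: "f \<in> smooth_functions \<Longrightarrow> X (\<lambda>y. c * f y) = c * X f"
  by (simp add: tangent_mult[OF smooth_functions_const] tangent_const)

lemma tangent_sum:
  "(\<And>i. i \<in> I \<Longrightarrow> f i \<in> smooth_functions) \<Longrightarrow> X (\<lambda>y. \<Sum>i\<in>I. f i y) = (\<Sum>i\<in>I. X (f i))"
  by (induction I rule: infinite_finite_induct)
    (simp_all add: tangent_const tangent_add smooth_functions_sum)

end

end

section \<open>Alternating forms on lists\<close>

definition contraction :: "'v \<Rightarrow> ('v list \<Rightarrow> real) \<Rightarrow> 'v list \<Rightarrow> real" where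
  "contraction v a ws = a (v # ws)"

lemma set_list_update_subset_iff:
  "i < length vs \<Longrightarrow> v \<in> V \<Longrightarrow>
    set (vs[i := v]) \<subseteq> V \<longleftrightarrow> (\<forall>j<length vs. j \<noteq> i \<longrightarrow> vs ! j \<in> V)"
  by (auto simp: subset_iff in_set_conv_nth nth_list_update)

lemma alternating_forms_zero:
  "a \<in> alternating_forms V p \<Longrightarrow> \<not> (length vs = p \<and> set vs \<subseteq> V) \<Longrightarrow> a vs = 0"
  by (simp add: alternating_forms_def)

lemma alternating_forms_repeat:
  assumes "a \<in> alternating_forms V p" "i < j" "j < length vs" "vs ! i = vs ! j"
  shows "a vs = 0"
proof -
  have "\<forall>vs i j. length vs = p \<and> set vs \<subseteq> V \<and> i < j \<and> j < p \<and> vs ! i = vs ! j \<longrightarrow> a vs = 0"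
    using assms(1) unfolding alternating_forms_def by (elim CollectE conjE)
  then show ?thesis
    using assms(2-4) alternating_forms_zero[OF assms(1), of vs] by blast
qed

lemma contraction_twice:
  assumes "a \<in> alternating_forms V p"
  shows "contraction v (contraction v a) = (\<lambda>ws. 0)"
proof
  show "contraction v (contraction v a) ws = 0" for ws
    using alternating_forms_repeat[OF assms, of 0 1 "v # v # ws"] by (simp add: contraction_def)
qed

lemma alternating_formsI:
  assumes zero: "\<And>vs. \<not> (length vs = p \<and> set vs \<subseteq> V) \<Longrightarrow> a vs = 0"
    and lin: "\<And>vs i c v w. v \<in> V \<Longrightarrow> w \<in> V \<Longrightarrow> length vs = p \<Longrightarrow> set vs \<subseteq> V \<Longrightarrow> i < p \<Longrightarrow>
      a (vs[i := c *\<^sub>R v + w]) = c * a (vs[i := v]) + a (vs[i := w])"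
    and rep: "\<And>vs i j. length vs = p \<Longrightarrow> set vs \<subseteq> V \<Longrightarrow> i < j \<Longrightarrow> j < p \<Longrightarrow> vs ! i = vs ! j \<Longrightarrow> a vs = 0"
  shows "a \<in> alternating_forms V p"
  unfolding alternating_forms_def
proof (intro CollectI conjI allI ballI impI)
  fix vs assume "\<not> (length vs = p \<and> set vs \<subseteq> V)"
  then show "a vs = 0" by (rule zero)
next
  fix vs i c v w assume "v \<in> V" "w \<in> V" and h: "length vs = p \<and> set vs \<subseteq> V \<and> i < p"
  then show "a (vs[i := c *\<^sub>R v + w]) = c * a (vs[i := v]) + a (vs[i := w])"
    by (intro lin) simp_all
next
  fix vs i j assume "length vs = p \<and> set vs \<subseteq> V \<and> i < j \<and> j < p \<and> vs ! i = vs ! j"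
  then show "a vs = 0" by (intro rep[of vs i j]) simp_all
qed

lemma zero_alternating_forms: "(\<lambda>ws. 0) \<in> alternating_forms V p"
  by (simp add: alternating_forms_def)

lemma add_alternating_forms:
  "a \<in> alternating_forms V p \<Longrightarrow> b \<in> alternating_forms V p \<Longrightarrow>
    (\<lambda>ws. c * a ws + b ws) \<in> alternating_forms V p"
  unfolding alternating_forms_def by (auto simp: algebra_simps)

lemma omit_0_Cons: "omit (insert 0 (Suc ` J)) (v # vs) = omit J vs"
  by (simp add: omit_def nths_Cons) (rule arg_cong[where f = "nths vs"], auto)

lemma omit_Suc_Cons: "omit (Suc ` J) (v # vs) = v # omit J vs"
  by (simp add: omit_def nths_Cons) (rule arg_cong[where f = "nths vs"], auto)

lemma omit_map: "omit I (map f xs) = map f (omit I xs)"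
  by (simp add: omit_def nths_map)

lemma set_omit_subset: "set (omit I xs) \<subseteq> set xs"
  by (simp add: omit_def set_nths_subset)

locale subspace_forms =
  fixes V :: "'v::real_vector set"
  assumes subspace: "subspace V"
begin

lemma combination_mem: "v \<in> V \<Longrightarrow> w \<in> V \<Longrightarrow> c *\<^sub>R v + w \<in> V"
  using subspace by (simp add: subspace_add subspace_scale)

lemma form_linear:
  assumes a: "a \<in> alternating_forms V p" and "v \<in> V" "w \<in> V" and i: "i < length vs"
  shows "a (vs[i := c *\<^sub>R v + w]) = c * a (vs[i := v]) + a (vs[i := w])"
proof (cases "length vs = p \<and> (\<forall>j<length vs. j \<noteq> i \<longrightarrow> vs ! j \<in> V)")
  case True
  then have vs: "length (vs[i := v]) = p" "set (vs[i := v]) \<subseteq> V"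
    using set_list_update_subset_iff[OF i] assms(2) by auto
  have lin: "\<forall>vs i c. \<forall>v\<in>V. \<forall>w\<in>V. length vs = p \<and> set vs \<subseteq> V \<and> i < p \<longrightarrow>
      a (vs[i := c *\<^sub>R v + w]) = c * a (vs[i := v]) + a (vs[i := w])"
    using a unfolding alternating_forms_def by (elim CollectE conjE)
  show ?thesis
    using lin[rule_format, OF assms(2,3), of "vs[i := v]" i c] vs i by simp
next
  case False
  then have "a (vs[i := u]) = 0" if "u \<in> V" for u
    using alternating_forms_zero[OF a, of "vs[i := u]"] set_list_update_subset_iff[OF i that] False that
    by auto
  then show ?thesis using combination_mem assms(2,3) by simp
qed

lemma form_linear_append:
  assumes a: "a \<in> alternating_forms V p" and "v \<in> V" "w \<in> V"
  shows "a (xs @ (c *\<^sub>R v + w) # ys) = c * a (xs @ v # ys) + a (xs @ w # ys)"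
  using form_linear[OF assms, of "length xs" "xs @ v # ys" c] by simp

lemma form_linear_Cons:
  assumes a: "a \<in> alternating_forms V p" and "v \<in> V" "w \<in> V"
  shows "a ((c *\<^sub>R v + w) # ys) = c * a (v # ys) + a (w # ys)"
  using form_linear_append[OF assms, of "[]"] by simp

lemma form_zero_entry: "a \<in> alternating_forms V p \<Longrightarrow> a (xs @ 0 # ys) = 0"
  using form_linear_append[of a p 0 0 xs 1 ys] subspace_0[OF subspace] by simp

lemma form_scale_append:
  "a \<in> alternating_forms V p \<Longrightarrow> v \<in> V \<Longrightarrow> a (xs @ (c *\<^sub>R v) # ys) = c * a (xs @ v # ys)"
  using form_linear_append[of a p v 0 xs c ys] subspace_0[OF subspace] form_zero_entry by simp

lemma form_sum_append:
  assumes a: "a \<in> alternating_forms V p" and "\<And>b. b \<in> B \<Longrightarrow> e b \<in> V"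
  shows "a (xs @ (\<Sum>b\<in>B. c b *\<^sub>R e b) # ys) = (\<Sum>b\<in>B. c b * a (xs @ e b # ys))"
  using assms(2)
proof (induction B rule: infinite_finite_induct)
  case (insert b B)
  have "(\<Sum>b\<in>B. c b *\<^sub>R e b) \<in> V"
    using insert.prems by (auto intro: subspace_sum[OF subspace] subspace_scale[OF subspace])
  then show ?case
    using insert form_linear_append[OF a] by simp
qed (simp_all add: form_zero_entry[OF a])

lemma form_scale_all:
  assumes "a \<in> alternating_forms V p" "set vs \<subseteq> V"
  shows "a (map (\<lambda>v. c *\<^sub>R v) vs) = c ^ length vs * a vs"
proof -
  have "a (us @ map (\<lambda>v. c *\<^sub>R v) vs) = c ^ length vs * a (us @ vs)" for us
    using assms(2)
  proof (induction vs arbitrary: us)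
    case (Cons v vs)
    have "a (us @ map (\<lambda>v. c *\<^sub>R v) (v # vs)) = c * a ((us @ [v]) @ map (\<lambda>v. c *\<^sub>R v) vs)"
      using form_scale_append[OF assms(1), of v us c "map (\<lambda>v. c *\<^sub>R v) vs"] Cons.prems by simp
    also have "a ((us @ [v]) @ map (\<lambda>v. c *\<^sub>R v) vs) = c ^ length vs * a ((us @ [v]) @ vs)"
      by (rule Cons.IH) (use Cons.prems in simp)
    finally show ?case by simp
  qed simp
  from this[of "[]"] show ?thesis by simp
qed

lemma form_swap_Cons:
  assumes a: "a \<in> alternating_forms V p"
  shows "a (v # w # ws) = - a (w # v # ws)"
proof (cases "v \<in> V \<and> w \<in> V")
  case True
  have z: "a (u # u # ws) = 0" for u
    using alternating_forms_repeat[OF a, of 0 1] by simp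
  have add: "a (xs @ (x + y) # ys) = a (xs @ x # ys) + a (xs @ y # ys)" if "x \<in> V" "y \<in> V" for x y xs ys
    using form_linear_append[OF a that, of xs 1 ys] by simp
  have "v + w \<in> V" using True subspace subspace_add by blast
  then have "a ((v + w) # (v + w) # ws) = a (v # v # ws) + a (v # w # ws) + (a (w # v # ws) + a (w # w # ws))"
    using True add[of v w "[]"] add[of v w "[v]"] add[of v w "[w]"] by simp
  then show ?thesis by (simp add: z)
next
  case False
  then show ?thesis
    using alternating_forms_zero[OF a, of "v # w # ws"] alternating_forms_zero[OF a, of "w # v # ws"] by auto
qed

lemma contraction_alternating:
  assumes a: "a \<in> alternating_forms V p" and v: "v \<in> V"
  shows "contraction v a \<in> alternating_forms V (p - 1)"
proof (cases p)
  case 0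
  then have "contraction v a = (\<lambda>ws. 0)"
    using alternating_forms_zero[OF a] by (simp add: contraction_def fun_eq_iff)
  then show ?thesis by (simp add: zero_alternating_forms)
next
  case (Suc q)
  have "a (v # vs[i := c *\<^sub>R u + w]) = c * a (v # vs[i := u]) + a (v # vs[i := w])"
    if "u \<in> V" "w \<in> V" "i < length vs" for vs i c u w
    using form_linear[OF a that(1,2), of "Suc i" "v # vs"] that(3) by simp
  moreover have "a (v # vs) = 0" if "i < j" "j < length vs" "vs ! i = vs ! j" for vs i j
    using alternating_forms_repeat[OF a, of "Suc i" "Suc j" "v # vs"] that by simp
  moreover have "a (v # vs) = 0" if "\<not> (length vs = q \<and> set vs \<subseteq> V)" for vs
    using alternating_forms_zero[OF a, of "v # vs"] that v Suc by auto
  ultimately show ?thesis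
    unfolding contraction_def Suc diff_Suc_1 by (intro alternating_formsI) auto
qed

text \<open>If the contractions of a form are alternating, only its first two arguments remain to be
  examined: a repetition further apart is reduced to these by a transposition.\<close>

lemma alternating_forms_ConsI:
  assumes zero: "\<And>vs. \<not> (length vs = Suc p \<and> set vs \<subseteq> V) \<Longrightarrow> a vs = 0"
    and lin: "\<And>c v w ws. v \<in> V \<Longrightarrow> w \<in> V \<Longrightarrow> a ((c *\<^sub>R v + w) # ws) = c * a (v # ws) + a (w # ws)"
    and con: "\<And>v. v \<in> V \<Longrightarrow> contraction v a \<in> alternating_forms V p"
    and rep: "\<And>v ws. v \<in> V \<Longrightarrow> a (v # v # ws) = 0"
  shows "a \<in> alternating_forms V (Suc p)"
proof -
  have lin1: "a (u # (c *\<^sub>R v + w) # ws) = c * a (u # v # ws) + a (u # w # ws)"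
    if "u \<in> V" "v \<in> V" "w \<in> V" for u v w c ws
    using form_linear_Cons[OF con[OF that(1)] that(2,3)] by (simp add: contraction_def)
  have swap: "a (v # w # ws) = - a (w # v # ws)" if "v \<in> V" "w \<in> V" for v w ws
  proof -
    have "v + w \<in> V" using that subspace subspace_add by blast
    then have "a ((v + w) # (v + w) # ws) = a (v # v # ws) + a (v # w # ws) + (a (w # v # ws) + a (w # w # ws))"
      using that lin[of v w 1] lin1[of _ v w 1] by simp
    then show ?thesis using rep \<open>v + w \<in> V\<close> that by simp
  qed
  have later: "a vs = 0" if "0 < i" "i < j" "j < length vs" "set vs \<subseteq> V" "vs ! i = vs ! j" for vs i j
  proof -
    obtain u us where "vs = u # us" using \<open>j < length vs\<close> by (cases vs) auto
    moreover have "contraction u a us = 0"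
      using that \<open>vs = u # us\<close>
      by (intro alternating_forms_repeat[OF con, of _ "i - 1" "j - 1"]) auto
    ultimately show ?thesis by (simp add: contraction_def)
  qed
  have repeated: "a vs = 0" if "i < j" "j < length vs" "set vs \<subseteq> V" "vs ! i = vs ! j" for vs i j
  proof (cases "i = 0")
    case True
    obtain v w ws where vs: "vs = v # w # ws" using \<open>i < j\<close> \<open>j < length vs\<close> by (cases vs rule: remdups_adj.cases) auto
    show ?thesis
    proof (cases "j = 1")
      case True
      then show ?thesis using \<open>i = 0\<close> vs that rep by simp
    next
      case False
      then have "a (w # v # ws) = 0"
        using later[of 1 j "w # v # ws"] \<open>i = 0\<close> vs that by (auto simp: nth_Cons')
      then show ?thesis using swap[of v w ws] vs that(3) by simp
    qed
  next
    case False
    then show ?thesis using later[OF _ that] by simp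
  qed
  have "a (vs[i := c *\<^sub>R v + w]) = c * a (vs[i := v]) + a (vs[i := w])"
    if "v \<in> V" "w \<in> V" "set vs \<subseteq> V" "i < length vs" for vs i c v w
  proof -
    obtain u us where vs: "vs = u # us" using \<open>i < length vs\<close> by (cases vs) auto
    show ?thesis
    proof (cases i)
      case 0
      then show ?thesis using vs lin that by simp
    next
      case (Suc k)
      then show ?thesis
        using vs that form_linear[OF con that(1,2), of u k us] by (simp add: contraction_def)
    qed
  qed
  note lin_at = this
  show ?thesis
  proof (rule alternating_formsI)
    show "a vs = 0" if "length vs = Suc p" "set vs \<subseteq> V" "i < j" "j < Suc p" "vs ! i = vs ! j" for vs i j
      using that by (intro repeated[of i j]) simp_all
  qed (simp_all add: zero lin_at)
qed

lemma form_exchange: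
  assumes a: "a \<in> alternating_forms V p" and ij: "i < length vs" "j < length vs" "i \<noteq> j"
    and V: "v \<in> V" "w \<in> V"
  shows "a (vs[i := v, j := w]) = - a (vs[i := w, j := v])"
proof -
  have s: "v + w \<in> V" using V subspace subspace_add by blast
  have z: "a (vs[i := u, j := u]) = 0" for u
    using ij alternating_forms_repeat[OF a, of i j "vs[i := u, j := u]"]
      alternating_forms_repeat[OF a, of j i "vs[i := u, j := u]"]
    by (cases "i < j") auto
  have 1: "a (vs[i := u, j := v + w]) = a (vs[i := u, j := v]) + a (vs[i := u, j := w])" for u
    using form_linear[OF a V, of j "vs[i := u]" 1] ij by simp
  have 2: "a (vs[i := v + w, j := u]) = a (vs[i := v, j := u]) + a (vs[i := w, j := u])" for u
    using form_linear[OF a V, of i "vs[j := u]" 1] ij by (simp add: list_update_swap)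
  have "a (vs[i := v + w, j := v + w]) = 0" by (rule z)
  then show ?thesis using 1[of v] 1[of w] 2[of "v + w"] z[of v] z[of w] by simp
qed

lemma form_move_to_front:
  assumes "a \<in> alternating_forms V p" "j < length vs"
  shows "a (b # omit {j} vs) = (-1) ^ j * a (vs[j := b])"
  using assms
proof (induction vs arbitrary: j a p)
  case (Cons v vs)
  show ?case
  proof (cases j)
    case 0
    then show ?thesis using omit_0_Cons[of "{}" v vs] by (simp add: omit_def nths_all)
  next
    case (Suc k)
    show ?thesis
    proof (cases "v \<in> V")
      case True
      have "a (b # omit {j} (v # vs)) = - contraction v a (b # omit {k} vs)"
        using Suc omit_Suc_Cons[of "{k}" v vs] form_swap_Cons[OF Cons.prems(1), of b v]
        by (simp add: contraction_def)
      also have "contraction v a (b # omit {k} vs) = (-1) ^ k * contraction v a (vs[k := b])"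
        using Cons.IH[OF contraction_alternating[OF Cons.prems(1) True]] Cons.prems(2) Suc by simp
      finally show ?thesis using Suc by (simp add: contraction_def)
    next
      case False
      then show ?thesis
        using Suc omit_Suc_Cons[of "{k}" v vs] alternating_forms_zero[OF Cons.prems(1)]
          alternating_forms_zero[OF Cons.prems(1), of "v # vs[k := b]"] by simp
    qed
  qed
qed simp

end

section \<open>The wedge product\<close>

text \<open>Forms are treated here as arbitrary functions of lists; in an algebroid, the results are
  used both for the elements of a fibre and for sections.\<close>

definition homogeneous :: "nat \<Rightarrow> ('v list \<Rightarrow> real) \<Rightarrow> bool" where
  "homogeneous p a \<longleftrightarrow> (\<forall>ws. length ws \<noteq> p \<longrightarrow> a ws = 0)"

lemma homogeneous_contraction: "homogeneous p a \<Longrightarrow> homogeneous (p - 1) (contraction v a)"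
  by (cases p) (auto simp: homogeneous_def contraction_def)

lemma alternating_forms_homogeneous: "a \<in> alternating_forms V p \<Longrightarrow> homogeneous p a"
  by (auto simp: homogeneous_def alternating_forms_zero)

lemma shuffle_sign_insert_0: "shuffle_sign (insert 0 (Suc ` J)) = shuffle_sign J"
proof -
  have "{(i, j). i \<in> insert 0 (Suc ` J) \<and> j \<notin> insert 0 (Suc ` J) \<and> j < i} =
      map_prod Suc Suc ` {(i, j). i \<in> J \<and> j \<notin> J \<and> j < i}" (is "?L = ?R")
  proof (intro equalityI subsetI)
    fix z assume "z \<in> ?L"
    then obtain i j where z: "z = (Suc i, j)" "i \<in> J" "j \<noteq> 0" "j \<notin> Suc ` J" "j < Suc i" by auto
    then obtain k where "j = Suc k" by (cases j) auto
    then show "z \<in> ?R" using z by (auto simp: image_iff intro!: bexI[of _ "(i, k)"])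
  qed auto
  then show ?thesis
    unfolding shuffle_sign_def by (simp add: card_image inj_on_def map_prod_def split_beta prod_eq_iff)
qed

lemma shuffle_sign_Suc:
  assumes "finite J"
  shows "shuffle_sign (Suc ` J) = (-1) ^ card J * shuffle_sign J"
proof -
  let ?P = "{(i, j). i \<in> J \<and> j \<notin> J \<and> j < i}"
  have eq: "{(i, j). i \<in> Suc ` J \<and> j \<notin> Suc ` J \<and> j < i} = (\<lambda>i. (Suc i, 0)) ` J \<union> map_prod Suc Suc ` ?P"
    (is "?L = ?R")
  proof (intro equalityI subsetI)
    fix z assume "z \<in> ?L"
    then obtain i j where z: "z = (Suc i, j)" "i \<in> J" "j \<notin> Suc ` J" "j < Suc i" by auto
    then show "z \<in> ?R" by (cases j) (auto simp: image_iff intro!: bexI[of _ "(i, j - 1)"])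
  qed auto
  have "?P \<subseteq> Sigma J (\<lambda>i. {..<i})" by auto
  then have "finite ?P" using assms finite_subset by blast
  moreover have "(\<lambda>i. (Suc i, 0::nat)) ` J \<inter> map_prod Suc Suc ` ?P = {}" by auto
  ultimately have "card ?L = card J + card ?P"
    unfolding eq using assms
    by (subst card_Un_disjoint) (auto simp: card_image inj_on_def)
  then show ?thesis unfolding shuffle_sign_def by (simp add: power_add)
qed

lemma wedge_Nil: "wedge a b [] = a [] * b []"
  by (simp add: wedge_def shuffle_sign_def omit_def)

text \<open>A shuffle gives the first argument either to \<open>a\<close>, which costs no sign, or to \<open>b\<close>, which
  moves it past the \<open>p\<close> arguments of \<open>a\<close>. Contractions are thus antiderivations of the wedge
  product. Symmetry and the derivation rules are proved by induction along this recursion.\<close>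

lemma wedge_Cons:
  assumes "homogeneous p a"
  shows "wedge a b (v # vs) = wedge (contraction v a) b vs + (-1) ^ p * wedge a (contraction v b) vs"
proof -
  let ?n = "length vs"
  let ?t = "\<lambda>I. shuffle_sign I * a (nths (v # vs) I) * b (omit I (v # vs))"
  have Pow: "Pow {..<Suc ?n} = image Suc ` Pow {..<?n} \<union> (\<lambda>J. insert 0 (Suc ` J)) ` Pow {..<?n}"
    unfolding lessThan_Suc_eq_insert_0 Pow_insert image_Pow_surj[OF refl, symmetric] image_image ..
  have disj: "image Suc ` Pow {..<?n} \<inter> (\<lambda>J. insert 0 (Suc ` J)) ` Pow {..<?n} = {}"
    by auto
  have inj: "inj_on (image Suc) (Pow {..<?n})" "inj_on (\<lambda>J. insert 0 (Suc ` J)) (Pow {..<?n})"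
    by (auto simp: inj_on_def inj_image_eq_iff)
  have "wedge a b (v # vs) = (\<Sum>J\<in>Pow {..<?n}. ?t (Suc ` J)) + (\<Sum>J\<in>Pow {..<?n}. ?t (insert 0 (Suc ` J)))"
    unfolding wedge_def length_Cons Pow
    by (subst sum.union_disjoint) (use disj in \<open>auto simp: sum.reindex[OF inj(1)] sum.reindex[OF inj(2)]\<close>)
  also have "(\<Sum>J\<in>Pow {..<?n}. ?t (insert 0 (Suc ` J))) = wedge (contraction v a) b vs"
    unfolding wedge_def contraction_def shuffle_sign_insert_0 omit_0_Cons
    by (rule sum.cong) (auto simp: nths_Cons inj_image_mem_iff)
  also have "(\<Sum>J\<in>Pow {..<?n}. ?t (Suc ` J)) = (-1) ^ p * wedge a (contraction v b) vs"
    unfolding wedge_def sum_distrib_left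
  proof (rule sum.cong)
    fix J assume J: "J \<in> Pow {..<?n}"
    then have fin: "finite J" using finite_subset by blast
    have "length (nths vs J) = card J"
      using J by (auto simp: length_nths intro!: arg_cong[where f = card])
    then have "card J = p \<or> a (nths vs J) = 0" using assms by (metis homogeneous_def)
    moreover have "nths (v # vs) (Suc ` J) = nths vs J"
      by (auto simp: nths_Cons intro!: arg_cong[where f = "nths vs"])
    ultimately show "?t (Suc ` J) = (-1) ^ p * (shuffle_sign J * a (nths vs J) * contraction v b (omit J vs))"
      by (auto simp: shuffle_sign_Suc[OF fin] omit_Suc_Cons contraction_def)
  qed simp
  finally show ?thesis by simp
qed

lemma wedge_linear_left: "wedge (\<lambda>ws. c * a ws + a' ws) b vs = c * wedge a b vs + wedge a' b vs"
  unfolding wedge_def sum_distrib_left sum.distrib[symmetric]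
  by (rule sum.cong) (simp_all add: algebra_simps)

lemma wedge_linear_right: "wedge a (\<lambda>ws. c * b ws + b' ws) vs = c * wedge a b vs + wedge a b' vs"
  unfolding wedge_def sum_distrib_left sum.distrib[symmetric]
  by (rule sum.cong) (simp_all add: algebra_simps)

lemma wedge_add_left: "wedge (\<lambda>ws. a ws + a' ws) b vs = wedge a b vs + wedge a' b vs"
  using wedge_linear_left[of 1] by simp

lemma wedge_add_right: "wedge a (\<lambda>ws. b ws + b' ws) vs = wedge a b vs + wedge a b' vs"
  using wedge_linear_right[of _ 1] by simp

lemma wedge_zero_left: "wedge (\<lambda>ws. 0) b vs = 0"
  by (simp add: wedge_def)

lemma wedge_zero_right: "wedge a (\<lambda>ws. 0) vs = 0"
  by (simp add: wedge_def)

lemma wedge_sum_right: "wedge a (\<lambda>ws. \<Sum>i\<in>I. c i * b i ws) vs = (\<Sum>i\<in>I. c i * wedge a (b i) vs)"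
  by (induction I rule: infinite_finite_induct) (simp_all add: wedge_zero_right wedge_linear_right)

lemma wedge_scalar: "wedge (\<lambda>ws. if ws = [] then c else 0) b vs = c * b vs"
proof (induction vs arbitrary: b)
  case Nil
  then show ?case by (simp add: wedge_Nil)
next
  case (Cons v vs)
  have "homogeneous 0 (\<lambda>ws::'a list. if ws = [] then c else 0)" by (simp add: homogeneous_def)
  moreover have "contraction v (\<lambda>ws. if ws = [] then c else 0) = (\<lambda>ws. 0)"
    by (simp add: contraction_def fun_eq_iff)
  ultimately show ?case
    using wedge_Cons[of 0 "\<lambda>ws. if ws = [] then c else 0" b v vs] Cons
    by (simp add: wedge_zero_left) (simp add: contraction_def)
qed

lemma wedge_cong:
  assumes "\<And>ws. set ws \<subseteq> set vs \<Longrightarrow> a ws = a' ws" "\<And>ws. set ws \<subseteq> set vs \<Longrightarrow> b ws = b' ws"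
  shows "wedge a b vs = wedge a' b' vs"
  unfolding wedge_def by (rule sum.cong) (simp_all add: assms set_nths_subset omit_def)

lemma wedge_map: "wedge a b (map f vs) = wedge (\<lambda>ws. a (map f ws)) (\<lambda>ws. b (map f ws)) vs"
  by (simp add: wedge_def omit_def nths_map)

lemma homogeneous_wedge:
  assumes "homogeneous p a" "homogeneous q b"
  shows "homogeneous (p + q) (wedge a b)"
  unfolding homogeneous_def
proof (intro allI impI)
  fix vs :: "'a list" assume l: "length vs \<noteq> p + q"
  have "a (nths vs I) = 0 \<or> b (omit I vs) = 0" if "I \<subseteq> {..<length vs}" for I
  proof -
    have "length (nths vs I) + length (omit I vs) = card ({i. i < length vs \<and> i \<in> I} \<union> {i. i < length vs \<and> i \<notin> I})"
      unfolding length_nths omit_def Compl_iff by (subst card_Un_disjoint) auto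
    also have "\<dots> = card {..<length vs}" by (rule arg_cong[where f = card]) auto
    finally have "length (nths vs I) \<noteq> p \<or> length (omit I vs) \<noteq> q" using l by auto
    then show ?thesis using assms by (metis homogeneous_def)
  qed
  then have "shuffle_sign I * a (nths vs I) * b (omit I vs) = 0" if "I \<in> Pow {..<length vs}" for I
    using that by (metis PowD mult_eq_0_iff)
  then show "wedge a b vs = 0" unfolding wedge_def by (rule sum.neutral[OF ballI])
qed

text \<open>If the first two arguments agree, they cancel if they are given to different factors, as this
  happens in two ways of opposite sign, and the other terms vanish anyway.\<close>

lemma (in subspace_forms) wedge_alternating:
  assumes "a \<in> alternating_forms V p" "b \<in> alternating_forms V q"
  shows "wedge a b \<in> alternating_forms V (p + q)"
  using assms
proof (induction "p + q" arbitrary: p q a b)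
  case 0
  have "homogeneous (p + q) (wedge a b)"
    using 0(2,3) by (intro homogeneous_wedge alternating_forms_homogeneous)
  then have zero: "wedge a b vs = 0" if "vs \<noteq> []" for vs
    using that 0(1) by (metis homogeneous_def length_0_conv)
  show ?case
  proof (rule alternating_formsI)
    show "wedge a b vs = 0" if "\<not> (length vs = p + q \<and> set vs \<subseteq> V)" for vs
      using that 0(1) by (cases "vs = []") (simp_all add: zero)
  qed (use 0(1) in simp_all)
next
  case (Suc n)
  note hom = alternating_forms_homogeneous[OF Suc.prems(1)]
  have con: "contraction v (wedge a b) =
      (\<lambda>ws. (-1) ^ p * wedge a (contraction v b) ws + wedge (contraction v a) b ws)" for v
    using wedge_Cons[OF hom, of b v] by (auto simp: contraction_def fun_eq_iff)
  have con_a: "wedge (contraction v a) b \<in> alternating_forms V n" if "v \<in> V" for v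
  proof (cases p)
    case 0
    then have "contraction v a = (\<lambda>ws. 0)"
      using hom by (auto simp: contraction_def homogeneous_def)
    then show ?thesis by (simp add: wedge_zero_left[abs_def] zero_alternating_forms)
  next
    case (Suc k)
    then show ?thesis
      using Suc.hyps(1)[of k q "contraction v a" b] Suc.hyps(2) contraction_alternating[OF Suc.prems(1) that]
        Suc.prems(2) by simp
  qed
  have con_b: "wedge a (contraction v b) \<in> alternating_forms V n" if "v \<in> V" for v
  proof (cases q)
    case 0
    then have "contraction v b = (\<lambda>ws. 0)"
      using alternating_forms_homogeneous[OF Suc.prems(2)] by (auto simp: contraction_def homogeneous_def)
    then show ?thesis by (simp add: wedge_zero_right[abs_def] zero_alternating_forms)
  next
    case (Suc k)
    then show ?thesis
      using Suc.hyps(1)[of p k a "contraction v b"] Suc.hyps(2) contraction_alternating[OF Suc.prems(2) that]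
        Suc.prems(1) by simp
  qed
  have "wedge a b \<in> alternating_forms V (Suc n)"
  proof (rule alternating_forms_ConsI)
    fix vs assume v: "\<not> (length vs = Suc n \<and> set vs \<subseteq> V)"
    show "wedge a b vs = 0"
    proof (cases "length vs = Suc n")
      case False
      then show ?thesis
        using homogeneous_wedge[OF hom alternating_forms_homogeneous[OF Suc.prems(2)]] Suc.hyps(2)
        by (simp add: homogeneous_def)
    next
      case True
      then obtain x where x: "x \<in> set vs" "x \<notin> V" using v by auto
      have "a (nths vs I) = 0 \<or> b (omit I vs) = 0" for I
      proof -
        obtain i where i: "i < length vs" "vs ! i = x" using x by (auto simp: in_set_conv_nth)
        then have "x \<in> set (nths vs I) \<or> x \<in> set (omit I vs)"
          by (auto simp: omit_def set_nths)
        then show ?thesis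
          using x alternating_forms_zero[OF Suc.prems(1), of "nths vs I"]
            alternating_forms_zero[OF Suc.prems(2), of "omit I vs"] by blast
      qed
      then have "shuffle_sign I * a (nths vs I) * b (omit I vs) = 0" for I
        by (metis mult_eq_0_iff)
      then show ?thesis unfolding wedge_def by (rule sum.neutral[OF ballI])
    qed
  next
    fix c v w ws assume "v \<in> V" "w \<in> V"
    then have "contraction (c *\<^sub>R v + w) a = (\<lambda>ws. c * contraction v a ws + contraction w a ws)"
      "contraction (c *\<^sub>R v + w) b = (\<lambda>ws. c * contraction v b ws + contraction w b ws)"
      using form_linear_Cons Suc.prems by (auto simp: contraction_def fun_eq_iff)
    then show "wedge a b ((c *\<^sub>R v + w) # ws) = c * wedge a b (v # ws) + wedge a b (w # ws)"
      by (simp only: wedge_Cons[OF hom] wedge_linear_left wedge_linear_right) (simp add: algebra_simps)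
  next
    fix v assume "v \<in> V"
    then show "contraction v (wedge a b) \<in> alternating_forms V n"
      unfolding con by (intro add_alternating_forms con_a con_b)
  next
    fix v ws assume "v \<in> V"
    have "contraction v (contraction v a) = (\<lambda>ws. 0)" "contraction v (contraction v b) = (\<lambda>ws. 0)"
      using contraction_twice Suc.prems by blast+
    moreover have "p = 0 \<Longrightarrow> contraction v a = (\<lambda>ws. 0)"
      using hom by (auto simp: contraction_def homogeneous_def)
    ultimately show "wedge a b (v # v # ws) = 0"
      by (cases p)
        (simp_all add: wedge_Cons[OF hom] wedge_Cons[OF homogeneous_contraction[OF hom]]
          wedge_zero_left wedge_zero_right)
  qed
  then show ?case using Suc.hyps(2) by simp
qed

text \<open>For \<open>c = [\<phi>, _]\<close> this is, up to sign, the part of the Lie derivative that involves the bracket.\<close>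

definition slotwise :: "('v \<Rightarrow> 'v) \<Rightarrow> ('v list \<Rightarrow> real) \<Rightarrow> 'v list \<Rightarrow> real" where
  "slotwise c a vs = (\<Sum>j<length vs. a (vs[j := c (vs ! j)]))"

lemma slotwise_Cons: "slotwise c a (v # vs) = a (c v # vs) + slotwise c (contraction v a) vs"
  by (simp add: slotwise_def contraction_def sum.lessThan_Suc_shift del: sum.lessThan_Suc)

lemma homogeneous_slotwise: "homogeneous p a \<Longrightarrow> homogeneous p (slotwise c a)"
  by (simp add: homogeneous_def slotwise_def)

lemma slotwise_linear: "slotwise c (\<lambda>ws. r * a ws + b ws) vs = r * slotwise c a vs + slotwise c b vs"
  by (simp add: slotwise_def sum.distrib sum_distrib_left)

lemma contraction_slotwise:
  "contraction v (slotwise c a) = (\<lambda>ws. contraction (c v) a ws + slotwise c (contraction v a) ws)"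
  by (simp add: contraction_def[of v "slotwise c a"] slotwise_Cons fun_eq_iff) (simp add: contraction_def)

text \<open>In the induction along \<open>wedge_Cons\<close> it matters that contraction by \<open>v\<close> and \<open>slotwise c\<close> commute up
  to the contraction by \<open>c v\<close>, which is itself an antiderivation.\<close>

lemma slotwise_wedge:
  assumes "homogeneous p a"
  shows "slotwise c (wedge a b) vs = wedge (slotwise c a) b vs + wedge a (slotwise c b) vs"
  using assms
proof (induction vs arbitrary: p a b)
  case Nil
  then show ?case by (simp add: slotwise_def wedge_Nil)
next
  case (Cons v vs)
  have "contraction v (wedge a b) =
      (\<lambda>ws. (-1) ^ p * wedge a (contraction v b) ws + wedge (contraction v a) b ws)"
    using wedge_Cons[OF Cons.prems, of b v] by (auto simp: contraction_def fun_eq_iff)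
  then have "slotwise c (contraction v (wedge a b)) vs =
      (-1) ^ p * slotwise c (wedge a (contraction v b)) vs + slotwise c (wedge (contraction v a) b) vs"
    by (simp only: slotwise_linear)
  also have "\<dots> = (-1) ^ p * (wedge (slotwise c a) (contraction v b) vs + wedge a (slotwise c (contraction v b)) vs)
      + (wedge (slotwise c (contraction v a)) b vs + wedge (contraction v a) (slotwise c b) vs)"
    using Cons.IH[OF Cons.prems] Cons.IH[OF homogeneous_contraction[OF Cons.prems]] by simp
  finally have "slotwise c (wedge a b) (v # vs) =
      wedge (contraction (c v) a) b vs + (-1) ^ p * wedge a (contraction (c v) b) vs + \<dots>"
    by (simp only: slotwise_Cons wedge_Cons[OF Cons.prems])
  also have "\<dots> = wedge (slotwise c a) b (v # vs) + wedge a (slotwise c b) (v # vs)"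
    unfolding wedge_Cons[OF Cons.prems] wedge_Cons[OF homogeneous_slotwise[OF Cons.prems]]
      contraction_slotwise wedge_add_left wedge_add_right
    by (simp add: algebra_simps)
  finally show ?case .
qed

section \<open>Sections of a vector bundle\<close>

context smooth_vector_bundle
begin

lemma fibre_basis_exists: obtains B :: "'f set" where "orthonormal_basis B"
  using model_fibre unfolding is_Rn_def orthonormal_basis_def by blast

lemma fibre_combination: "v \<in> E x \<Longrightarrow> w \<in> E x \<Longrightarrow> c *\<^sub>R v + w \<in> E x"
  using fibre_subspace by (simp add: subspace_add subspace_scale)

lemma fibre_zero: "0 \<in> E x"
  using fibre_subspace subspace_0 by blast

lemma fibre_scale: "v \<in> E x \<Longrightarrow> c *\<^sub>R v \<in> E x"
  using fibre_subspace subspace_scale by blast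

lemma fibre_add: "v \<in> E x \<Longrightarrow> w \<in> E x \<Longrightarrow> v + w \<in> E x"
  using fibre_subspace subspace_add by blast

context
  fixes U \<tau> x assumes triv: "(U, \<tau>) \<in> triv" and x: "x \<in> U"
begin

lemma frame_mem: "inv_into (E x) (\<tau> x) s \<in> E x"
  using triv_bij[OF triv x] by (auto simp: bij_betw_def inv_into_into)

lemma triv_frame: "\<tau> x (inv_into (E x) (\<tau> x) s) = s"
  using triv_bij[OF triv x] by (auto simp: bij_betw_def f_inv_into_f)

lemma frame_triv: "v \<in> E x \<Longrightarrow> inv_into (E x) (\<tau> x) (\<tau> x v) = v"
  using triv_bij[OF triv x] by (auto simp: bij_betw_def)

lemma frame_linear:
  "inv_into (E x) (\<tau> x) (c *\<^sub>R s + t) = c *\<^sub>R inv_into (E x) (\<tau> x) s + inv_into (E x) (\<tau> x) t"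
  using frame_triv[OF fibre_combination[OF frame_mem frame_mem], of c s t]
    triv_linear[OF triv x frame_mem frame_mem, of c s t]
  by (simp add: triv_frame)

lemma triv_zero: "\<tau> x 0 = 0"
  using triv_linear[OF triv x fibre_zero fibre_zero, of 1] by simp

lemma triv_scale: "v \<in> E x \<Longrightarrow> \<tau> x (c *\<^sub>R v) = c *\<^sub>R \<tau> x v"
  using triv_linear[OF triv x _ fibre_zero, of v c] by (simp add: triv_zero)

lemma frame_sum:
  "inv_into (E x) (\<tau> x) (\<Sum>b\<in>B. c b *\<^sub>R t b) = (\<Sum>b\<in>B. c b *\<^sub>R inv_into (E x) (\<tau> x) (t b))"
proof (induction B rule: infinite_finite_induct)
  case empty
  then show ?case using frame_linear[of "-1" 0 0] by simp
next
  case (infinite A)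
  then show ?case using frame_linear[of "-1" 0 0] by simp
next
  case (insert b B)
  then show ?case using frame_linear[of "c b" "t b"] by simp
qed

lemma frame_expand:
  assumes "orthonormal_basis B" "v \<in> E x"
  shows "v = (\<Sum>b\<in>B. (\<tau> x v \<bullet> b) *\<^sub>R inv_into (E x) (\<tau> x) b)"
  using frame_sum[where B = B and t = "\<lambda>b. b" and c = "\<lambda>b. \<tau> x v \<bullet> b"]
    orthonormal_basis_expand[OF assms(1), of "\<tau> x v"] frame_triv[OF assms(2)] by simp

end

definition local_section :: "'m set \<Rightarrow> ('m \<Rightarrow> 'v \<Rightarrow> 'f) \<Rightarrow> ('m \<Rightarrow> 'v) \<Rightarrow> bool" where
  "local_section U \<tau> s \<longleftrightarrow> (\<forall>x\<in>U. s x \<in> E x) \<and> smooth_map_on U (\<lambda>x. \<tau> x (s x))"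

lemma section_mem: "\<psi> \<in> sections \<Longrightarrow> \<psi> x \<in> E x"
  by (simp add: sections_def)

lemma section_local: "\<psi> \<in> sections \<Longrightarrow> (U, \<tau>) \<in> triv \<Longrightarrow> local_section U \<tau> \<psi>"
  unfolding sections_def local_section_def by auto

lemma frame_local:
  assumes "(U, \<tau>) \<in> triv"
  shows "local_section U \<tau> (\<lambda>x. inv_into (E x) (\<tau> x) s)"
proof -
  have "smooth_map_on U (\<lambda>x. \<tau> x (inv_into (E x) (\<tau> x) s))"
    by (rule smooth_map_on_cong[OF triv_open[OF assms] smooth_map_on_const[of _ s]])
      (simp add: triv_frame[OF assms])
  then show ?thesis
    using frame_mem[OF assms] by (simp add: local_section_def)
qed

lemma local_section_coordinate:
  assumes "(U, \<tau>) \<in> triv" "local_section U \<tau> s"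
  shows "smooth_map_on U (\<lambda>x. \<tau> x (s x) \<bullet> b)"
  using assms(2) unfolding local_section_def
  by (intro smooth_map_on_inner triv_open[OF assms(1)] smooth_map_on_const) auto

lemma smooth_functions_trivI:
  assumes "\<And>U \<tau>. (U, \<tau>) \<in> triv \<Longrightarrow> smooth_map_on U f"
  shows "f \<in> smooth_functions"
  unfolding smooth_functions_def mem_Collect_eq
proof (rule smooth_map_on_local)
  fix x
  obtain U \<tau> where "(U, \<tau>) \<in> triv" "x \<in> U" using triv_cover[of x] by auto
  then show "\<exists>W' f'. open W' \<and> x \<in> W' \<and> smooth_map_on W' f' \<and> (\<forall>y\<in>W'. f y = f' y)"
    using assms triv_open by blast
qed

lemma smooth_functionD: "f \<in> smooth_functions \<Longrightarrow> smooth_map_on W f"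
  unfolding smooth_functions_def using smooth_map_on_subset by blast

lemma sections_combination:
  assumes "f \<in> smooth_functions" "\<phi> \<in> sections" "\<eta> \<in> sections"
  shows "(\<lambda>x. f x *\<^sub>R \<phi> x + \<eta> x) \<in> sections"
  unfolding sections_def
proof (intro CollectI conjI allI ballI)
  show "f x *\<^sub>R \<phi> x + \<eta> x \<in> E x" for x
    using assms by (simp add: fibre_combination section_mem)
  fix t assume "t \<in> triv"
  then obtain U \<tau> where t: "t = (U, \<tau>)" "(U, \<tau>) \<in> triv" by (cases t) auto
  have "smooth_map_on U (\<lambda>x. f x *\<^sub>R \<tau> x (\<phi> x) + \<tau> x (\<eta> x))"
    using section_local[OF _ t(2)] assms triv_open[OF t(2)] unfolding local_section_def
    by (intro smooth_map_on_add smooth_map_on_scaleR smooth_functionD) auto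
  then have "smooth_map_on U (\<lambda>x. \<tau> x (f x *\<^sub>R \<phi> x + \<eta> x))"
    by (rule smooth_map_on_cong[OF triv_open[OF t(2)]])
      (use triv_linear[OF t(2)] section_mem assms in auto)
  then show "case t of (U, \<tau>) \<Rightarrow> smooth_map_on U (\<lambda>x. \<tau> x (f x *\<^sub>R \<phi> x + \<eta> x))"
    by (simp add: t)
qed

lemma zero_section: "(\<lambda>x. 0) \<in> sections"
proof -
  have "smooth_map_on U (\<lambda>x. \<tau> x 0)" if "(U, \<tau>) \<in> triv" for U \<tau>
    by (rule smooth_map_on_cong[OF triv_open[OF that] smooth_map_on_const[of _ 0]])
      (simp add: triv_zero[OF that])
  then show ?thesis
    using fibre_zero by (auto simp: sections_def)
qed

lemma sections_scale: "f \<in> smooth_functions \<Longrightarrow> \<phi> \<in> sections \<Longrightarrow> (\<lambda>x. f x *\<^sub>R \<phi> x) \<in> sections"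
  using sections_combination[OF _ _ zero_section] by simp

lemma sections_add: "\<phi> \<in> sections \<Longrightarrow> \<eta> \<in> sections \<Longrightarrow> (\<lambda>x. \<phi> x + \<eta> x) \<in> sections"
  using sections_combination[OF smooth_functions_const, of \<phi> \<eta> 1] by simp

context
  fixes U \<tau> \<theta> K
  assumes triv: "(U, \<tau>) \<in> triv" and \<theta>: "\<theta> \<in> smooth_functions"
    and K: "closed K" "K \<subseteq> U" "\<And>x. x \<notin> K \<Longrightarrow> \<theta> x = 0"
begin

text \<open>Outside \<open>U\<close> the value of \<open>inv_into\<close> is arbitrary, but multiplied by 0.\<close>

lemma cutoff_section: "(\<lambda>x. \<theta> x *\<^sub>R inv_into (E x) (\<tau> x) s) \<in> sections" (is "?\<psi> \<in> _")
  unfolding sections_def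
proof (intro CollectI conjI allI ballI)
  show "?\<psi> x \<in> E x" for x
    using K frame_mem[OF triv] fibre_scale fibre_zero by (cases "x \<in> K") auto
  fix t assume "t \<in> triv"
  then obtain V \<sigma> where t: "t = (V, \<sigma>)" "(V, \<sigma>) \<in> triv" by (cases t) auto
  have "smooth_map_on V (\<lambda>x. \<sigma> x (?\<psi> x))"
  proof (rule smooth_map_on_local)
    fix x assume x: "x \<in> V"
    show "\<exists>W' f'. open W' \<and> x \<in> W' \<and> smooth_map_on W' f' \<and> (\<forall>y\<in>W'. \<sigma> y (?\<psi> y) = f' y)"
    proof (cases "x \<in> K")
      case True
      have "open (U \<inter> V)" using triv_open triv t(2) by blast
      then have "smooth_map_on (U \<inter> V) (\<lambda>x. \<theta> x *\<^sub>R \<sigma> x (inv_into (E x) (\<tau> x) s))"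
        by (intro smooth_map_on_scaleR smooth_functionD \<theta> triv_compatible triv t(2))
      moreover have "\<sigma> y (?\<psi> y) = \<theta> y *\<^sub>R \<sigma> y (inv_into (E y) (\<tau> y) s)" if "y \<in> U \<inter> V" for y
        using that triv_scale[OF t(2)] frame_mem[OF triv] by simp
      ultimately show ?thesis using \<open>open (U \<inter> V)\<close> x True K(2)
        by (intro exI[of _ "U \<inter> V"] exI[of _ "\<lambda>x. \<theta> x *\<^sub>R \<sigma> x (inv_into (E x) (\<tau> x) s)"]) auto
    next
      case False
      have "open (V \<inter> - K)" using triv_open[OF t(2)] K(1) by (intro open_Int) auto
      then show ?thesis
        using x False K(3) triv_zero[OF t(2)]
        by (intro exI[of _ "V \<inter> - K"] exI[of _ "\<lambda>x. 0"]) (auto simp: smooth_map_on_const)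
    qed
  qed
  then show "case t of (V, \<sigma>) \<Rightarrow> smooth_map_on V (\<lambda>x. \<sigma> x (?\<psi> x))"
    by (simp add: t)
qed

lemma cutoff_function:
  assumes "smooth_map_on U f"
  shows "(\<lambda>x. \<theta> x * f x) \<in> smooth_functions"
  unfolding smooth_functions_def mem_Collect_eq
proof (rule smooth_map_on_local)
  fix x
  show "\<exists>W' f'. open W' \<and> x \<in> W' \<and> smooth_map_on W' f' \<and> (\<forall>y\<in>W'. \<theta> y * f y = f' y)"
  proof (cases "x \<in> K")
    case True
    have "smooth_map_on U (\<lambda>x. \<theta> x * f x)"
      using triv_open[OF triv] smooth_functionD[OF \<theta>] assms by (rule smooth_map_on_mult)
    then show ?thesis using triv_open[OF triv] K(2) True by blast
  next
    case False
    then show ?thesis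
      using K(1,3)
      by (intro exI[of _ "- K"] exI[of _ "\<lambda>x. 0"]) (auto simp: smooth_map_on_const)
  qed
qed

end

lemma section_through_exists:
  assumes "v \<in> E x"
  shows "\<exists>\<psi>\<in>sections. \<psi> x = v"
proof -
  obtain U \<tau> where t: "(U, \<tau>) \<in> triv" "x \<in> U" using triv_cover[of x] by auto
  obtain \<theta> K where \<theta>: "\<theta> \<in> smooth_functions" "\<theta> x = 1" "closed K" "K \<subseteq> U" "\<And>x. x \<notin> K \<Longrightarrow> \<theta> x = 0"
    using bump_function[OF triv_open[OF t(1)] t(2)] by metis
  show ?thesis
    using cutoff_section[OF t(1) \<theta>(1,3-5), of "\<tau> x v"] frame_triv[OF t assms] \<theta>(2)
    by (intro bexI[of _ "\<lambda>y. \<theta> y *\<^sub>R inv_into (E y) (\<tau> y) (\<tau> x v)"]) auto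
qed

definition section_through :: "'m \<Rightarrow> 'v \<Rightarrow> 'm \<Rightarrow> 'v" where
  "section_through x v = (SOME \<psi>. \<psi> \<in> sections \<and> \<psi> x = v)"

lemma section_through:
  assumes "v \<in> E x"
  shows "section_through x v \<in> sections" "section_through x v x = v"
  using someI_ex[of "\<lambda>\<psi>. \<psi> \<in> sections \<and> \<psi> x = v"] section_through_exists[OF assms]
  unfolding section_through_def by auto

lemma sections_through:
  assumes "set vs \<subseteq> E x"
  shows "set (map (section_through x) vs) \<subseteq> sections"
    and "map (\<lambda>\<psi>. \<psi> x) (map (section_through x) vs) = vs"
  using assms section_through by (auto intro!: map_idI)

text \<open>If \<open>\<psi>\<close> vanishes at \<open>x\<close>, then so do the coordinates \<open>\<psi>\<^sub>b\<close> of \<open>\<psi>\<close> in a local frame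
  \<open>(e\<^sub>b)\<close>, and \<open>\<psi> = \<Sum>\<^sub>b (\<theta> \<psi>\<^sub>b) (\<theta> e\<^sub>b) + (1 - \<theta>\<^sup>2) \<psi>\<close> for a bump function \<open>\<theta>\<close> at \<open>x\<close>.
  This shows that function-linear operations on sections are pointwise.\<close>

lemma linear_vanishes_at:
  fixes F :: "('m \<Rightarrow> 'v) \<Rightarrow> real"
  assumes lin: "\<And>f \<phi> \<eta>. f \<in> smooth_functions \<Longrightarrow> \<phi> \<in> sections \<Longrightarrow> \<eta> \<in> sections \<Longrightarrow>
      F (\<lambda>y. f y *\<^sub>R \<phi> y + \<eta> y) = f x * F \<phi> + F \<eta>"
    and \<psi>: "\<psi> \<in> sections" "\<psi> x = 0"
  shows "F \<psi> = 0"
proof -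
  obtain B :: "'f set" where B: "orthonormal_basis B" by (rule fibre_basis_exists)
  obtain U \<tau> where t: "(U, \<tau>) \<in> triv" "x \<in> U" using triv_cover[of x] by auto
  obtain \<theta> K where \<theta>: "\<theta> \<in> smooth_functions" "\<theta> x = 1" "closed K" "K \<subseteq> U" "\<And>x. x \<notin> K \<Longrightarrow> \<theta> x = 0"
    using bump_function[OF triv_open[OF t(1)] t(2)] by metis
  define e where "e b y = \<theta> y *\<^sub>R inv_into (E y) (\<tau> y) b" for b y
  define c where "c b y = \<theta> y * (\<tau> y (\<psi> y) \<bullet> b)" for b y
  have e: "e b \<in> sections" for b
    unfolding e_def using cutoff_section[OF t(1) \<theta>(1,3-5)] .
  have c: "c b \<in> smooth_functions" for b
    unfolding c_def
    by (intro cutoff_function[OF t(1) \<theta>(1,3-5)] local_section_coordinate section_local t \<psi>)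
  have zero: "F (\<lambda>y. 0) = 0"
    using lin[OF smooth_functions_const zero_section zero_section, of 1] by simp
  have sum: "(\<lambda>y. \<Sum>b\<in>A. c b y *\<^sub>R e b y) \<in> sections \<and> F (\<lambda>y. \<Sum>b\<in>A. c b y *\<^sub>R e b y) = 0" for A
  proof (induction A rule: infinite_finite_induct)
    case (insert b A)
    have "c b x = 0" by (simp add: c_def \<psi>(2) triv_zero[OF t])
    then show ?case using insert lin[OF c e] sections_combination[OF c e] by simp
  qed (simp_all add: zero_section zero)
  have one_minus: "(\<lambda>y. 1 + (-1) * (\<theta> y * \<theta> y)) \<in> smooth_functions"
    by (intro smooth_functions_add smooth_functions_mult smooth_functions_const \<theta>)
  have "\<psi> y = (1 + (-1) * (\<theta> y * \<theta> y)) *\<^sub>R \<psi> y + (\<Sum>b\<in>B. c b y *\<^sub>R e b y)" for y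
  proof (cases "y \<in> K")
    case True
    then have y: "y \<in> U" using \<theta>(4) by auto
    have "(\<theta> y * \<theta> y) *\<^sub>R \<psi> y = (\<Sum>b\<in>B. (\<theta> y * \<theta> y) *\<^sub>R (\<tau> y (\<psi> y) \<bullet> b) *\<^sub>R inv_into (E y) (\<tau> y) b)"
      using frame_expand[OF t(1) y B section_mem[OF \<psi>(1)]] unfolding scaleR_sum_right[symmetric] by simp
    also have "\<dots> = (\<Sum>b\<in>B. c b y *\<^sub>R e b y)"
      by (simp add: c_def e_def mult.assoc mult.left_commute mult.commute)
    finally show ?thesis by (simp add: algebra_simps)
  next
    case False
    then show ?thesis using \<theta>(5) by (simp add: c_def)
  qed
  then have "F \<psi> = F (\<lambda>y. (1 + (-1) * (\<theta> y * \<theta> y)) *\<^sub>R \<psi> y + (\<Sum>b\<in>B. c b y *\<^sub>R e b y))"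
    by presburger
  also have "\<dots> = 0"
    using lin[OF one_minus \<psi>(1)] sum[of B] \<theta>(2) by simp
  finally show ?thesis .
qed

end

section \<open>Smooth objects evaluated on sections\<close>

context metric_anchored_bundle
begin

lemma fibre_forms: "subspace_forms (E x)"
  by (simp add: subspace_forms_def fibre_subspace)

lemma anchor_zero: "\<rho> x 0 f = 0"
  using anchor_linear[OF fibre_zero fibre_zero, of x 1 f] by simp

lemma anchor_sum:
  "(\<And>b. b \<in> B \<Longrightarrow> e b \<in> E x) \<Longrightarrow> \<rho> x (\<Sum>b\<in>B. c b *\<^sub>R e b) f = (\<Sum>b\<in>B. c b * \<rho> x (e b) f)"
proof (induction B rule: infinite_finite_induct)
  case (insert b B)
  then have "(\<Sum>b\<in>B. c b *\<^sub>R e b) \<in> E x"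
    by (intro subspace_sum[OF fibre_subspace] fibre_scale) auto
  then show ?case using insert by (simp add: anchor_linear)
qed (simp_all add: anchor_zero)

lemma metric_linear_right:
  "u \<in> E x \<Longrightarrow> v \<in> E x \<Longrightarrow> w \<in> E x \<Longrightarrow> g x w (a *\<^sub>R u + v) = a * g x w u + g x w v"
  using metric_linear metric_sym fibre_combination by metis

lemma metric_sum:
  assumes "\<And>b. b \<in> B \<Longrightarrow> e b \<in> E x" "w \<in> E x"
  shows "g x (\<Sum>b\<in>B. c b *\<^sub>R e b) w = (\<Sum>b\<in>B. c b * g x (e b) w)"
  using assms(1)
proof (induction B rule: infinite_finite_induct)
  case (insert b B)
  then have "(\<Sum>b\<in>B. c b *\<^sub>R e b) \<in> E x"
    by (intro subspace_sum[OF fibre_subspace] fibre_scale) auto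
  then show ?case using insert assms(2) by (simp add: metric_linear)
qed (use metric_linear[OF fibre_zero fibre_zero assms(2), of 1] in simp_all)

lemma anchor_function_smooth:
  assumes "\<phi> \<in> sections" "f \<in> smooth_functions"
  shows "(\<lambda>x. \<rho> x (\<phi> x) f) \<in> smooth_functions"
proof (rule smooth_functions_trivI)
  fix U \<tau> assume t: "(U, \<tau>) \<in> triv"
  obtain B :: "'f set" where B: "orthonormal_basis B" by (rule fibre_basis_exists)
  have "smooth_map_on U (\<lambda>x. \<Sum>b\<in>B. (\<tau> x (\<phi> x) \<bullet> b) * \<rho> x (inv_into (E x) (\<tau> x) b) f)"
    by (intro smooth_map_on_sum smooth_map_on_mult triv_open[OF t] local_section_coordinate[OF t]
        section_local t anchor_smooth assms)
  then show "smooth_map_on U (\<lambda>x. \<rho> x (\<phi> x) f)"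
  proof (rule smooth_map_on_cong[OF triv_open[OF t]])
    fix x assume "x \<in> U"
    then show "\<rho> x (\<phi> x) f = (\<Sum>b\<in>B. (\<tau> x (\<phi> x) \<bullet> b) * \<rho> x (inv_into (E x) (\<tau> x) b) f)"
      using anchor_sum[of B "inv_into (E x) (\<tau> x)" x] frame_mem[OF t]
      by (subst frame_expand[OF t _ B section_mem[OF assms(1)], of x]) auto
  qed
qed

lemma metric_function_smooth:
  assumes "\<phi> \<in> sections" "\<psi> \<in> sections"
  shows "(\<lambda>x. g x (\<phi> x) (\<psi> x)) \<in> smooth_functions"
proof (rule smooth_functions_trivI)
  fix U \<tau> assume t: "(U, \<tau>) \<in> triv"
  obtain B :: "'f set" where B: "orthonormal_basis B" by (rule fibre_basis_exists)
  let ?e = "\<lambda>x. inv_into (E x) (\<tau> x)"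
  have "smooth_map_on U (\<lambda>x. \<Sum>a\<in>B. (\<tau> x (\<phi> x) \<bullet> a) * (\<Sum>b\<in>B. (\<tau> x (\<psi> x) \<bullet> b) * g x (?e x b) (?e x a)))"
    by (intro smooth_map_on_sum smooth_map_on_mult triv_open[OF t] local_section_coordinate[OF t]
        section_local t metric_smooth assms)
  then show "smooth_map_on U (\<lambda>x. g x (\<phi> x) (\<psi> x))"
  proof (rule smooth_map_on_cong[OF triv_open[OF t]])
    fix x assume x: "x \<in> U"
    have mem: "?e x b \<in> E x" "\<phi> x \<in> E x" "\<psi> x \<in> E x" for b
      using frame_mem[OF t x] section_mem assms by auto
    have outer: "g x (\<phi> x) (\<psi> x) = (\<Sum>a\<in>B. (\<tau> x (\<phi> x) \<bullet> a) * g x (?e x a) (\<psi> x))"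
      using metric_sum[where B = B and e = "?e x" and c = "\<lambda>b. \<tau> x (\<phi> x) \<bullet> b", OF mem(1) mem(3)]
        frame_expand[OF t x B mem(2), symmetric] by simp
    have inner: "g x (?e x a) (\<psi> x) = (\<Sum>b\<in>B. (\<tau> x (\<psi> x) \<bullet> b) * g x (?e x b) (?e x a))" for a
      using metric_sum[where B = B and e = "?e x" and c = "\<lambda>b. \<tau> x (\<psi> x) \<bullet> b", OF mem(1) mem(1)]
        frame_expand[OF t x B mem(3), symmetric]
        metric_sym[OF mem(1) mem(3)] by simp
    show "g x (\<phi> x) (\<psi> x) =
      (\<Sum>a\<in>B. (\<tau> x (\<phi> x) \<bullet> a) * (\<Sum>b\<in>B. (\<tau> x (\<psi> x) \<bullet> b) * g x (?e x b) (?e x a)))"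
      unfolding outer inner ..
  qed
qed

lemma form_section_alternating: "\<alpha> \<in> form_sections p \<Longrightarrow> \<alpha> x \<in> alternating_forms (E x) p"
  by (simp add: form_sections_def)

text \<open>The arguments are expanded in the local frame one by one, from left to right; \<open>bs\<close> lists the
  frame vectors obtained so far.\<close>

lemma form_smooth_local:
  assumes \<alpha>: "\<alpha> \<in> form_sections p" and t: "(U, \<tau>) \<in> triv"
    and "\<forall>s\<in>set ss. local_section U \<tau> s"
  shows "smooth_map_on U (\<lambda>x. \<alpha> x (map (inv_into (E x) (\<tau> x)) bs @ map (\<lambda>s. s x) ss))"
  using assms(3)
proof (induction ss arbitrary: bs)
  case Nil
  show ?case
  proof (cases "length bs = p")
    case True
    then show ?thesis using \<alpha> t by (auto simp: form_sections_def)
  next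
    case False
    then have "\<alpha> x (map (inv_into (E x) (\<tau> x)) bs) = 0" for x
      using alternating_forms_zero[OF form_section_alternating[OF \<alpha>]] by simp
    then show ?thesis by (simp add: smooth_map_on_const)
  qed
next
  case (Cons s ss)
  obtain B :: "'f set" where B: "orthonormal_basis B" by (rule fibre_basis_exists)
  let ?e = "\<lambda>x. inv_into (E x) (\<tau> x)"
  have s: "local_section U \<tau> s" using Cons.prems by simp
  have "smooth_map_on U (\<lambda>x. \<alpha> x (map (?e x) (bs @ [b]) @ map (\<lambda>s. s x) ss))" for b
    using Cons.IH[of "bs @ [b]"] Cons.prems by simp
  then have "smooth_map_on U (\<lambda>x. \<Sum>b\<in>B. (\<tau> x (s x) \<bullet> b) * \<alpha> x (map (?e x) (bs @ [b]) @ map (\<lambda>s. s x) ss))"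
    by (intro smooth_map_on_sum smooth_map_on_mult triv_open[OF t] local_section_coordinate[OF t] s)
  then show ?case
  proof (rule smooth_map_on_cong[OF triv_open[OF t]])
    fix x assume x: "x \<in> U"
    then have "s x \<in> E x" using s by (simp add: local_section_def)
    then have "\<alpha> x (map (?e x) bs @ s x # map (\<lambda>s. s x) ss) =
        \<alpha> x (map (?e x) bs @ (\<Sum>b\<in>B. (\<tau> x (s x) \<bullet> b) *\<^sub>R ?e x b) # map (\<lambda>s. s x) ss)"
      using frame_expand[OF t x B] by simp
    then show "\<alpha> x (map (?e x) bs @ map (\<lambda>s. s x) (s # ss)) =
        (\<Sum>b\<in>B. (\<tau> x (s x) \<bullet> b) * \<alpha> x (map (?e x) (bs @ [b]) @ map (\<lambda>s. s x) ss))"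
      using subspace_forms.form_sum_append[where B = B and e = "?e x", OF fibre_forms
          form_section_alternating[OF \<alpha>] frame_mem[OF t x]] by simp
  qed
qed

lemma eval_form_smooth:
  assumes "\<alpha> \<in> form_sections p" "set \<psi>s \<subseteq> sections"
  shows "eval_form \<alpha> \<psi>s \<in> smooth_functions"
proof (rule smooth_functions_trivI)
  fix U \<tau> assume t: "(U, \<tau>) \<in> triv"
  show "smooth_map_on U (eval_form \<alpha> \<psi>s)"
    using form_smooth_local[OF assms(1) t, of \<psi>s "[]"] section_local[OF _ t] assms(2)
    by (auto simp: eval_form_def[abs_def])
qed

lemma form_sections_combination:
  assumes "\<alpha> \<in> form_sections p" "\<beta> \<in> form_sections p"
  shows "(\<lambda>x ws. c * \<alpha> x ws + \<beta> x ws) \<in> form_sections p"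
  using assms unfolding form_sections_def
  by (auto intro!: add_alternating_forms smooth_map_on_add smooth_map_on_mult smooth_map_on_const
      dest: triv_open)

definition contract :: "('m \<Rightarrow> 'v) \<Rightarrow> ('m \<Rightarrow> 'v list \<Rightarrow> real) \<Rightarrow> 'm \<Rightarrow> 'v list \<Rightarrow> real" where
  "contract \<phi> \<alpha> x = contraction (\<phi> x) (\<alpha> x)"

lemma contract_form_section:
  assumes "\<alpha> \<in> form_sections p" "\<phi> \<in> sections"
  shows "contract \<phi> \<alpha> \<in> form_sections (p - 1)"
  unfolding form_sections_def
proof (intro CollectI conjI allI ballI)
  show "contract \<phi> \<alpha> x \<in> alternating_forms (E x) (p - 1)" for x
    unfolding contract_def
    by (intro subspace_forms.contraction_alternating fibre_forms form_section_alternating section_mem assms)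
  fix t assume "t \<in> triv"
  then obtain U \<tau> where t: "t = (U, \<tau>)" "(U, \<tau>) \<in> triv" by (cases t) auto
  have "smooth_map_on U (\<lambda>x. contract \<phi> \<alpha> x (map (inv_into (E x) (\<tau> x)) ss))" for ss
    using form_smooth_local[OF assms(1) t(2), of "\<phi> # map (\<lambda>s x. inv_into (E x) (\<tau> x) s) ss" "[]"]
      frame_local[OF t(2)] section_local[OF assms(2) t(2)]
    by (auto simp: contract_def contraction_def comp_def)
  then show "case t of (U, \<tau>) \<Rightarrow> \<forall>ss. length ss = p - 1 \<longrightarrow>
      smooth_map_on U (\<lambda>x. contract \<phi> \<alpha> x (map (inv_into (E x) (\<tau> x)) ss))"
    by (simp add: t)
qed

lemma wedge_form_section:
  assumes "\<alpha> \<in> form_sections p" "\<beta> \<in> form_sections q"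
  shows "(\<lambda>x. wedge (\<alpha> x) (\<beta> x)) \<in> form_sections (p + q)"
  unfolding form_sections_def
proof (intro CollectI conjI allI ballI)
  show "wedge (\<alpha> x) (\<beta> x) \<in> alternating_forms (E x) (p + q)" for x
    by (intro subspace_forms.wedge_alternating fibre_forms form_section_alternating assms)
  fix t assume "t \<in> triv"
  then obtain U \<tau> where t: "t = (U, \<tau>)" "(U, \<tau>) \<in> triv" by (cases t) auto
  have "smooth_map_on U (\<lambda>x. \<gamma> x (map (inv_into (E x) (\<tau> x)) ss))" if "\<gamma> \<in> form_sections r" for \<gamma> r ss
    using form_smooth_local[OF that t(2), of "[]"] by simp
  then have "smooth_map_on U (\<lambda>x. wedge (\<alpha> x) (\<beta> x) (map (inv_into (E x) (\<tau> x)) ss))" for ss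
    unfolding wedge_map unfolding wedge_def
    by (intro smooth_map_on_sum smooth_map_on_mult smooth_map_on_const triv_open[OF t(2)])
      (use assms in auto)
  then show "case t of (U, \<tau>) \<Rightarrow> \<forall>ss. length ss = p + q \<longrightarrow>
      smooth_map_on U (\<lambda>x. wedge (\<alpha> x) (\<beta> x) (map (inv_into (E x) (\<tau> x)) ss))"
    by (simp add: t)
qed

end

section \<open>The kernel of the extended anchor\<close>

context metric_anchored_bundle
begin

text \<open>In coordinates the metric gives a linear map from the model fibre to itself. It is injective by
  non-degeneracy, hence surjective.\<close>

lemma metric_representation:
  assumes L: "\<And>a u v. u \<in> E x \<Longrightarrow> v \<in> E x \<Longrightarrow> L (a *\<^sub>R u + v) = a * L u + (L v :: real)"
  shows "\<exists>!u. u \<in> E x \<and> (\<forall>v\<in>E x. g x u v = L v)"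
proof (rule ex_ex1I)
  obtain B :: "'f set" where B: "orthonormal_basis B" by (rule fibre_basis_exists)
  obtain U \<tau> where t: "(U, \<tau>) \<in> triv" "x \<in> U" using triv_cover[of x] by auto
  let ?e = "inv_into (E x) (\<tau> x)"
  note e = frame_mem[OF t]
  have on_frame: "F v = 0"
    if F: "\<And>a u v. u \<in> E x \<Longrightarrow> v \<in> E x \<Longrightarrow> F (a *\<^sub>R u + v) = a * F u + (F v :: real)"
      and 0: "\<And>b. b \<in> B \<Longrightarrow> F (?e b) = 0" and v: "v \<in> E x" for F v
  proof -
    have zero: "F 0 = 0" using F[OF fibre_zero fibre_zero, of 1] by simp
    have "(\<Sum>b\<in>A. c b *\<^sub>R ?e b) \<in> E x \<and> F (\<Sum>b\<in>A. c b *\<^sub>R ?e b) = 0" if "A \<subseteq> B" for A c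
      using that
    proof (induction A rule: infinite_finite_induct)
      case (insert b A)
      then show ?case using F[OF e, of _ "c b" b] 0[of b] fibre_combination[OF e] by auto
    qed (simp_all add: zero fibre_zero)
    then show ?thesis using frame_expand[OF t B v] by (metis order_refl)
  qed
  define M where "M s = (\<Sum>b\<in>B. g x (?e s) (?e b) *\<^sub>R b)" for s
  have "linear M"
  proof (rule linearI)
    show "M (s + s') = M s + M s'" for s s'
      using frame_linear[OF t, of 1 s s'] metric_linear[OF e e e, of 1]
      by (simp add: M_def scaleR_add_left sum.distrib)
    have "?e (r *\<^sub>R s) = r *\<^sub>R ?e s + 0" for r s
      using frame_linear[OF t, of r s 0] frame_linear[OF t, of "-1" 0 0] by simp
    moreover have "g x 0 (?e b) = 0" for b
      using metric_linear[OF fibre_zero fibre_zero e, of 1] by simp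
    ultimately show "M (r *\<^sub>R s) = r *\<^sub>R M s" for r s
      using metric_linear[OF e fibre_zero e, of r] by (simp add: M_def scaleR_sum_right)
  qed
  moreover have "inj M"
    unfolding linear_injective_0[OF \<open>linear M\<close>]
  proof (intro allI impI)
    fix s assume "M s = 0"
    then have "g x (?e s) (?e b) = 0" if "b \<in> B" for b
      using orthonormal_basis_coordinate[OF B that, of "\<lambda>b. g x (?e s) (?e b)"] by (simp add: M_def)
    then have "\<forall>v\<in>E x. g x (?e s) v = 0"
      using on_frame[of "g x (?e s)"] metric_linear_right[OF _ _ e] by blast
    then have "?e s = 0" using metric_nondegenerate[OF e] by blast
    then show "s = 0" using triv_frame[OF t, of s] triv_zero[OF t] by simp
  qed
  ultimately obtain s where s: "M s = (\<Sum>b\<in>B. L (?e b) *\<^sub>R b)"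
    using orthonormal_basis_injective_surjective[OF B] by (metis surjD)
  have on_basis: "g x (?e s) (?e b) - L (?e b) = 0" if "b \<in> B" for b
    using orthonormal_basis_coordinate[OF B that, of "\<lambda>b. g x (?e s) (?e b)"]
      orthonormal_basis_coordinate[OF B that, of "\<lambda>b. L (?e b)"] s by (simp add: M_def)
  have "g x (?e s) (a *\<^sub>R u + v) - L (a *\<^sub>R u + v) = a * (g x (?e s) u - L u) + (g x (?e s) v - L v)"
    if "u \<in> E x" "v \<in> E x" for a u v
    unfolding metric_linear_right[OF that e] L[OF that] by (simp add: algebra_simps)
  then have "g x (?e s) v - L v = 0" if "v \<in> E x" for v
    by (rule on_frame[of "\<lambda>v. g x (?e s) v - L v", OF _ on_basis that])
  then show "\<exists>u. u \<in> E x \<and> (\<forall>v\<in>E x. g x u v = L v)"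
    using e by (intro exI[of _ "?e s"]) auto
next
  fix u u' assume u: "u \<in> E x \<and> (\<forall>v\<in>E x. g x u v = L v)" "u' \<in> E x \<and> (\<forall>v\<in>E x. g x u' v = L v)"
  have "g x ((-1) *\<^sub>R u + u') v = 0" if "v \<in> E x" for v
    using metric_linear[of u x u' v "-1"] u that by simp
  then have "(-1) *\<^sub>R u + u' = 0"
    using metric_nondegenerate[of "(-1) *\<^sub>R u + u'" x] fibre_combination[of u x u' "-1"] u by blast
  then show "u = u'" by simp
qed

definition anchor_gradient :: "('m \<Rightarrow> real) \<Rightarrow> 'm \<Rightarrow> 'v" where
  "anchor_gradient f x = anchor_dual x (differential f x)"

lemma anchor_gradient:
  shows anchor_gradient_mem: "anchor_gradient f x \<in> E x"
    and metric_anchor_gradient: "v \<in> E x \<Longrightarrow> g x (anchor_gradient f x) v = \<rho> x v f"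
  using theI'[OF metric_representation[of x "\<lambda>v. \<rho> x v f", OF anchor_linear]]
  by (simp_all add: anchor_gradient_def anchor_dual_def differential_def)

lemma anchor_gradient_unique:
  "u \<in> E x \<Longrightarrow> (\<And>v. v \<in> E x \<Longrightarrow> g x u v = \<rho> x v f) \<Longrightarrow> u = anchor_gradient f x"
  using metric_representation[of x "\<lambda>v. \<rho> x v f", OF anchor_linear] anchor_gradient by blast

lemma anchor_gradient_linear:
  assumes "\<And>v. v \<in> E x \<Longrightarrow> \<rho> x v h = a * \<rho> x v f + b * \<rho> x v f'"
  shows "anchor_gradient h x = a *\<^sub>R anchor_gradient f x + b *\<^sub>R anchor_gradient f' x"
proof (rule anchor_gradient_unique[symmetric])
  note mem = anchor_gradient_mem
  show "a *\<^sub>R anchor_gradient f x + b *\<^sub>R anchor_gradient f' x \<in> E x"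
    by (intro fibre_combination fibre_scale mem)
  fix v assume v: "v \<in> E x"
  have "g x (b *\<^sub>R anchor_gradient f' x) v = b * \<rho> x v f'"
    using metric_linear[OF mem fibre_zero v, of b f'] metric_linear[OF fibre_zero fibre_zero v, of 1]
    by (simp add: metric_anchor_gradient v)
  then show "g x (a *\<^sub>R anchor_gradient f x + b *\<^sub>R anchor_gradient f' x) v = \<rho> x v h"
    using metric_linear[OF mem fibre_scale[OF mem] v] by (simp add: metric_anchor_gradient v assms)
qed

lemma flat_homogeneous: "homogeneous 1 (flat x v)"
  by (simp add: homogeneous_def flat_def)

lemma contraction_flat:
  "w \<in> E x \<Longrightarrow> contraction w (flat x v) = (\<lambda>ws. if ws = [] then g x v w else 0)"
  by (auto simp: contraction_def flat_def)

lemma wedge_flat_Cons: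
  "w \<in> E x \<Longrightarrow> wedge (flat x v) b (w # ws) = g x v w * b ws - wedge (flat x v) (contraction w b) ws"
  using wedge_Cons[OF flat_homogeneous, of x v b w ws] by (simp add: contraction_flat wedge_scalar)

lemma flat_alternating:
  assumes "v \<in> E x"
  shows "flat x v \<in> alternating_forms (E x) 1"
proof (rule alternating_formsI)
  fix vs :: "'v list" and i c u w assume "u \<in> E x" "w \<in> E x" "length vs = 1" "i < (1::nat)"
  moreover from this obtain y where "vs = [y]" by (cases vs) auto
  ultimately show "flat x v (vs[i := c *\<^sub>R u + w]) = c * flat x v (vs[i := u]) + flat x v (vs[i := w])"
    using assms by (simp add: flat_def metric_linear_right fibre_combination)
qed (auto simp: flat_def)

text \<open>Contracting a decomposable form by \<open>\<nabla>f\<close> thus reproduces the formula that defines the extended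
  anchor, because \<open>\<langle>v, \<nabla>f\<rangle> = \<rho>(v) f\<close>. This is why the extended anchor is well defined.\<close>

lemma decomposable_contraction:
  assumes "u \<in> E x"
  shows "decomposable x vs (u # ws) = (\<Sum>i<length vs. (-1) ^ i * g x (vs ! i) u * decomposable x (omit {i} vs) ws)"
proof (induction vs arbitrary: ws)
  case Nil
  then show ?case by simp
next
  case (Cons v vs)
  have "contraction u (decomposable x vs) =
      (\<lambda>ws. \<Sum>i<length vs. ((-1) ^ i * g x (vs ! i) u) * decomposable x (omit {i} vs) ws)"
    using Cons by (simp add: contraction_def fun_eq_iff)
  then have "decomposable x (v # vs) (u # ws) = g x v u * decomposable x vs ws -
      (\<Sum>i<length vs. ((-1) ^ i * g x (vs ! i) u) * wedge (flat x v) (decomposable x (omit {i} vs)) ws)"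
    using assms by (simp add: wedge_flat_Cons wedge_sum_right)
  moreover have "decomposable x (omit {Suc i} (v # vs)) = wedge (flat x v) (decomposable x (omit {i} vs))" for i
    using omit_Suc_Cons[of "{i}" v vs] by simp
  moreover have "omit {0} (v # vs) = vs"
    using omit_0_Cons[of "{}" v vs] by (simp add: omit_def nths_all)
  ultimately show ?case
    by (simp add: sum.lessThan_Suc_shift sum_negf[symmetric] del: sum.lessThan_Suc decomposable.simps)
qed

lemma anchor_tilde_decomposable_contraction:
  assumes "set vs \<subseteq> E x"
  shows "anchor_tilde_decomposable x vs f ws = decomposable x vs (anchor_gradient f x # ws)"
  unfolding anchor_tilde_decomposable_def decomposable_contraction[OF anchor_gradient_mem]
proof (rule sum.cong)
  fix i assume "i \<in> {..<length vs}"
  then have "vs ! i \<in> E x" using assms by auto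
  then have "g x (vs ! i) (anchor_gradient f x) = \<rho> x (vs ! i) f"
    using metric_anchor_gradient metric_sym[OF anchor_gradient_mem] by metis
  then show "(-1) ^ i * (\<rho> x (vs ! i) f * decomposable x (omit {i} vs) ws) =
      (-1) ^ i * g x (vs ! i) (anchor_gradient f x) * decomposable x (omit {i} vs) ws"
    by simp
qed simp

definition combination_of_decomposables :: "'m \<Rightarrow> nat \<Rightarrow> ('v list \<Rightarrow> real) \<Rightarrow> bool" where
  "combination_of_decomposables x p a \<longleftrightarrow> (\<exists>cs. (\<forall>(c, vs)\<in>set cs. length vs = p \<and> set vs \<subseteq> E x) \<and>
     a = (\<lambda>ws. \<Sum>(c, vs)\<leftarrow>cs. c * decomposable x vs ws))"

lemma combination_of_decomposablesI:
  "\<forall>(c, vs)\<in>set cs. length vs = p \<and> set vs \<subseteq> E x \<Longrightarrow>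
    a = (\<lambda>ws. \<Sum>(c, vs)\<leftarrow>cs. c * decomposable x vs ws) \<Longrightarrow> combination_of_decomposables x p a"
  unfolding combination_of_decomposables_def by (intro exI conjI)

lemma combination_sum:
  assumes "\<And>i. i \<in> I \<Longrightarrow> combination_of_decomposables x p (b i)"
  shows "combination_of_decomposables x p (\<lambda>ws. \<Sum>i\<in>I. b i ws)"
proof -
  have zero: "combination_of_decomposables x p (\<lambda>ws. 0)"
    unfolding combination_of_decomposables_def by (intro exI[of _ "[]"]) simp
  show ?thesis using assms
  proof (induction I rule: infinite_finite_induct)
    case (insert i I)
    have "combination_of_decomposables x p (b i)" "combination_of_decomposables x p (\<lambda>ws. \<Sum>i\<in>I. b i ws)"
      using insert by simp_all
    then obtain cs cs' where cs:
      "\<forall>(c, vs)\<in>set cs. length vs = p \<and> set vs \<subseteq> E x" "\<forall>(c, vs)\<in>set cs'. length vs = p \<and> set vs \<subseteq> E x"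
      and b: "b i = (\<lambda>ws. \<Sum>(c, vs)\<leftarrow>cs. c * decomposable x vs ws)"
      "(\<lambda>ws. \<Sum>i\<in>I. b i ws) = (\<lambda>ws. \<Sum>(c, vs)\<leftarrow>cs'. c * decomposable x vs ws)"
      unfolding combination_of_decomposables_def by (elim exE conjE)
    have "(\<lambda>ws. \<Sum>i\<in>insert i I. b i ws) = (\<lambda>ws. \<Sum>(c, vs)\<leftarrow>cs @ cs'. c * decomposable x vs ws)"
      using insert.hyps b by (simp add: fun_eq_iff)
    moreover have "\<forall>(c, vs)\<in>set (cs @ cs'). length vs = p \<and> set vs \<subseteq> E x"
      using cs by auto
    ultimately show ?case by (intro combination_of_decomposablesI)
  qed (simp_all add: zero)
qed

lemma combination_wedge_flat:
  assumes "combination_of_decomposables x p b" "v \<in> E x"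
  shows "combination_of_decomposables x (Suc p) (\<lambda>ws. r * wedge (flat x v) b ws)"
proof -
  obtain cs where cs: "\<forall>(c, vs)\<in>set cs. length vs = p \<and> set vs \<subseteq> E x"
    and b: "b = (\<lambda>ws. \<Sum>(c, vs)\<leftarrow>cs. c * decomposable x vs ws)"
    using assms(1) unfolding combination_of_decomposables_def by auto
  have "r * wedge (flat x v) (\<lambda>ws. \<Sum>(c, vs)\<leftarrow>cs. c * decomposable x vs ws) ws =
      (\<Sum>(c, vs)\<leftarrow>map (\<lambda>(c, vs). (r * c, v # vs)) cs. c * decomposable x vs ws)" for ws
    by (induction cs) (auto simp: wedge_zero_right wedge_linear_right algebra_simps)
  moreover have "\<forall>(c, vs)\<in>set (map (\<lambda>(c, vs). (r * c, v # vs)) cs). length vs = Suc p \<and> set vs \<subseteq> E x"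
    using cs assms(2) by fastforce
  ultimately show ?thesis
    unfolding b by (intro combination_of_decomposablesI ext)
qed

text \<open>For a frame \<open>(e\<^sub>b)\<close> with dual frame \<open>(u\<^sub>b)\<close>, Euler's identity
  \<open>\<Sum>\<^sub>b u\<^sub>b \<and> \<iota>(e\<^sub>b) a = p a\<close> reduces a \<open>p\<close>-form to decomposable ones by induction on \<open>p\<close>.\<close>

lemma alternating_combination_of_decomposables:
  assumes "a \<in> alternating_forms (E x) p"
  shows "combination_of_decomposables x p a"
  using assms
proof (induction p arbitrary: a)
  case 0
  have "a ws = a [] * decomposable x [] ws" for ws
    using alternating_forms_zero[OF 0, of ws] by simp
  note at_Nil = this
  have "a = (\<lambda>ws. \<Sum>(c, vs)\<leftarrow>[(a [], [])]. c * decomposable x vs ws)"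
    by (rule ext, subst at_Nil) simp
  then show ?case by (rule combination_of_decomposablesI[rotated]) simp
next
  case (Suc p)
  obtain B :: "'f set" where B: "orthonormal_basis B" by (rule fibre_basis_exists)
  obtain U \<tau> where t: "(U, \<tau>) \<in> triv" "x \<in> U" using triv_cover[of x] by auto
  let ?e = "inv_into (E x) (\<tau> x)"
  note e = frame_mem[OF t]
  have "\<exists>u. u \<in> E x \<and> (\<forall>v\<in>E x. g x u v = \<tau> x v \<bullet> b)" for b
    by (rule ex1_implies_ex[OF metric_representation]) (simp add: triv_linear[OF t] inner_add_left)
  then obtain u where u: "\<And>b. u b \<in> E x" "\<And>b v. v \<in> E x \<Longrightarrow> g x (u b) v = \<tau> x v \<bullet> b"
    by metis
  have Euler: "(\<Sum>b\<in>B. wedge (flat x (u b)) (contraction (?e b) a) ws) = length ws * a ws"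
    if "a \<in> alternating_forms (E x) q" "set ws \<subseteq> E x" for a :: "'v list \<Rightarrow> real" and q ws
    using that
  proof (induction ws arbitrary: a q)
    case Nil
    then show ?case by (simp add: wedge_Nil flat_def)
  next
    case (Cons w ws)
    have w: "w \<in> E x" using Cons.prems by simp
    have swap: "contraction w (contraction (?e b) a) = (\<lambda>ws. (-1) * contraction (?e b) (contraction w a) ws + 0)" for b
      using subspace_forms.form_swap_Cons[OF fibre_forms Cons.prems(1), of "?e b" w]
      by (simp add: contraction_def fun_eq_iff)
    have "(\<Sum>b\<in>B. wedge (flat x (u b)) (contraction (?e b) a) (w # ws)) =
        (\<Sum>b\<in>B. (\<tau> x w \<bullet> b) * contraction (?e b) a ws) + (\<Sum>b\<in>B. wedge (flat x (u b)) (contraction (?e b) (contraction w a)) ws)"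
      unfolding wedge_flat_Cons[OF w] u(2)[OF w] swap wedge_linear_right
      by (simp add: wedge_zero_right sum.distrib)
    also have "(\<Sum>b\<in>B. (\<tau> x w \<bullet> b) * contraction (?e b) a ws) = a (w # ws)"
      using subspace_forms.form_sum_append[where xs = "[]" and B = B and e = ?e and c = "\<lambda>b. \<tau> x w \<bullet> b",
          OF fibre_forms Cons.prems(1) e] frame_expand[OF t B w, symmetric] by (simp add: contraction_def)
    also have "(\<Sum>b\<in>B. wedge (flat x (u b)) (contraction (?e b) (contraction w a)) ws) =
        length ws * contraction w a ws"
      using Cons.IH[OF subspace_forms.contraction_alternating[OF fibre_forms Cons.prems(1) w]] Cons.prems(2) by simp
    finally show ?case by (simp add: contraction_def algebra_simps)
  qed
  have "a ws = (\<Sum>b\<in>B. inverse (Suc p) * wedge (flat x (u b)) (contraction (?e b) a) ws)" for ws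
  proof (cases "length ws = Suc p \<and> set ws \<subseteq> E x")
    case True
    then show ?thesis using Euler[OF Suc.prems, of ws] by (simp add: sum_distrib_left[symmetric] del: of_nat_Suc)
  next
    case False
    have "wedge (flat x (u b)) (contraction (?e b) a) \<in> alternating_forms (E x) (Suc p)" for b
      using subspace_forms.wedge_alternating[OF fibre_forms flat_alternating[OF u(1)]
          subspace_forms.contraction_alternating[OF fibre_forms Suc.prems e]] by simp
    from alternating_forms_zero[OF this False] show ?thesis
      using alternating_forms_zero[OF Suc.prems False] by simp
  qed
  then have "a = (\<lambda>ws. \<Sum>b\<in>B. inverse (Suc p) * wedge (flat x (u b)) (contraction (?e b) a) ws)"
    by blast
  moreover have "combination_of_decomposables x (Suc p) \<dots>"
    using subspace_forms.contraction_alternating[OF fibre_forms Suc.prems e]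
    by (intro combination_sum combination_wedge_flat Suc.IH u(1)) simp
  ultimately show ?case by simp
qed

text \<open>By \<open>decomposable_contraction\<close> every representation of \<open>a\<close> by decomposable forms yields this value,
  and a representation exists. Hence the kernel consists of the forms that vanish as soon as one argument
  lies in the image of the dual of the anchor.\<close>

lemma anchor_tilde_contraction:
  assumes "a \<in> alternating_forms (E x) p"
  shows "anchor_tilde x p a = (\<lambda>f ws. a (anchor_gradient f x # ws))"
proof -
  have "(\<lambda>f ws. \<Sum>(c, vs)\<leftarrow>cs. c * anchor_tilde_decomposable x vs f ws) = (\<lambda>f ws. a (anchor_gradient f x # ws))"
    if "\<forall>(c, vs)\<in>set cs. length vs = p \<and> set vs \<subseteq> E x"
      and a: "a = (\<lambda>ws. \<Sum>(c, vs)\<leftarrow>cs. c * decomposable x vs ws)" for cs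
    unfolding a using that(1)
    by (intro ext arg_cong[where f = sum_list] map_cong)
      (auto simp: anchor_tilde_decomposable_contraction split_beta)
  note contracted = this
  obtain cs where cs: "\<forall>(c, vs)\<in>set cs. length vs = p \<and> set vs \<subseteq> E x"
    "a = (\<lambda>ws. \<Sum>(c, vs)\<leftarrow>cs. c * decomposable x vs ws)"
    using alternating_combination_of_decomposables[OF assms]
    unfolding combination_of_decomposables_def by (elim exE conjE)
  show ?thesis
    unfolding anchor_tilde_def
  proof (rule the_equality)
    show "\<exists>cs. (\<forall>(c, vs)\<in>set cs. length vs = p \<and> set vs \<subseteq> E x) \<and>
        a = (\<lambda>ws. \<Sum>(c, vs)\<leftarrow>cs. c * decomposable x vs ws) \<and>
        (\<lambda>f ws. a (anchor_gradient f x # ws)) = (\<lambda>f ws. \<Sum>(c, vs)\<leftarrow>cs. c * anchor_tilde_decomposable x vs f ws)"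
      by (intro exI conjI) (rule cs, rule cs, rule contracted[OF cs, symmetric])
    show "t = (\<lambda>f ws. a (anchor_gradient f x # ws))"
      if "\<exists>cs. (\<forall>(c, vs)\<in>set cs. length vs = p \<and> set vs \<subseteq> E x) \<and>
        a = (\<lambda>ws. \<Sum>(c, vs)\<leftarrow>cs. c * decomposable x vs ws) \<and>
        t = (\<lambda>f ws. \<Sum>(c, vs)\<leftarrow>cs. c * anchor_tilde_decomposable x vs f ws)" for t
      using that by (elim exE conjE) (rule trans[OF _ contracted])
  qed
qed

lemma Omega_ker_iff:
  "\<alpha> \<in> Omega_ker p \<longleftrightarrow> \<alpha> \<in> form_sections p \<and> (\<forall>x f ws. \<alpha> x (anchor_gradient f x # ws) = 0)"
  unfolding Omega_ker_def
  by (auto simp: anchor_tilde_contraction[OF form_section_alternating] fun_eq_iff)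

lemma Omega_ker_form_section: "\<alpha> \<in> Omega_ker p \<Longrightarrow> \<alpha> \<in> form_sections p"
  by (simp add: Omega_ker_iff)

lemma Omega_ker_gradient: "\<alpha> \<in> Omega_ker p \<Longrightarrow> \<alpha> x (anchor_gradient f x # ws) = 0"
  by (simp add: Omega_ker_iff)

lemma Omega_ker_alternating: "\<alpha> \<in> Omega_ker p \<Longrightarrow> \<alpha> x \<in> alternating_forms (E x) p"
  by (simp add: Omega_ker_form_section form_section_alternating)

lemma contract_Omega_ker:
  assumes "\<alpha> \<in> Omega_ker p" "\<phi> \<in> sections"
  shows "contract \<phi> \<alpha> \<in> Omega_ker (p - 1)"
proof -
  have "contract \<phi> \<alpha> x (anchor_gradient f x # ws) = 0" for x f ws
    using subspace_forms.form_swap_Cons[OF fibre_forms Omega_ker_alternating[OF assms(1)], of x "\<phi> x"]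
      Omega_ker_gradient[OF assms(1)] by (simp add: contract_def contraction_def)
  then show ?thesis
    using assms contract_form_section by (simp add: Omega_ker_iff)
qed

lemma wedge_Omega_ker:
  assumes "\<alpha> \<in> Omega_ker p" "\<beta> \<in> Omega_ker q"
  shows "(\<lambda>x. wedge (\<alpha> x) (\<beta> x)) \<in> Omega_ker (p + q)"
proof -
  have "contraction (anchor_gradient f x) (\<gamma> x) = (\<lambda>ws. 0)" if "\<gamma> \<in> Omega_ker r" for \<gamma> r x f
    by (rule ext) (simp add: contraction_def Omega_ker_gradient[OF that])
  then have "wedge (\<alpha> x) (\<beta> x) (anchor_gradient f x # ws) = 0" for x f ws
    using assms wedge_Cons[OF alternating_forms_homogeneous[OF Omega_ker_alternating[OF assms(1)]]]
    by (simp add: wedge_zero_left wedge_zero_right)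
  then show ?thesis
    using assms wedge_form_section by (simp add: Omega_ker_iff)
qed

end

section \<open>Cartan's formula\<close>

context metric_anchored_bundle
begin

lemma eval_form_contract: "eval_form (contract \<phi> \<alpha>) \<psi>s = eval_form \<alpha> (\<phi> # \<psi>s)"
  by (simp add: eval_form_def contract_def contraction_def fun_eq_iff)

lemma eval_form_combination:
  "eval_form (\<lambda>x ws. c * \<alpha> x ws + \<beta> x ws) \<psi>s = (\<lambda>x. c * eval_form \<alpha> \<psi>s x + eval_form \<beta> \<psi>s x)"
  by (simp add: eval_form_def fun_eq_iff)

lemma eval_form_update_linear:
  assumes "\<alpha> \<in> form_sections p" "k < length \<psi>s" "\<phi> x \<in> E x" "\<eta> x \<in> E x" "\<sigma> x = c *\<^sub>R \<phi> x + \<eta> x"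
  shows "eval_form \<alpha> (\<psi>s[k := \<sigma>]) x = c * eval_form \<alpha> (\<psi>s[k := \<phi>]) x + eval_form \<alpha> (\<psi>s[k := \<eta>]) x"
  using subspace_forms.form_linear[OF fibre_forms form_section_alternating[OF assms(1)] assms(3,4)] assms(2,5)
  by (simp add: eval_form_def map_update)

lemma Omega_ker_gradient_at:
  assumes "\<alpha> \<in> Omega_ker p" "j < length vs"
  shows "\<alpha> x (vs[j := anchor_gradient f x]) = 0"
  using subspace_forms.form_move_to_front[OF fibre_forms Omega_ker_alternating[OF assms(1)] assms(2)]
    Omega_ker_gradient[OF assms(1)] by (metis mult_eq_0_iff power_eq_0_iff zero_neq_neg_one)

end

context strongly_anchored_almost_courant_algebroid
begin

lemma anchor_section_tangent: "\<phi> \<in> sections \<Longrightarrow> \<rho> x (\<phi> x) \<in> tangent_space x"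
  by (simp add: anchor_tangent section_mem)

lemma D_rhs_Nil: "D_rhs \<alpha> [] x = 0"
  by (simp add: D_rhs_def)

text \<open>The terms without \<open>\<phi>\<close> as outer derivative or as entry of the bracket have \<open>\<phi>\<close> as an argument of
  \<open>\<alpha>\<close>; they make up the last term, with the opposite sign since the positions are shifted by one or
  since \<open>\<phi>\<close> has to be moved past a bracket. The first two terms are the Lie derivative of \<open>\<alpha>\<close>.\<close>

lemma D_rhs_Cons:
  assumes "\<alpha> \<in> form_sections p"
  shows "D_rhs \<alpha> (\<phi> # \<psi>s) x = \<rho> x (\<phi> x) (eval_form \<alpha> \<psi>s)
    - slotwise (br \<phi>) (\<lambda>\<eta>s. eval_form \<alpha> \<eta>s x) \<psi>s - D_rhs (contract \<phi> \<alpha>) \<psi>s x"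
proof -
  let ?n = "length \<psi>s"
  let ?P = "{(i, j). i < j \<and> j < ?n}"
  let ?t = "\<lambda>(i, j). (-1) ^ (i + j) * eval_form \<alpha> (br ((\<phi> # \<psi>s) ! i) ((\<phi> # \<psi>s) ! j) # omit {i, j} (\<phi> # \<psi>s)) x"
  have alt: "\<alpha> x \<in> alternating_forms (E x) p" using assms by (rule form_section_alternating)
  have single: "omit {0} (\<phi> # \<psi>s) = \<psi>s" "omit {Suc i} (\<phi> # \<psi>s) = \<phi> # omit {i} \<psi>s" for i
    using omit_0_Cons[of "{}" \<phi> \<psi>s] omit_Suc_Cons[of "{i}" \<phi> \<psi>s] by (simp_all add: omit_def nths_all)
  have double: "omit {0, Suc j} (\<phi> # \<psi>s) = omit {j} \<psi>s" "omit {Suc i, Suc j} (\<phi> # \<psi>s) = \<phi> # omit {i, j} \<psi>s" for i j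
    using omit_0_Cons[of "{j}" \<phi> \<psi>s] omit_Suc_Cons[of "{i, j}" \<phi> \<psi>s] by simp_all
  have pairs: "{(i, j). i < j \<and> j < Suc ?n} = (\<lambda>j. (0, Suc j)) ` {..<?n} \<union> map_prod Suc Suc ` ?P"
    (is "?L = ?R")
  proof (intro equalityI subsetI)
    fix z assume "z \<in> ?L"
    then obtain i j where "z = (i, j)" "i < j" "j < Suc ?n" by auto
    then show "z \<in> ?R" by (cases i; cases j) (auto simp: image_iff intro!: bexI[of _ "(i - 1, j - 1)"])
  qed auto
  have "finite ?P" by (rule finite_subset[of _ "{..<?n} \<times> {..<?n}"]) auto
  then have "(\<Sum>z\<in>{(i, j). i < j \<and> j < Suc ?n}. ?t z) =
      (\<Sum>j<?n. ?t (0, Suc j)) + (\<Sum>z\<in>?P. ?t (map_prod Suc Suc z))"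
    unfolding pairs
    by (subst sum.union_disjoint) (auto simp: sum.reindex inj_on_def map_prod_def split_beta prod_eq_iff)
  also have "(\<Sum>j<?n. ?t (0, Suc j)) = - slotwise (br \<phi>) (\<lambda>\<eta>s. eval_form \<alpha> \<eta>s x) \<psi>s"
    unfolding slotwise_def sum_negf[symmetric]
  proof (rule sum.cong)
    fix j assume "j \<in> {..<?n}"
    then show "?t (0, Suc j) = - eval_form \<alpha> (\<psi>s[j := br \<phi> (\<psi>s ! j)]) x"
      using subspace_forms.form_move_to_front[OF fibre_forms alt, of j "map (\<lambda>\<psi>. \<psi> x) \<psi>s" "br \<phi> (\<psi>s ! j) x"]
      by (simp add: double eval_form_def omit_map map_update flip: power_add)
  qed simp
  also have "(\<Sum>z\<in>?P. ?t (map_prod Suc Suc z)) = - (\<Sum>(i, j)\<in>?P.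
      (-1) ^ (i + j) * eval_form (contract \<phi> \<alpha>) (br (\<psi>s ! i) (\<psi>s ! j) # omit {i, j} \<psi>s) x)"
    unfolding sum_negf[symmetric]
  proof (rule sum.cong)
    fix z assume "z \<in> ?P"
    obtain i j where z: "z = (i, j)" by (cases z)
    show "?t (map_prod Suc Suc z) = - (case z of (i, j) \<Rightarrow>
        (-1) ^ (i + j) * eval_form (contract \<phi> \<alpha>) (br (\<psi>s ! i) (\<psi>s ! j) # omit {i, j} \<psi>s) x)"
      using subspace_forms.form_swap_Cons[OF fibre_forms alt, of "br (\<psi>s ! i) (\<psi>s ! j) x" "\<phi> x"]
      by (simp add: z double eval_form_contract) (simp add: eval_form_def)
  qed simp
  finally show ?thesis
    unfolding D_rhs_def length_Cons sum.lessThan_Suc_shift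
    by (simp add: single eval_form_contract sum_negf)
qed

lemma D_rhs_combination:
  assumes "\<alpha> \<in> form_sections p" "\<beta> \<in> form_sections q" "set \<psi>s \<subseteq> sections"
  shows "D_rhs (\<lambda>x ws. c * \<alpha> x ws + \<beta> x ws) \<psi>s x = c * D_rhs \<alpha> \<psi>s x + D_rhs \<beta> \<psi>s x"
proof -
  have "\<rho> x ((\<psi>s ! i) x) (\<lambda>x. c * eval_form \<alpha> (omit {i} \<psi>s) x + eval_form \<beta> (omit {i} \<psi>s) x) =
      c * \<rho> x ((\<psi>s ! i) x) (eval_form \<alpha> (omit {i} \<psi>s)) + \<rho> x ((\<psi>s ! i) x) (eval_form \<beta> (omit {i} \<psi>s))"
    if "i < length \<psi>s" for i
  proof -
    have "\<psi>s ! i \<in> sections" using assms(3) that by auto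
    then have tangent: "\<rho> x ((\<psi>s ! i) x) \<in> tangent_space x" by (rule anchor_section_tangent)
    have omit: "set (omit {i} \<psi>s) \<subseteq> sections" using set_omit_subset assms(3) by (rule order.trans)
    show ?thesis
      by (rule tangent_linear[OF tangent eval_form_smooth[OF assms(1) omit] eval_form_smooth[OF assms(2) omit]])
  qed
  then have "(\<Sum>i<length \<psi>s. (-1) ^ i * \<rho> x ((\<psi>s ! i) x)
        (\<lambda>x. c * eval_form \<alpha> (omit {i} \<psi>s) x + eval_form \<beta> (omit {i} \<psi>s) x)) =
      (\<Sum>i<length \<psi>s. c * ((-1) ^ i * \<rho> x ((\<psi>s ! i) x) (eval_form \<alpha> (omit {i} \<psi>s))) +
        (-1) ^ i * \<rho> x ((\<psi>s ! i) x) (eval_form \<beta> (omit {i} \<psi>s)))"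
    by (intro sum.cong) (simp_all add: distrib_left)
  moreover have "(\<Sum>(i, j)\<in>P. (-1) ^ (i + j) * (c * a i j + b i j)) =
      c * (\<Sum>(i, j)\<in>P. (-1) ^ (i + j) * a i j) + (\<Sum>(i, j)\<in>P. (-1) ^ (i + j) * b i j)"
    for P :: "(nat \<times> nat) set" and a b :: "nat \<Rightarrow> nat \<Rightarrow> real"
    unfolding sum_distrib_left sum.distrib[symmetric]
    by (intro sum.cong) (auto simp: distrib_left)
  ultimately show ?thesis
    unfolding D_rhs_def eval_form_combination by (simp add: sum.distrib sum_distrib_left[symmetric] distrib_left)
qed

lemma D_rhs_zero:
  assumes "set \<psi>s \<subseteq> sections"
  shows "D_rhs (\<lambda>x ws. 0) \<psi>s x = 0"
proof -
  have "\<rho> x ((\<psi>s ! i) x) (\<lambda>x. 0) = 0" if "i < length \<psi>s" for i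
  proof -
    have "\<psi>s ! i \<in> sections" using assms that by auto
    then have tangent: "\<rho> x ((\<psi>s ! i) x) \<in> tangent_space x" by (rule anchor_section_tangent)
    show ?thesis using tangent_const[OF tangent] .
  qed
  then show ?thesis by (simp add: D_rhs_def eval_form_def[abs_def])
qed

lemma D_rhs_smooth:
  assumes "\<alpha> \<in> form_sections p" "set \<psi>s \<subseteq> sections"
  shows "D_rhs \<alpha> \<psi>s \<in> smooth_functions"
proof -
  have nth: "\<psi>s ! i \<in> sections" if "i < length \<psi>s" for i using assms(2) that by auto
  have omit: "set (omit I \<psi>s) \<subseteq> sections" for I using set_omit_subset assms(2) by (rule order.trans)
  have "(\<lambda>x. (\<Sum>i<length \<psi>s. (-1) ^ i * \<rho> x ((\<psi>s ! i) x) (eval_form \<alpha> (omit {i} \<psi>s))) +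
     (\<Sum>z\<in>{(i, j). i < j \<and> j < length \<psi>s}. (-1) ^ (fst z + snd z) *
        eval_form \<alpha> (br (\<psi>s ! fst z) (\<psi>s ! snd z) # omit {fst z, snd z} \<psi>s) x)) \<in> smooth_functions"
    by (intro smooth_functions_add smooth_functions_sum smooth_functions_mult smooth_functions_const
        anchor_function_smooth eval_form_smooth[OF assms(1)])
      (auto simp: nth omit[THEN subsetD] intro!: bracket_section)
  then show ?thesis by (simp add: D_rhs_def[abs_def] split_beta)
qed

section \<open>Symmetry and linearity of the differential\<close>

text \<open>In Cartan's formula everything cancels but \<open>\<alpha>([\<phi>, \<phi>], \<dots>)\<close>, which is zero because \<open>[\<phi>, \<phi>]\<close> is
  half of a gradient.\<close>

lemma D_rhs_repeat_head:
  assumes "\<alpha> \<in> Omega_ker p" "\<phi> \<in> sections" "set \<psi>s \<subseteq> sections"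
  shows "D_rhs \<alpha> (\<phi> # \<phi> # \<psi>s) x = 0"
proof -
  note form = Omega_ker_form_section[OF assms(1)]
  let ?h = "\<lambda>y. g y (\<phi> y) (\<phi> y)"
  have twice: "contract \<phi> (contract \<phi> \<alpha>) = (\<lambda>x ws. 0)"
    using contraction_twice[OF form_section_alternating[OF form]] by (simp add: contract_def fun_eq_iff)
  have con: "contraction \<phi> (\<lambda>\<eta>s. eval_form \<alpha> \<eta>s x) = (\<lambda>\<eta>s. eval_form (contract \<phi> \<alpha>) \<eta>s x)"
    by (simp add: contraction_def[abs_def] eval_form_contract)
  have "br \<phi> \<phi> x = (1/2) *\<^sub>R anchor_gradient ?h x"
    using bracket_self[OF assms(2)] by (simp add: anchor_gradient_def)
  then have "eval_form \<alpha> (br \<phi> \<phi> # \<psi>s) x = 0"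
    using subspace_forms.form_scale_append[OF fibre_forms form_section_alternating[OF form] anchor_gradient_mem,
        where xs = "[]"] Omega_ker_gradient[OF assms(1)]
    by (simp add: eval_form_def)
  then show ?thesis
    by (simp add: D_rhs_Cons[OF form] D_rhs_Cons[OF contract_form_section[OF form assms(2)]] slotwise_Cons
        con eval_form_contract[symmetric] twice D_rhs_zero[OF assms(3)])
qed

lemma D_rhs_add_head:
  assumes "\<alpha> \<in> form_sections p" "\<phi> \<in> sections" "\<eta> \<in> sections" "set \<psi>s \<subseteq> sections"
  shows "D_rhs \<alpha> ((\<lambda>x. \<phi> x + \<eta> x) # \<psi>s) x = D_rhs \<alpha> (\<phi> # \<psi>s) x + D_rhs \<alpha> (\<eta> # \<psi>s) x"
proof -
  let ?\<sigma> = "\<lambda>x. \<phi> x + \<eta> x"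
  note mem = section_mem[OF assms(2)] section_mem[OF assms(3)]
  have anchor: "\<rho> x (\<phi> x + \<eta> x) f = \<rho> x (\<phi> x) f + \<rho> x (\<eta> x) f" for f
    using anchor_linear[OF mem, of x 1 f] by simp
  have "eval_form \<alpha> (\<psi>s[j := br ?\<sigma> (\<psi>s ! j)]) x =
      eval_form \<alpha> (\<psi>s[j := br \<phi> (\<psi>s ! j)]) x + eval_form \<alpha> (\<psi>s[j := br \<eta> (\<psi>s ! j)]) x"
    if "j < length \<psi>s" for j
  proof -
    have \<psi>: "\<psi>s ! j \<in> sections" using assms(4) that by auto
    have "br ?\<sigma> (\<psi>s ! j) x = 1 *\<^sub>R br \<phi> (\<psi>s ! j) x + br \<eta> (\<psi>s ! j) x"
      using bracket_linear_left[OF assms(2,3) \<psi>, of 1] by (simp add: fun_eq_iff)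
    then have "eval_form \<alpha> (\<psi>s[j := br ?\<sigma> (\<psi>s ! j)]) x =
        1 * eval_form \<alpha> (\<psi>s[j := br \<phi> (\<psi>s ! j)]) x + eval_form \<alpha> (\<psi>s[j := br \<eta> (\<psi>s ! j)]) x"
      by (intro eval_form_update_linear[OF assms(1) that] section_mem bracket_section \<psi> assms(2,3))
    then show ?thesis by simp
  qed
  then have slot: "slotwise (br ?\<sigma>) (\<lambda>\<eta>s. eval_form \<alpha> \<eta>s x) \<psi>s =
      slotwise (br \<phi>) (\<lambda>\<eta>s. eval_form \<alpha> \<eta>s x) \<psi>s + slotwise (br \<eta>) (\<lambda>\<eta>s. eval_form \<alpha> \<eta>s x) \<psi>s"
    by (simp add: slotwise_def sum.distrib)
  have "contract ?\<sigma> \<alpha> = (\<lambda>x ws. 1 * contract \<phi> \<alpha> x ws + contract \<eta> \<alpha> x ws)"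
    using subspace_forms.form_linear_Cons[OF fibre_forms form_section_alternating[OF assms(1)] mem, of _ 1]
    by (simp add: contract_def contraction_def fun_eq_iff)
  then have "D_rhs (contract ?\<sigma> \<alpha>) \<psi>s x = D_rhs (contract \<phi> \<alpha>) \<psi>s x + D_rhs (contract \<eta> \<alpha>) \<psi>s x"
    using D_rhs_combination[OF contract_form_section[OF assms(1,2)] contract_form_section[OF assms(1,3)] assms(4), of 1]
    by simp
  then show ?thesis
    by (simp add: D_rhs_Cons[OF assms(1)] anchor slot)
qed

text \<open>The Leibniz rule makes the derivative of \<open>f\<close> appear twice, with opposite signs: once from
  \<open>\<rho>(\<zeta>)\<close> and once from the bracket with the argument multiplied by \<open>f\<close>. The two cancel in Cartan's
  formula; the second one is the last summand below.\<close>

lemma slotwise_bracket_linear: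
  assumes "\<alpha> \<in> form_sections p" "\<zeta> \<in> sections" "\<phi> \<in> sections" "\<eta> \<in> sections" "f \<in> smooth_functions"
    and k: "k < length \<psi>s"
  shows "slotwise (br \<zeta>) (\<lambda>\<eta>s. eval_form \<alpha> \<eta>s x) (\<psi>s[k := (\<lambda>x. f x *\<^sub>R \<phi> x + \<eta> x)]) =
    f x * slotwise (br \<zeta>) (\<lambda>\<eta>s. eval_form \<alpha> \<eta>s x) (\<psi>s[k := \<phi>])
    + slotwise (br \<zeta>) (\<lambda>\<eta>s. eval_form \<alpha> \<eta>s x) (\<psi>s[k := \<eta>]) + \<rho> x (\<zeta> x) f * eval_form \<alpha> (\<psi>s[k := \<phi>]) x"
proof -
  let ?\<sigma> = "\<lambda>x. f x *\<^sub>R \<phi> x + \<eta> x"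
  let ?A = "\<lambda>\<eta>s. eval_form \<alpha> \<eta>s x"
  let ?term = "\<lambda>\<sigma> j. ?A ((\<psi>s[k := \<sigma>])[j := br \<zeta> ((\<psi>s[k := \<sigma>]) ! j)])"
  have f\<phi>: "(\<lambda>x. f x *\<^sub>R \<phi> x) \<in> sections" using assms by (simp add: sections_scale)
  have mem: "\<phi> x \<in> E x" "\<eta> x \<in> E x" "br \<zeta> \<phi> x \<in> E x" "br \<zeta> \<eta> x \<in> E x"
    using assms by (simp_all add: section_mem bracket_section)
  have br: "br \<zeta> ?\<sigma> = (\<lambda>x. \<rho> x (\<zeta> x) f *\<^sub>R \<phi> x + (f x *\<^sub>R br \<zeta> \<phi> x + br \<zeta> \<eta> x))"
    using bracket_linear_right[OF assms(2) f\<phi> assms(4), of 1] bracket_Leibniz[OF assms(2,3,5)]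
    by (simp add: fun_eq_iff)
  have "?term ?\<sigma> j = f x * ?term \<phi> j + ?term \<eta> j + (if j = k then \<rho> x (\<zeta> x) f * ?A (\<psi>s[k := \<phi>]) else 0)"
    if "j < length \<psi>s" for j
  proof (cases "j = k")
    case True
    have "?A (\<psi>s[k := br \<zeta> ?\<sigma>]) = \<rho> x (\<zeta> x) f * ?A (\<psi>s[k := \<phi>]) +
        ?A (\<psi>s[k := (\<lambda>x. f x *\<^sub>R br \<zeta> \<phi> x + br \<zeta> \<eta> x)])"
      by (rule eval_form_update_linear[OF assms(1) k]) (simp_all add: br mem fibre_combination)
    also have "?A (\<psi>s[k := (\<lambda>x. f x *\<^sub>R br \<zeta> \<phi> x + br \<zeta> \<eta> x)]) =
        f x * ?A (\<psi>s[k := br \<zeta> \<phi>]) + ?A (\<psi>s[k := br \<zeta> \<eta>])"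
      by (rule eval_form_update_linear[OF assms(1) k]) (simp_all add: mem)
    finally show ?thesis using True k by simp
  next
    case False
    have "?A ((\<psi>s[j := br \<zeta> (\<psi>s ! j)])[k := ?\<sigma>]) =
        f x * ?A ((\<psi>s[j := br \<zeta> (\<psi>s ! j)])[k := \<phi>]) + ?A ((\<psi>s[j := br \<zeta> (\<psi>s ! j)])[k := \<eta>])"
      by (rule eval_form_update_linear[OF assms(1)]) (simp_all add: k mem)
    then show ?thesis using False by (simp add: list_update_swap)
  qed
  then have "(\<Sum>j<length \<psi>s. ?term ?\<sigma> j) = (\<Sum>j<length \<psi>s. f x * ?term \<phi> j + ?term \<eta> j
      + (if j = k then \<rho> x (\<zeta> x) f * ?A (\<psi>s[k := \<phi>]) else 0))"
    by (intro sum.cong) auto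
  also have "\<dots> = f x * (\<Sum>j<length \<psi>s. ?term \<phi> j) + (\<Sum>j<length \<psi>s. ?term \<eta> j) + \<rho> x (\<zeta> x) f * ?A (\<psi>s[k := \<phi>])"
    using k by (simp add: sum.distrib sum_distrib_left)
  finally show ?thesis by (simp add: slotwise_def)
qed

text \<open>Linearity in the head is reduced to linearity in the tail, by exchanging the first two
  arguments. This avoids the derivatives of \<open>f\<close> that \<open>[f \<phi>, \<psi>]\<close> produces.\<close>

lemma D_rhs_linear:
  assumes "\<alpha> \<in> Omega_ker p" "set \<psi>s \<subseteq> sections" "k < length \<psi>s" "\<phi> \<in> sections" "\<eta> \<in> sections"
    "f \<in> smooth_functions"
  shows "D_rhs \<alpha> (\<psi>s[k := (\<lambda>x. f x *\<^sub>R \<phi> x + \<eta> x)]) x =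
    f x * D_rhs \<alpha> (\<psi>s[k := \<phi>]) x + D_rhs \<alpha> (\<psi>s[k := \<eta>]) x"
  using assms
proof (induction \<psi>s arbitrary: \<alpha> p k \<phi> \<eta> f)
  case Nil
  then show ?case by simp
next
  case (Cons \<zeta> \<psi>s)
  note form = Omega_ker_form_section[OF Cons.prems(1)]
  have \<psi>s: "set \<psi>s \<subseteq> sections" using Cons.prems(2) by simp
  have tail: "D_rhs \<alpha> (\<xi> # \<psi>s[k := (\<lambda>x. f x *\<^sub>R \<phi> x + \<eta> x)]) x =
      f x * D_rhs \<alpha> (\<xi> # \<psi>s[k := \<phi>]) x + D_rhs \<alpha> (\<xi> # \<psi>s[k := \<eta>]) x"
    if \<xi>: "\<xi> \<in> sections" and k: "k < length \<psi>s"
      and s: "\<phi> \<in> sections" "\<eta> \<in> sections" "f \<in> smooth_functions" for \<xi> k \<phi> \<eta> f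
  proof -
    let ?e = "\<lambda>\<sigma>. eval_form \<alpha> (\<psi>s[k := \<sigma>])"
    have smooth: "?e \<sigma> \<in> smooth_functions" if "\<sigma> \<in> sections" for \<sigma>
      using eval_form_smooth[OF form] \<psi>s that by (meson insert_subset set_update_subset_insert subset_trans)
    have "?e (\<lambda>x. f x *\<^sub>R \<phi> x + \<eta> x) = (\<lambda>y. f y * ?e \<phi> y + ?e \<eta> y)"
      using eval_form_update_linear[OF form k] section_mem s by (simp add: fun_eq_iff)
    then have "\<rho> x (\<xi> x) (?e (\<lambda>x. f x *\<^sub>R \<phi> x + \<eta> x)) =
        f x * \<rho> x (\<xi> x) (?e \<phi>) + ?e \<phi> x * \<rho> x (\<xi> x) f + \<rho> x (\<xi> x) (?e \<eta>)"
      using tangent_add[OF anchor_section_tangent[OF \<xi>] smooth_functions_mult[OF s(3) smooth[OF s(1)]] smooth[OF s(2)]]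
        tangent_mult[OF anchor_section_tangent[OF \<xi>] s(3) smooth[OF s(1)]] by simp
    note anchor = this
    have contract: "D_rhs (contract \<xi> \<alpha>) (\<psi>s[k := (\<lambda>x. f x *\<^sub>R \<phi> x + \<eta> x)]) x =
        f x * D_rhs (contract \<xi> \<alpha>) (\<psi>s[k := \<phi>]) x + D_rhs (contract \<xi> \<alpha>) (\<psi>s[k := \<eta>]) x"
      by (rule Cons.IH[OF contract_Omega_ker[OF Cons.prems(1) \<xi>] \<psi>s k s])
    show ?thesis
      unfolding D_rhs_Cons[OF form] slotwise_bracket_linear[OF form \<xi> s k] anchor contract
      by (simp add: algebra_simps)
  qed
  show ?case
  proof (cases k)
    case (Suc j)
    then show ?thesis using tail[of \<zeta> j \<phi> \<eta> f] Cons.prems by simp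
  next
    case 0
    show ?thesis
    proof (cases \<psi>s)
      case Nil
      then show ?thesis
        using 0 Cons.prems anchor_linear[OF section_mem section_mem, of \<phi> \<eta>]
        by (simp add: D_rhs_Cons[OF form] D_rhs_Nil slotwise_def)
    next
      case (Cons \<xi> \<omega>s)
      have \<omega>s: "\<xi> \<in> sections" "set \<omega>s \<subseteq> sections" using \<psi>s Cons by auto
      have add2: "D_rhs \<alpha> (\<sigma> # (\<lambda>x. \<sigma>1 x + \<sigma>2 x) # \<omega>s) x = D_rhs \<alpha> (\<sigma> # \<sigma>1 # \<omega>s) x + D_rhs \<alpha> (\<sigma> # \<sigma>2 # \<omega>s) x"
        if "\<sigma> \<in> sections" "\<sigma>1 \<in> sections" "\<sigma>2 \<in> sections" for \<sigma> \<sigma>1 \<sigma>2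
        using tail[OF that(1) _ that(2,3) smooth_functions_const, of 0 1] Cons by simp
      have swap: "D_rhs \<alpha> (\<sigma> # \<xi> # \<omega>s) x = - D_rhs \<alpha> (\<xi> # \<sigma> # \<omega>s) x" if \<sigma>: "\<sigma> \<in> sections" for \<sigma>
      proof -
        let ?s = "\<lambda>x. \<sigma> x + \<xi> x"
        have s: "?s \<in> sections" using \<sigma> \<omega>s(1) by (rule sections_add)
        have "D_rhs \<alpha> (?s # ?s # \<omega>s) x = D_rhs \<alpha> (\<sigma> # ?s # \<omega>s) x + D_rhs \<alpha> (\<xi> # ?s # \<omega>s) x"
          using D_rhs_add_head[OF form \<sigma> \<omega>s(1), of "?s # \<omega>s"] s \<omega>s(2) by simp
        then show ?thesis
          using add2[OF \<sigma> \<sigma> \<omega>s(1)] add2[OF \<omega>s(1) \<sigma> \<omega>s(1)] D_rhs_repeat_head[OF Cons.prems(1) _ \<omega>s(2)]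
            s \<sigma> \<omega>s(1) by simp
      qed
      have "D_rhs \<alpha> ((\<lambda>x. f x *\<^sub>R \<phi> x + \<eta> x) # \<xi> # \<omega>s) x = - D_rhs \<alpha> (\<xi> # (\<lambda>x. f x *\<^sub>R \<phi> x + \<eta> x) # \<omega>s) x"
        using Cons.prems by (intro swap sections_combination)
      also have "\<dots> = f x * D_rhs \<alpha> (\<phi> # \<xi> # \<omega>s) x + D_rhs \<alpha> (\<eta> # \<xi> # \<omega>s) x"
        using tail[OF \<omega>s(1), of 0 \<phi> \<eta> f] Cons.prems Cons by (simp add: swap)
      finally show ?thesis using 0 Cons by simp
    qed
  qed
qed

lemma D_rhs_swap:
  assumes "\<alpha> \<in> Omega_ker p" "\<phi> \<in> sections" "\<eta> \<in> sections" "set \<psi>s \<subseteq> sections"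
  shows "D_rhs \<alpha> (\<phi> # \<eta> # \<psi>s) x = - D_rhs \<alpha> (\<eta> # \<phi> # \<psi>s) x"
proof -
  let ?s = "\<lambda>x. \<phi> x + \<eta> x"
  have s: "?s \<in> sections" using assms(2,3) by (rule sections_add)
  have head: "D_rhs \<alpha> (?s # \<xi> # \<psi>s) x = D_rhs \<alpha> (\<phi> # \<xi> # \<psi>s) x + D_rhs \<alpha> (\<eta> # \<xi> # \<psi>s) x"
    if "\<xi> \<in> sections" for \<xi>
    using D_rhs_add_head[OF Omega_ker_form_section[OF assms(1)] assms(2,3), of "\<xi> # \<psi>s"] that assms(4) by simp
  have second: "D_rhs \<alpha> (\<xi> # ?s # \<psi>s) x = D_rhs \<alpha> (\<xi> # \<phi> # \<psi>s) x + D_rhs \<alpha> (\<xi> # \<eta> # \<psi>s) x"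
    if "\<xi> \<in> sections" for \<xi>
    using D_rhs_linear[OF assms(1) _ _ assms(2,3) smooth_functions_const, of "\<xi> # \<phi> # \<psi>s" 1 1] that assms(2,4)
    by simp
  note repeat = D_rhs_repeat_head[OF assms(1) _ assms(4), where x = x]
  show ?thesis
    using head[OF s] second[OF assms(2)] second[OF assms(3)] repeat[OF s] repeat[OF assms(2)] repeat[OF assms(3)]
    by simp
qed

text \<open>If two arguments agree, only the slots of these two contribute, and their contributions differ
  by a transposition.\<close>

lemma slotwise_bracket_repeated:
  assumes "\<alpha> \<in> form_sections p" "\<zeta> \<in> sections" "set \<psi>s \<subseteq> sections"
    and ij: "i < j" "j < length \<psi>s" "\<psi>s ! i = \<psi>s ! j"
  shows "slotwise (br \<zeta>) (\<lambda>\<eta>s. eval_form \<alpha> \<eta>s x) \<psi>s = 0"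
proof -
  note alt = form_section_alternating[OF assms(1), of x]
  let ?vs = "map (\<lambda>\<psi>. \<psi> x) \<psi>s"
  let ?t = "\<lambda>k. eval_form \<alpha> (\<psi>s[k := br \<zeta> (\<psi>s ! k)]) x"
  have t: "?t k = \<alpha> x (?vs[k := br \<zeta> (\<psi>s ! k) x])" for k
    by (simp add: eval_form_def map_update)
  have "\<psi>s ! j \<in> sections" using assms(3) ij(2) by auto
  then have "\<alpha> x (?vs[i := br \<zeta> (\<psi>s ! j) x, j := (\<psi>s ! j) x]) = - \<alpha> x (?vs[i := (\<psi>s ! j) x, j := br \<zeta> (\<psi>s ! j) x])"
    using ij assms(2) section_mem bracket_section
    by (intro subspace_forms.form_exchange[OF fibre_forms alt]) auto
  moreover have "?vs[i := br \<zeta> (\<psi>s ! j) x, j := (\<psi>s ! j) x] = ?vs[i := br \<zeta> (\<psi>s ! j) x]"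
    using ij by (auto intro!: list_update_same_conv[THEN iffD2] simp: nth_list_update)
  moreover have "?vs[i := (\<psi>s ! j) x] = ?vs"
    using ij by (auto intro!: list_update_same_conv[THEN iffD2])
  moreover have "?t i = \<alpha> x (?vs[i := br \<zeta> (\<psi>s ! j) x])" using t[of i] ij(3) by simp
  ultimately have pair: "?t i + ?t j = 0" using t[of j] by simp
  have other: "?t k = 0" if "k \<notin> {i, j}" for k
    unfolding t using that ij by (intro alternating_forms_repeat[OF alt, of i j]) auto
  have "(\<Sum>k<length \<psi>s. ?t k) = (\<Sum>k\<in>{i, j}. ?t k)"
    using ij other by (intro sum.mono_neutral_right) auto
  then show ?thesis using pair ij(1) by (simp add: slotwise_def)
qed

text \<open>A repetition in the tail is inherited by all terms of Cartan's formula. A repetition that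
  involves the head is brought into the tail by exchanging the first two arguments, unless it occupies
  exactly these two.\<close>

lemma D_rhs_repeated:
  assumes "\<alpha> \<in> Omega_ker p" "set \<psi>s \<subseteq> sections" "i < j" "j < length \<psi>s" "\<psi>s ! i = \<psi>s ! j"
  shows "D_rhs \<alpha> \<psi>s x = 0"
  using assms
proof (induction "length \<psi>s" arbitrary: \<psi>s \<alpha> p i j)
  case 0
  then show ?case by simp
next
  case (Suc n)
  note form = Omega_ker_form_section[OF Suc.prems(1)]
  have later: "D_rhs \<alpha> (\<zeta> # \<eta>s) x = 0"
    if \<zeta>: "\<zeta> \<in> sections" and n: "length \<eta>s = n" and \<eta>s: "set \<eta>s \<subseteq> sections"
      and ij: "i < j" "j < length \<eta>s" "\<eta>s ! i = \<eta>s ! j" for \<zeta> \<eta>s i j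
  proof -
    have "eval_form \<alpha> \<eta>s = (\<lambda>y. 0)"
      using alternating_forms_repeat[OF form_section_alternating[OF form], of i j] ij
      by (simp add: eval_form_def fun_eq_iff)
    then have "\<rho> x (\<zeta> x) (eval_form \<alpha> \<eta>s) = 0"
      by (simp add: tangent_const[OF anchor_section_tangent[OF \<zeta>]])
    moreover have "D_rhs (contract \<zeta> \<alpha>) \<eta>s x = 0"
      using Suc.hyps(1)[OF n[symmetric] contract_Omega_ker[OF Suc.prems(1) \<zeta>] \<eta>s ij] .
    ultimately show ?thesis
      by (simp add: D_rhs_Cons[OF form] slotwise_bracket_repeated[OF form \<zeta> \<eta>s ij])
  qed
  obtain \<zeta> \<xi> \<eta>s where \<psi>s: "\<psi>s = \<zeta> # \<xi> # \<eta>s"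
    using Suc.prems(3,4) by (cases \<psi>s rule: remdups_adj.cases) auto
  then have s: "\<zeta> \<in> sections" "\<xi> \<in> sections" "set \<eta>s \<subseteq> sections" "length \<eta>s = n - 1" "n > 0"
    using Suc.prems(2) Suc.hyps(2) by auto
  show ?case
  proof (cases i)
    case (Suc k)
    then obtain l where l: "j = Suc l" using Suc.prems(3) by (cases j) auto
    have kl: "k < l" "l < length (\<xi> # \<eta>s)" "(\<xi> # \<eta>s) ! k = (\<xi> # \<eta>s) ! l"
      using Suc.prems(3-5) Suc l \<psi>s by simp_all
    have "D_rhs \<alpha> (\<zeta> # \<xi> # \<eta>s) x = 0"
      by (rule later[OF s(1) _ _ kl]) (use s in simp_all)
    then show ?thesis by (simp add: \<psi>s)
  next
    case 0
    consider "j = 1" | k where "j = Suc (Suc k)" using Suc.prems(3) 0 by (cases j; cases "j - 1") auto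
    then show ?thesis
    proof cases
      case 1
      then show ?thesis using D_rhs_repeat_head[OF Suc.prems(1)] s \<psi>s 0 Suc.prems(5) by simp
    next
      case 2
      then have "\<eta>s ! k = \<zeta>" "k < length \<eta>s"
        using Suc.prems(3-5) 0 \<psi>s by simp_all
      then have "D_rhs \<alpha> (\<xi> # \<zeta> # \<eta>s) x = 0"
        using s by (intro later[of _ _ 0 "Suc k"]) simp_all
      then show ?thesis using D_rhs_swap[OF Suc.prems(1) s(1-3)] \<psi>s by simp
    qed
  qed
qed

text \<open>By linearity over functions, a section that vanishes at \<open>x\<close> does not contribute at \<open>x\<close>; the
  arguments can thus be replaced one after the other.\<close>

lemma D_rhs_pointwise:
  assumes "\<alpha> \<in> Omega_ker p" "set \<psi>s \<subseteq> sections" "set \<psi>s' \<subseteq> sections"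
    and "map (\<lambda>\<psi>. \<psi> x) \<psi>s = map (\<lambda>\<psi>. \<psi> x) \<psi>s'"
  shows "D_rhs \<alpha> \<psi>s x = D_rhs \<alpha> \<psi>s' x"
proof -
  have one: "D_rhs \<alpha> (\<xi>s @ \<phi> # \<eta>s) x = D_rhs \<alpha> (\<xi>s @ \<phi>' # \<eta>s) x"
    if s: "set \<xi>s \<subseteq> sections" "\<phi> \<in> sections" "\<phi>' \<in> sections" "set \<eta>s \<subseteq> sections" and eq: "\<phi> x = \<phi>' x"
    for \<xi>s \<phi> \<phi>' \<eta>s
  proof -
    let ?F = "\<lambda>\<sigma>. D_rhs \<alpha> (\<xi>s @ \<sigma> # \<eta>s) x"
    have lin: "?F (\<lambda>y. f y *\<^sub>R \<sigma> y + \<eta> y) = f x * ?F \<sigma> + ?F \<eta>"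
      if "f \<in> smooth_functions" "\<sigma> \<in> sections" "\<eta> \<in> sections" for f \<sigma> \<eta>
      using D_rhs_linear[OF assms(1) _ _ that(2,3,1), of "\<xi>s @ \<phi> # \<eta>s" "length \<xi>s" x] s by simp
    have "?F (\<lambda>y. (-1) *\<^sub>R \<phi> y + \<phi>' y) = 0"
      by (rule linear_vanishes_at[of ?F x, OF lin])
        (use sections_combination[OF smooth_functions_const s(2,3), of "-1"] eq in simp_all)
    then show ?thesis using lin[OF smooth_functions_const s(2,3), of "-1"] by simp
  qed
  have "length \<psi>s = length \<psi>s'" using assms(4) by (rule map_eq_imp_length_eq)
  then have "D_rhs \<alpha> (\<xi>s @ \<psi>s) x = D_rhs \<alpha> (\<xi>s @ \<psi>s') x" if "set \<xi>s \<subseteq> sections" for \<xi>s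
    using assms(2-4) that
  proof (induction \<psi>s \<psi>s' arbitrary: \<xi>s rule: list_induct2)
    case (Cons \<psi> \<psi>s \<psi>' \<psi>s')
    then show ?case
      using one[of \<xi>s \<psi> \<psi>' \<psi>s] Cons.IH[of "\<xi>s @ [\<psi>']"] by simp
  qed simp
  from this[of "[]"] show ?thesis by simp
qed

section \<open>The differential of a form\<close>

text \<open>The sections chosen through the given vectors are immaterial by \<open>D_rhs_pointwise\<close>.\<close>

definition D_form :: "nat \<Rightarrow> ('m \<Rightarrow> 'v list \<Rightarrow> real) \<Rightarrow> 'm \<Rightarrow> 'v list \<Rightarrow> real" where
  "D_form p \<alpha> x vs =
    (if length vs = Suc p \<and> set vs \<subseteq> E x then D_rhs \<alpha> (map (section_through x) vs) x else 0)"

context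
  fixes \<alpha> p assumes \<alpha>: "\<alpha> \<in> Omega_ker p"
begin

lemma D_form_eval:
  assumes "length \<psi>s = Suc p" "set \<psi>s \<subseteq> sections"
  shows "D_form p \<alpha> x (map (\<lambda>\<psi>. \<psi> x) \<psi>s) = D_rhs \<alpha> \<psi>s x"
proof -
  have E: "set (map (\<lambda>\<psi>. \<psi> x) \<psi>s) \<subseteq> E x" using assms(2) section_mem by auto
  then have "D_form p \<alpha> x (map (\<lambda>\<psi>. \<psi> x) \<psi>s) = D_rhs \<alpha> (map (section_through x) (map (\<lambda>\<psi>. \<psi> x) \<psi>s)) x"
    by (simp add: D_form_def assms(1))
  also have "\<dots> = D_rhs \<alpha> \<psi>s x"
    by (rule D_rhs_pointwise[OF \<alpha> sections_through(1)[OF E] assms(2) sections_through(2)[OF E]])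
  finally show ?thesis .
qed

lemma D_form_alternating: "D_form p \<alpha> x \<in> alternating_forms (E x) (Suc p)"
proof (rule alternating_formsI)
  fix vs :: "'v list" and i c v w
  assume v: "v \<in> E x" and w: "w \<in> E x" and l: "length vs = Suc p" and vs: "set vs \<subseteq> E x" and i: "i < Suc p"
  let ?\<psi>s = "map (section_through x) vs"
  note vw = section_through[OF v] section_through[OF w]
  have upd: "D_form p \<alpha> x (vs[i := \<sigma> x]) = D_rhs \<alpha> (?\<psi>s[i := \<sigma>]) x" if "\<sigma> \<in> sections" for \<sigma>
  proof -
    have "set (?\<psi>s[i := \<sigma>]) \<subseteq> sections"
      using sections_through(1)[OF vs] that set_update_subset_insert[of ?\<psi>s i \<sigma>] by blast
    moreover have "map (\<lambda>\<psi>. \<psi> x) (?\<psi>s[i := \<sigma>]) = vs[i := \<sigma> x]"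
      by (simp only: map_update sections_through(2)[OF vs])
    ultimately show ?thesis using D_form_eval[of "?\<psi>s[i := \<sigma>]" x] l by simp
  qed
  let ?\<sigma> = "\<lambda>y. c *\<^sub>R section_through x v y + section_through x w y"
  have "?\<sigma> \<in> sections" by (rule sections_combination[OF smooth_functions_const vw(1,3)])
  moreover have "D_rhs \<alpha> (?\<psi>s[i := ?\<sigma>]) x =
      c * D_rhs \<alpha> (?\<psi>s[i := section_through x v]) x + D_rhs \<alpha> (?\<psi>s[i := section_through x w]) x"
    by (rule D_rhs_linear[OF \<alpha> sections_through(1)[OF vs] _ vw(1,3) smooth_functions_const]) (simp add: l i)
  ultimately show "D_form p \<alpha> x (vs[i := c *\<^sub>R v + w]) =
      c * D_form p \<alpha> x (vs[i := v]) + D_form p \<alpha> x (vs[i := w])"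
    using upd[of ?\<sigma>] upd[OF vw(1)] upd[OF vw(3)] vw(2,4) by simp
next
  fix vs i j assume *: "length vs = Suc p" "set vs \<subseteq> E x" "i < j" "j < Suc p" "vs ! i = vs ! j"
  then show "D_form p \<alpha> x vs = 0"
    using D_rhs_repeated[OF \<alpha> sections_through(1)[OF *(2)] *(3)] by (simp add: D_form_def)
qed (auto simp: D_form_def)

text \<open>Near a point where the bump function \<open>\<theta>\<close> does not vanish, the coefficients of the form in a
  local frame \<open>(e\<^sub>b)\<close> are the values on the global sections \<open>\<theta> e\<^sub>b\<close>, divided by a power of \<open>\<theta>\<close>.\<close>

lemma D_form_form_section: "D_form p \<alpha> \<in> form_sections (Suc p)"
proof -
  have "smooth_map_on U (\<lambda>x. D_form p \<alpha> x (map (inv_into (E x) (\<tau> x)) ss))"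
    if t: "(U, \<tau>) \<in> triv" and ss: "length ss = Suc p" for U \<tau> ss
  proof (rule smooth_map_on_local)
    fix x\<^sub>0 assume x0: "x\<^sub>0 \<in> U"
    obtain \<theta> K where \<theta>: "\<theta> \<in> smooth_functions" "\<theta> x\<^sub>0 = 1" "closed K" "K \<subseteq> U" "\<And>x. x \<notin> K \<Longrightarrow> \<theta> x = 0"
      using bump_function[OF triv_open[OF t] x0] by metis
    define \<psi>s where "\<psi>s = map (\<lambda>s x. \<theta> x *\<^sub>R inv_into (E x) (\<tau> x) s) ss"
    have \<psi>s: "set \<psi>s \<subseteq> sections"
      using cutoff_section[OF t \<theta>(1,3-5)] by (auto simp: \<psi>s_def)
    define W where "W = \<theta> -` (- {0})"
    have "open W"
      unfolding W_def using open_vimage[of "- {0}" \<theta>] smooth_function_continuous[OF \<theta>(1)] by auto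
    have WU: "x \<in> U" "\<theta> x \<noteq> 0" if "x \<in> W" for x
      using that \<theta>(4) \<theta>(5)[of x] by (auto simp: W_def)
    have "smooth_map_on W (\<lambda>x. inverse (\<theta> x) ^ Suc p * D_rhs \<alpha> \<psi>s x)"
      using WU(2) by (intro smooth_map_on_mult[OF \<open>open W\<close>] smooth_map_on_power[OF \<open>open W\<close>]
        smooth_map_on_inverse[OF \<open>open W\<close>] smooth_functionD \<theta>(1)
        D_rhs_smooth[OF Omega_ker_form_section[OF \<alpha>] \<psi>s])
    moreover have "D_form p \<alpha> x (map (inv_into (E x) (\<tau> x)) ss) = inverse (\<theta> x) ^ Suc p * D_rhs \<alpha> \<psi>s x"
      if x: "x \<in> W" for x
    proof -
      let ?vs = "map (inv_into (E x) (\<tau> x)) ss"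
      have "set ?vs \<subseteq> E x" using frame_mem[OF t WU(1)[OF x]] by auto
      then have "D_form p \<alpha> x (map (\<lambda>v. \<theta> x *\<^sub>R v) ?vs) = \<theta> x ^ Suc p * D_form p \<alpha> x ?vs"
        using subspace_forms.form_scale_all[OF fibre_forms D_form_alternating, of ?vs x "\<theta> x"] ss by simp
      moreover have "map (\<lambda>v. \<theta> x *\<^sub>R v) ?vs = map (\<lambda>\<psi>. \<psi> x) \<psi>s"
        by (simp add: \<psi>s_def)
      moreover have "length \<psi>s = Suc p" by (simp add: \<psi>s_def ss)
      ultimately have "D_rhs \<alpha> \<psi>s x = \<theta> x ^ Suc p * D_form p \<alpha> x ?vs"
        using D_form_eval[OF _ \<psi>s, of x] by metis
      moreover have "inverse (\<theta> x) ^ Suc p * \<theta> x ^ Suc p = 1"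
        using WU(2)[OF x] by (simp flip: power_mult_distrib del: power_Suc)
      ultimately show ?thesis by (simp only: mult.assoc[symmetric] mult_1)
    qed
    ultimately show "\<exists>W' f'. open W' \<and> x\<^sub>0 \<in> W' \<and> smooth_map_on W' f' \<and>
        (\<forall>y\<in>W'. D_form p \<alpha> y (map (inv_into (E y) (\<tau> y)) ss) = f' y)"
      using \<open>open W\<close> \<theta>(2)
      by (intro exI[of _ W] exI[of _ "\<lambda>x. inverse (\<theta> x) ^ Suc p * D_rhs \<alpha> \<psi>s x"]) (auto simp: W_def)
  qed
  then show ?thesis
    unfolding form_sections_def using D_form_alternating by auto
qed

lemma form_section_determined:
  assumes "\<omega> \<in> form_sections (Suc p)"
    and "\<And>\<psi>s. length \<psi>s = Suc p \<Longrightarrow> set \<psi>s \<subseteq> sections \<Longrightarrow> eval_form \<omega> \<psi>s = D_rhs \<alpha> \<psi>s"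
  shows "\<omega> = D_form p \<alpha>"
proof (intro ext)
  fix x vs
  show "\<omega> x vs = D_form p \<alpha> x vs"
  proof (cases "length vs = Suc p \<and> set vs \<subseteq> E x")
    case True
    then have "\<omega> x vs = eval_form \<omega> (map (section_through x) vs) x"
      unfolding eval_form_def using sections_through(2)[of vs x] by simp
    also have "\<dots> = D_form p \<alpha> x vs"
      using assms(2)[of "map (section_through x) vs"] sections_through(1)[of vs x] True by (simp add: D_form_def)
    finally show ?thesis .
  next
    case False
    then show ?thesis
      using alternating_forms_zero[OF form_section_alternating[OF assms(1)] False]
      by (auto simp: D_form_def)
  qed
qed

lemma D_form_property:
  "D_form p \<alpha> \<in> form_sections (Suc p) \<and>
    (\<forall>\<psi>s. length \<psi>s = Suc p \<and> set \<psi>s \<subseteq> sections \<longrightarrow> eval_form (D_form p \<alpha>) \<psi>s = D_rhs \<alpha> \<psi>s)"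
  using D_form_form_section D_form_eval by (auto simp: eval_form_def)

lemma D_exists_unique:
  "\<exists>!\<omega>. \<omega> \<in> form_sections (Suc p) \<and>
    (\<forall>\<psi>s. length \<psi>s = Suc p \<and> set \<psi>s \<subseteq> sections \<longrightarrow> eval_form \<omega> \<psi>s = D_rhs \<alpha> \<psi>s)"
  using D_form_property form_section_determined by (intro ex1I) auto

lemma D_eq_D_form: "D p \<alpha> = D_form p \<alpha>"
  unfolding D_def using D_form_property form_section_determined by (intro the_equality) auto

lemma D_form_section: "D p \<alpha> \<in> form_sections (Suc p)"
  by (simp add: D_eq_D_form D_form_form_section)

text \<open>On lists of any other length than \<open>Suc p\<close> both sides vanish. Allowing these saves case
  distinctions in the proof of the Leibniz rule, where forms are evaluated on all sublists.\<close>

lemma D_eval: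
  assumes "set \<psi>s \<subseteq> sections"
  shows "D p \<alpha> x (map (\<lambda>\<psi>. \<psi> x) \<psi>s) = D_rhs \<alpha> \<psi>s x"
proof (cases "length \<psi>s = Suc p")
  case True
  then show ?thesis using D_form_eval assms by (simp add: D_eq_D_form)
next
  case False
  have hom: "eval_form \<alpha> \<eta>s = (\<lambda>x. 0)" if "length \<eta>s \<noteq> p" for \<eta>s
    using alternating_forms_zero[OF Omega_ker_alternating[OF \<alpha>]] that by (simp add: eval_form_def fun_eq_iff)
  have len: "length (omit I \<psi>s) + card I = length \<psi>s" if "I \<subseteq> {..<length \<psi>s}" for I
  proof -
    have "length (omit I \<psi>s) = card ({..<length \<psi>s} - I)"
      unfolding omit_def length_nths by (rule arg_cong[where f = card]) auto
    moreover have "card I \<le> length \<psi>s" using card_mono[OF finite_lessThan that] by simp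
    ultimately show ?thesis using that by (simp add: card_Diff_subset finite_subset)
  qed
  have "\<rho> x ((\<psi>s ! i) x) (eval_form \<alpha> (omit {i} \<psi>s)) = 0" if "i < length \<psi>s" for i
  proof -
    have "\<psi>s ! i \<in> sections" using assms that by auto
    then have tangent: "\<rho> x ((\<psi>s ! i) x) \<in> tangent_space x" by (rule anchor_section_tangent)
    have "eval_form \<alpha> (omit {i} \<psi>s) = (\<lambda>x. 0)"
      using len[of "{i}"] False that by (intro hom) auto
    then show ?thesis using tangent_const[OF tangent] by simp
  qed
  moreover have "eval_form \<alpha> (br (\<psi>s ! i) (\<psi>s ! j) # omit {i, j} \<psi>s) x = 0" if "i < j" "j < length \<psi>s" for i j
    using len[of "{i, j}"] that False hom[of "br (\<psi>s ! i) (\<psi>s ! j) # omit {i, j} \<psi>s"] by auto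
  ultimately have "D_rhs \<alpha> \<psi>s x = 0"
    unfolding D_rhs_def by (simp add: split_beta)
  then show ?thesis using False by (simp add: D_eq_D_form D_form_def)
qed

end

section \<open>The differential preserves the kernel\<close>

lemma anchor_gradient_add:
  assumes "f \<in> smooth_functions" "h \<in> smooth_functions"
  shows "anchor_gradient (\<lambda>y. f y + h y) x = anchor_gradient f x + anchor_gradient h x"
  using anchor_gradient_linear[of x "\<lambda>y. f y + h y" 1 f 1 h] tangent_add[OF anchor_tangent assms] by simp

lemma anchor_gradient_mult:
  assumes "f \<in> smooth_functions" "h \<in> smooth_functions"
  shows "anchor_gradient (\<lambda>y. f y * h y) x = f x *\<^sub>R anchor_gradient h x + h x *\<^sub>R anchor_gradient f x"
  using anchor_gradient_linear[of x "\<lambda>y. f y * h y" "f x" h "h x" f] tangent_mult[OF anchor_tangent assms] by simp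

lemma bracket_add:
  assumes "\<phi> \<in> sections" "\<eta> \<in> sections" "\<psi> \<in> sections"
  shows "br (\<lambda>x. \<phi> x + \<eta> x) \<psi> x = br \<phi> \<psi> x + br \<eta> \<psi> x"
    and "br \<psi> (\<lambda>x. \<phi> x + \<eta> x) x = br \<psi> \<phi> x + br \<psi> \<eta> x"
  using bracket_linear_left[OF assms, of 1] bracket_linear_right[OF assms(3,1,2), of 1]
  by (simp_all add: fun_eq_iff)

lemma metric_add:
  assumes "u \<in> E x" "v \<in> E x"
  shows "g x (u + v) (u + v) = (g x u u + g x u v) + (g x u v + g x v v)"
    and "w \<in> E x \<Longrightarrow> g x (u + v) w = g x u w + g x v w"
    and "w \<in> E x \<Longrightarrow> g x w (u + v) = g x w u + g x w v"
  using metric_linear[OF assms, of _ 1] metric_linear_right[OF assms, of _ 1] metric_sym[OF assms] fibre_add[OF assms] assms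
  by simp_all

lemma bracket_self_gradient:
  assumes "\<psi> \<in> sections"
  shows "anchor_gradient (\<lambda>y. g y (\<psi> y) (\<psi> y)) x = 2 *\<^sub>R br \<psi> \<psi> x"
  using bracket_self[OF assms, of x] by (simp add: anchor_gradient_def)

definition bracket_sym :: "('m \<Rightarrow> 'v) \<Rightarrow> ('m \<Rightarrow> 'v) \<Rightarrow> 'm \<Rightarrow> 'v" where
  "bracket_sym \<phi> \<psi> x = br \<phi> \<psi> x + br \<psi> \<phi> x"

lemma bracket_sym_section: "\<phi> \<in> sections \<Longrightarrow> \<psi> \<in> sections \<Longrightarrow> bracket_sym \<phi> \<psi> \<in> sections"
  unfolding bracket_sym_def[abs_def] by (intro sections_add bracket_section)

text \<open>This is the polarisation of \<open>[\<psi>, \<psi>] = \<nabla>\<langle>\<psi>, \<psi>\<rangle> / 2\<close>.\<close>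

lemma bracket_sym_gradient:
  assumes "\<phi> \<in> sections" "\<psi> \<in> sections"
  shows "bracket_sym \<phi> \<psi> x = anchor_gradient (\<lambda>y. g y (\<phi> y) (\<psi> y)) x"
proof -
  let ?s = "\<lambda>x. \<phi> x + \<psi> x"
  note s = sections_add[OF assms]
  note smooth = metric_function_smooth[OF assms(1,1)] metric_function_smooth[OF assms(1,2)]
    metric_function_smooth[OF assms(2,2)]
  have "2 *\<^sub>R br ?s ?s x = anchor_gradient (\<lambda>y. g y (?s y) (?s y)) x"
    using bracket_self_gradient[OF s] by simp
  also have "(\<lambda>y. g y (?s y) (?s y)) =
      (\<lambda>y. (g y (\<phi> y) (\<phi> y) + g y (\<phi> y) (\<psi> y)) + (g y (\<phi> y) (\<psi> y) + g y (\<psi> y) (\<psi> y)))"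
    using metric_add(1) section_mem assms by (simp add: fun_eq_iff)
  also have "anchor_gradient \<dots> x =
      (2 *\<^sub>R br \<phi> \<phi> x + anchor_gradient (\<lambda>y. g y (\<phi> y) (\<psi> y)) x)
      + (anchor_gradient (\<lambda>y. g y (\<phi> y) (\<psi> y)) x + 2 *\<^sub>R br \<psi> \<psi> x)"
    unfolding anchor_gradient_add[OF smooth_functions_add[OF smooth(1,2)] smooth_functions_add[OF smooth(2,3)]]
      anchor_gradient_add[OF smooth(1,2)] anchor_gradient_add[OF smooth(2,3)]
      bracket_self_gradient[OF assms(1)] bracket_self_gradient[OF assms(2)] ..
  finally have "2 *\<^sub>R bracket_sym \<phi> \<psi> x = 2 *\<^sub>R anchor_gradient (\<lambda>y. g y (\<phi> y) (\<psi> y)) x"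
    by (simp add: bracket_add assms s bracket_sym_def scaleR_2 algebra_simps)
  then show ?thesis by simp
qed

lemma anchor_bracket_sym:
  assumes "\<phi> \<in> sections" "\<psi> \<in> sections"
  shows "\<rho> x (bracket_sym \<phi> \<psi> x) f = 0"
  using anchor_linear[of "br \<phi> \<psi> x" x "br \<psi> \<phi> x" 1 f] section_mem bracket_section assms
  by (simp add: bracket_sym_def anchor_bracket lie_bracket_def)

lemma bracket_metric_polarised:
  assumes "\<psi> \<in> sections" "\<phi> \<in> sections" "\<eta> \<in> sections"
  shows "\<rho> x (\<psi> x) (\<lambda>y. g y (\<phi> y) (\<eta> y)) = g x (br \<psi> \<phi> x) (\<eta> x) + g x (\<phi> x) (br \<psi> \<eta> x)"
proof -
  let ?s = "\<lambda>x. \<phi> x + \<eta> x"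
  note s = sections_add[OF assms(2,3)]
  note tangent = anchor_section_tangent[OF assms(1)]
  note smooth = metric_function_smooth[OF assms(2,2)] metric_function_smooth[OF assms(2,3)]
    metric_function_smooth[OF assms(3,3)]
  have mem: "\<phi> x \<in> E x" "\<eta> x \<in> E x" "br \<psi> \<phi> x \<in> E x" "br \<psi> \<eta> x \<in> E x" for x
    using section_mem bracket_section assms by auto
  have "\<rho> x (\<psi> x) (\<lambda>y. g y (?s y) (?s y)) = 2 * g x (br \<psi> ?s x) (?s x)"
    using bracket_metric[OF assms(1) s] .
  moreover have "(\<lambda>y. g y (?s y) (?s y)) =
      (\<lambda>y. (g y (\<phi> y) (\<phi> y) + g y (\<phi> y) (\<eta> y)) + (g y (\<phi> y) (\<eta> y) + g y (\<eta> y) (\<eta> y)))"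
    using metric_add(1) mem by (simp add: fun_eq_iff)
  moreover have "\<rho> x (\<psi> x) \<dots> = (2 * g x (br \<psi> \<phi> x) (\<phi> x) + \<rho> x (\<psi> x) (\<lambda>y. g y (\<phi> y) (\<eta> y)))
      + (\<rho> x (\<psi> x) (\<lambda>y. g y (\<phi> y) (\<eta> y)) + 2 * g x (br \<psi> \<eta> x) (\<eta> x))"
    unfolding tangent_add[OF tangent smooth_functions_add[OF smooth(1,2)] smooth_functions_add[OF smooth(2,3)]]
      tangent_add[OF tangent smooth(1,2)] tangent_add[OF tangent smooth(2,3)]
      bracket_metric[OF assms(1,2)] bracket_metric[OF assms(1,3)] ..
  moreover have "g x (br \<psi> ?s x) (?s x) = g x (br \<psi> \<phi> x) (\<phi> x) + g x (br \<psi> \<phi> x) (\<eta> x)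
      + (g x (\<phi> x) (br \<psi> \<eta> x) + g x (br \<psi> \<eta> x) (\<eta> x))"
    using metric_add(2,3) mem metric_sym[OF mem(4,1)] fibre_add by (simp add: bracket_add assms)
  ultimately show ?thesis by simp
qed

text \<open>By compatibility of bracket and metric, \<open>\<langle>[\<psi>, \<rho>\<^sup>* dh], \<eta>\<rangle>\<close> is
  \<open>\<rho>(\<psi>) \<rho>(\<eta>) h - \<rho>([\<psi>, \<eta>]) h\<close>, which is \<open>\<rho>(\<eta>) \<rho>(\<psi>) h\<close> since the anchor preserves brackets.\<close>

lemma bracket_gradient:
  assumes "\<psi> \<in> sections" "\<sigma> \<in> sections" "h \<in> smooth_functions" "\<And>y. \<sigma> y = anchor_gradient h y"
  shows "br \<psi> \<sigma> x = anchor_gradient (\<lambda>y. \<rho> y (\<psi> y) h) x"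
proof (rule anchor_gradient_unique)
  show "br \<psi> \<sigma> x \<in> E x" using section_mem bracket_section assms by blast
  fix v assume v: "v \<in> E x"
  let ?\<eta> = "section_through x v"
  note \<eta> = section_through[OF v]
  have metric: "g y (\<sigma> y) (\<xi> y) = \<rho> y (\<xi> y) h" if "\<xi> \<in> sections" for \<xi> y
    using metric_anchor_gradient section_mem[OF that] assms(4) by simp
  have "\<rho> x (\<psi> x) (\<lambda>y. \<rho> y (?\<eta> y) h) = g x (br \<psi> \<sigma> x) v + \<rho> x (br \<psi> ?\<eta> x) h"
    using bracket_metric_polarised[OF assms(1,2) \<eta>(1), of x] metric[OF \<eta>(1)]
      metric[OF bracket_section[OF assms(1) \<eta>(1)]] \<eta>(2) by simp
  then show "g x (br \<psi> \<sigma> x) v = \<rho> x v (\<lambda>y. \<rho> y (\<psi> y) h)"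
    by (simp add: anchor_bracket[OF assms(1) \<eta>(1)] lie_bracket_def assms(3) \<eta>(2))
qed

text \<open>The first argument is a gradient that the anchor maps to 0, so only the brackets of it with the
  other arguments remain in Cartan's formula, and these are gradients again.\<close>

lemma D_rhs_bracket_sym:
  assumes \<alpha>: "\<alpha> \<in> Omega_ker p" and s: "\<phi> \<in> sections" "\<psi> \<in> sections" "set \<psi>s \<subseteq> sections"
  shows "D_rhs \<alpha> (bracket_sym \<phi> \<psi> # \<psi>s) x = 0"
proof -
  let ?s = "bracket_sym \<phi> \<psi>"
  let ?h = "\<lambda>y. g y (\<phi> y) (\<psi> y)"
  note form = Omega_ker_form_section[OF \<alpha>]
  note sec = bracket_sym_section[OF s(1,2)]
  have contract: "contract ?s \<alpha> = (\<lambda>x ws. 0)"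
    by (simp add: contract_def contraction_def fun_eq_iff bracket_sym_gradient[OF s(1,2)] Omega_ker_gradient[OF \<alpha>])
  have "eval_form \<alpha> (\<psi>s[j := br ?s (\<psi>s ! j)]) x = 0" if j: "j < length \<psi>s" for j
  proof -
    let ?\<eta> = "\<psi>s ! j"
    have \<eta>: "?\<eta> \<in> sections" using s(3) j by auto
    have "br ?s ?\<eta> x = (-1) *\<^sub>R br ?\<eta> ?s x + bracket_sym ?s ?\<eta> x"
      by (simp add: bracket_sym_def)
    then have "eval_form \<alpha> (\<psi>s[j := br ?s ?\<eta>]) x =
        - 1 * eval_form \<alpha> (\<psi>s[j := br ?\<eta> ?s]) x + eval_form \<alpha> (\<psi>s[j := bracket_sym ?s ?\<eta>]) x"
      by (intro eval_form_update_linear[OF form j] section_mem bracket_section bracket_sym_section sec \<eta>)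
    also have "eval_form \<alpha> (\<psi>s[j := br ?\<eta> ?s]) x = 0"
      using bracket_gradient[OF \<eta> sec metric_function_smooth[OF s(1,2)] bracket_sym_gradient[OF s(1,2)], of x]
        Omega_ker_gradient_at[OF \<alpha>] j by (simp add: eval_form_def map_update)
    also have "eval_form \<alpha> (\<psi>s[j := bracket_sym ?s ?\<eta>]) x = 0"
      using bracket_sym_gradient[OF sec \<eta>, of x] Omega_ker_gradient_at[OF \<alpha>] j
      by (simp add: eval_form_def map_update)
    finally show ?thesis by simp
  qed
  then have "slotwise (br ?s) (\<lambda>\<eta>s. eval_form \<alpha> \<eta>s x) \<psi>s = 0"
    by (simp add: slotwise_def)
  then show ?thesis
    by (simp add: D_rhs_Cons[OF form] contract D_rhs_zero[OF s(3)] anchor_bracket_sym[OF s(1,2)])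
qed

text \<open>The gradient of an arbitrary \<open>f\<close> is recovered from symmetrised brackets through
  \<open>h \<nabla>f = \<nabla>(f h) - f \<nabla>h\<close> with \<open>h = \<langle>\<phi>, \<psi>\<rangle>\<close> and \<open>f h = \<langle>f \<phi>, \<psi>\<rangle>\<close>, where \<open>\<phi>, \<psi>\<close> are chosen such
  that \<open>h\<close> does not vanish at the given point.\<close>

lemma D_Omega_ker:
  assumes \<alpha>: "\<alpha> \<in> Omega_ker p"
  shows "D p \<alpha> \<in> Omega_ker (Suc p)"
proof -
  have "D p \<alpha> x (anchor_gradient f x # ws) = 0" for x f ws
  proof -
    note alt = form_section_alternating[OF D_form_section[OF \<alpha>], of x]
    let ?u = "anchor_gradient f x"
    show ?thesis
    proof (cases "?u = 0 \<or> \<not> set ws \<subseteq> E x")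
      case True
      then show ?thesis
        using subspace_forms.form_zero_entry[OF fibre_forms alt, of "[]" ws]
          alternating_forms_zero[OF alt, of "?u # ws"] by auto
    next
      case False
      then have u: "?u \<noteq> 0" and ws: "set ws \<subseteq> E x" by auto
      obtain v where v: "v \<in> E x" "g x ?u v \<noteq> 0"
        using metric_nondegenerate[OF anchor_gradient_mem] u by blast
      have f: "f \<in> smooth_functions"
      proof (rule ccontr)
        assume "f \<notin> smooth_functions"
        then show False
          using v tangent_not_smooth[OF anchor_tangent[OF v(1)]] metric_anchor_gradient[OF v(1)] by simp
      qed
      let ?\<phi> = "section_through x ?u" and ?\<psi> = "section_through x v"
      let ?\<psi>s = "map (section_through x) ws"
      let ?h = "\<lambda>y. g y (?\<phi> y) (?\<psi> y)"
      note \<phi> = section_through[OF anchor_gradient_mem[of f x]] and \<psi> = section_through[OF v(1)]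
      have f\<phi>: "(\<lambda>y. f y *\<^sub>R ?\<phi> y) \<in> sections" using f \<phi>(1) by (rule sections_scale)
      have zero: "D p \<alpha> x (bracket_sym \<sigma> ?\<psi> x # ws) = 0" if "\<sigma> \<in> sections" for \<sigma>
      proof -
        have "D p \<alpha> x (map (\<lambda>\<psi>. \<psi> x) (bracket_sym \<sigma> ?\<psi> # ?\<psi>s)) = D_rhs \<alpha> (bracket_sym \<sigma> ?\<psi> # ?\<psi>s) x"
          using bracket_sym_section[OF that \<psi>(1)] sections_through(1)[OF ws] by (intro D_eval[OF \<alpha>]) simp
        moreover have "map (\<lambda>\<psi>. \<psi> x) (bracket_sym \<sigma> ?\<psi> # ?\<psi>s) = bracket_sym \<sigma> ?\<psi> x # ws"
          by (simp only: list.map(2) sections_through(2)[OF ws])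
        ultimately show ?thesis
          using D_rhs_bracket_sym[OF \<alpha> that \<psi>(1) sections_through(1)[OF ws]] by simp
      qed
      have "g y (f y *\<^sub>R ?\<phi> y) (?\<psi> y) = f y * ?h y" for y
        using metric_linear[OF section_mem[OF \<phi>(1)] fibre_zero section_mem[OF \<psi>(1)]]
          metric_linear[OF fibre_zero fibre_zero section_mem[OF \<psi>(1)], of _ 1] by simp
      then have "bracket_sym (\<lambda>y. f y *\<^sub>R ?\<phi> y) ?\<psi> x = f x *\<^sub>R bracket_sym ?\<phi> ?\<psi> x + ?h x *\<^sub>R ?u"
        using anchor_gradient_mult[OF f metric_function_smooth[OF \<phi>(1) \<psi>(1)], of x]
        by (simp add: bracket_sym_gradient f\<phi> \<phi>(1) \<psi>(1))
      then have "0 = D p \<alpha> x ((f x *\<^sub>R bracket_sym ?\<phi> ?\<psi> x + ?h x *\<^sub>R ?u) # ws)"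
        using zero[OF f\<phi>] by simp
      also have "\<dots> = f x * D p \<alpha> x (bracket_sym ?\<phi> ?\<psi> x # ws) + D p \<alpha> x ((?h x *\<^sub>R ?u) # ws)"
        by (intro subspace_forms.form_linear_Cons[OF fibre_forms alt] section_mem bracket_sym_section \<phi>(1) \<psi>(1)
            fibre_scale anchor_gradient_mem)
      also have "\<dots> = ?h x * D p \<alpha> x (?u # ws)"
        using zero[OF \<phi>(1)] subspace_forms.form_scale_append[OF fibre_forms alt anchor_gradient_mem, where xs = "[]"]
        by simp
      finally show ?thesis using v(2) \<phi>(2) \<psi>(2) by simp
    qed
  qed
  then show ?thesis using D_form_section[OF \<alpha>] by (simp add: Omega_ker_iff)
qed

section \<open>The Leibniz rule\<close>

lemma anchor_wedge:
  assumes "\<phi> \<in> sections" "\<alpha> \<in> form_sections p" "\<beta> \<in> form_sections q" "set \<psi>s \<subseteq> sections"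
  shows "\<rho> x (\<phi> x) (eval_form (\<lambda>x. wedge (\<alpha> x) (\<beta> x)) \<psi>s) =
    wedge (\<lambda>\<eta>s. \<rho> x (\<phi> x) (eval_form \<alpha> \<eta>s)) (\<lambda>\<eta>s. eval_form \<beta> \<eta>s x) \<psi>s
    + wedge (\<lambda>\<eta>s. eval_form \<alpha> \<eta>s x) (\<lambda>\<eta>s. \<rho> x (\<phi> x) (eval_form \<beta> \<eta>s)) \<psi>s"
proof -
  note tangent = anchor_section_tangent[OF assms(1), of x]
  let ?a = "\<lambda>I. eval_form \<alpha> (nths \<psi>s I)" and ?b = "\<lambda>I. eval_form \<beta> (omit I \<psi>s)"
  have a: "?a I \<in> smooth_functions" for I
    using order.trans[OF set_nths_subset assms(4)] by (rule eval_form_smooth[OF assms(2)])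
  have b: "?b I \<in> smooth_functions" for I
    using order.trans[OF set_omit_subset assms(4)] by (rule eval_form_smooth[OF assms(3)])
  have ab: "(\<lambda>y. ?a I y * ?b I y) \<in> smooth_functions" for I
    using a b by (rule smooth_functions_mult)
  have "eval_form (\<lambda>x. wedge (\<alpha> x) (\<beta> x)) \<psi>s =
      (\<lambda>y. \<Sum>I\<in>Pow {..<length \<psi>s}. shuffle_sign I * (?a I y * ?b I y))"
    by (rule ext) (simp add: eval_form_def wedge_map, simp add: wedge_def mult.assoc)
  moreover have "\<rho> x (\<phi> x) \<dots> = (\<Sum>I\<in>Pow {..<length \<psi>s}. \<rho> x (\<phi> x) (\<lambda>y. shuffle_sign I * (?a I y * ?b I y)))"
    by (rule tangent_sum[OF tangent]) (intro smooth_functions_mult[OF smooth_functions_const] ab)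
  moreover have "\<rho> x (\<phi> x) (\<lambda>y. shuffle_sign I * (?a I y * ?b I y)) =
      shuffle_sign I * \<rho> x (\<phi> x) (?a I) * ?b I x + shuffle_sign I * ?a I x * \<rho> x (\<phi> x) (?b I)" for I
    unfolding tangent_cmult[OF tangent ab] tangent_mult[OF tangent a b] by (simp add: algebra_simps)
  ultimately show ?thesis by (simp add: wedge_def sum.distrib)
qed

lemma contract_zero_degree:
  assumes "\<alpha> \<in> form_sections 0"
  shows "contract \<phi> \<alpha> = (\<lambda>x ws. 0)"
  using alternating_forms_zero[OF form_section_alternating[OF assms]]
  by (simp add: contract_def contraction_def fun_eq_iff)

lemma contraction_D:
  assumes \<alpha>: "\<alpha> \<in> Omega_ker p" and s: "\<phi> \<in> sections" "set \<eta>s \<subseteq> sections"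
  shows "contraction (\<phi> x) (D p \<alpha> x) (map (\<lambda>\<psi>. \<psi> x) \<eta>s) = - 1 * (slotwise (br \<phi>) (\<lambda>\<eta>s. eval_form \<alpha> \<eta>s x) \<eta>s)
    + (- 1 * D (p - 1) (contract \<phi> \<alpha>) x (map (\<lambda>\<psi>. \<psi> x) \<eta>s) + \<rho> x (\<phi> x) (eval_form \<alpha> \<eta>s))"
  using D_eval[OF \<alpha>, of "\<phi> # \<eta>s" x] D_eval[OF contract_Omega_ker[OF \<alpha> s(1)] s(2), of x] s
  by (simp add: contraction_def D_rhs_Cons[OF Omega_ker_form_section[OF \<alpha>]])

text \<open>Both sides are expanded by contraction with the first argument: the left one by Cartan's formula,
  whose three terms are distributed over the product, the right one by the antiderivation property of
  the contraction and Cartan's formula for \<open>\<alpha>\<close> and \<open>\<beta>\<close>.\<close>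

lemma D_rhs_wedge:
  assumes "\<alpha> \<in> Omega_ker p" "\<beta> \<in> Omega_ker q" "set \<psi>s \<subseteq> sections"
  shows "D_rhs (\<lambda>x. wedge (\<alpha> x) (\<beta> x)) \<psi>s x = wedge (D p \<alpha> x) (\<beta> x) (map (\<lambda>\<psi>. \<psi> x) \<psi>s)
    + (-1) ^ p * wedge (\<alpha> x) (D q \<beta> x) (map (\<lambda>\<psi>. \<psi> x) \<psi>s)"
  using assms
proof (induction \<psi>s arbitrary: \<alpha> \<beta> p q)
  case Nil
  have "D p \<alpha> x [] = 0" "D q \<beta> x [] = 0"
    using D_eval[OF Nil(1), of "[]" x] D_eval[OF Nil(2), of "[]" x] by (simp_all add: D_rhs_Nil)
  then show ?case by (simp add: D_rhs_Nil wedge_Nil)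
next
  case (Cons \<phi> \<psi>s)
  note forms = Omega_ker_form_section[OF Cons.prems(1)] Omega_ker_form_section[OF Cons.prems(2)]
  have s: "\<phi> \<in> sections" "set \<psi>s \<subseteq> sections" using Cons.prems(3) by auto
  let ?at = "map (\<lambda>\<psi>. \<psi> x)"
  let ?\<alpha> = "contract \<phi> \<alpha>" and ?\<beta> = "contract \<phi> \<beta>"
  let ?A = "\<lambda>\<eta>s. eval_form \<alpha> \<eta>s x" and ?B = "\<lambda>\<eta>s. eval_form \<beta> \<eta>s x"
  let ?RA = "\<lambda>\<eta>s. \<rho> x (\<phi> x) (eval_form \<alpha> \<eta>s)" and ?RB = "\<lambda>\<eta>s. \<rho> x (\<phi> x) (eval_form \<beta> \<eta>s)"
  let ?LA = "slotwise (br \<phi>) ?A" and ?LB = "slotwise (br \<phi>) ?B"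
  let ?vs = "?at \<psi>s"
  have hom: "homogeneous p (\<alpha> y)" "homogeneous (Suc p) (D p \<alpha> y)" "homogeneous p ?A" for y
    using alternating_forms_homogeneous[OF form_section_alternating[OF forms(1)]]
      alternating_forms_homogeneous[OF form_section_alternating[OF D_form_section[OF Cons.prems(1)]]]
    by (simp_all add: homogeneous_def eval_form_def)
  have c: "?\<alpha> \<in> Omega_ker (p - 1)" "?\<beta> \<in> Omega_ker (q - 1)"
    using contract_Omega_ker Cons.prems(1,2) s(1) by auto
  have pull: "wedge (a x) (b x) ?vs = wedge (\<lambda>\<eta>s. a x (?at \<eta>s)) (\<lambda>\<eta>s. b x (?at \<eta>s)) \<psi>s" for a b
    by (rule wedge_map)
  have eval: "eval_form \<gamma> \<eta>s x = \<gamma> x (?at \<eta>s)" for \<gamma> \<eta>s by (simp add: eval_form_def)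
  have anchor: "\<rho> x (\<phi> x) (eval_form (\<lambda>x. wedge (\<alpha> x) (\<beta> x)) \<psi>s) = wedge ?RA ?B \<psi>s + wedge ?A ?RB \<psi>s"
    by (rule anchor_wedge[OF s(1) forms s(2)])
  have "(\<lambda>\<eta>s. eval_form (\<lambda>x. wedge (\<alpha> x) (\<beta> x)) \<eta>s x) = wedge ?A ?B"
    by (rule ext) (simp add: eval wedge_map)
  then have slot: "slotwise (br \<phi>) (\<lambda>\<eta>s. eval_form (\<lambda>x. wedge (\<alpha> x) (\<beta> x)) \<eta>s x) \<psi>s =
      wedge ?LA ?B \<psi>s + wedge ?A ?LB \<psi>s"
    using slotwise_wedge[OF hom(3)] by simp
  have "contract \<phi> (\<lambda>x. wedge (\<alpha> x) (\<beta> x)) =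
      (\<lambda>y ws. (-1) ^ p * wedge (\<alpha> y) (?\<beta> y) ws + wedge (?\<alpha> y) (\<beta> y) ws)"
    using wedge_Cons[OF hom(1)] by (simp add: contract_def contraction_def[of _ "wedge _ _"] fun_eq_iff)
  then have "D_rhs (contract \<phi> (\<lambda>x. wedge (\<alpha> x) (\<beta> x))) \<psi>s x =
      (-1) ^ p * D_rhs (\<lambda>x. wedge (\<alpha> x) (?\<beta> x)) \<psi>s x + D_rhs (\<lambda>x. wedge (?\<alpha> x) (\<beta> x)) \<psi>s x"
    using D_rhs_combination[OF wedge_form_section[OF forms(1) Omega_ker_form_section[OF c(2)]]
        wedge_form_section[OF Omega_ker_form_section[OF c(1)] forms(2)] s(2)] by simp
  also have "\<dots> = (-1) ^ p * (wedge (D p \<alpha> x) (?\<beta> x) ?vs + (-1) ^ p * wedge (\<alpha> x) (D (q - 1) ?\<beta> x) ?vs)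
      + (wedge (D (p - 1) ?\<alpha> x) (\<beta> x) ?vs + (-1) ^ (p - 1) * wedge (?\<alpha> x) (D q \<beta> x) ?vs)"
    using Cons.IH[OF Cons.prems(1) c(2) s(2)] Cons.IH[OF c(1) Cons.prems(2) s(2)] by simp
  \<comment> \<open>for \<open>p = 0\<close> the exponent is truncated, but then the contraction vanishes\<close>
  also have "(-1) ^ (p - 1) * wedge (?\<alpha> x) (D q \<beta> x) ?vs = - ((-1) ^ p * wedge (?\<alpha> x) (D q \<beta> x) ?vs)"
    using contract_zero_degree[of \<alpha> \<phi>] forms(1) by (cases p) (simp_all add: wedge_zero_left)
  finally have rest: "D_rhs (contract \<phi> (\<lambda>x. wedge (\<alpha> x) (\<beta> x))) \<psi>s x =
      (-1) ^ p * (wedge (D p \<alpha> x) (?\<beta> x) ?vs + (-1) ^ p * wedge (\<alpha> x) (D (q - 1) ?\<beta> x) ?vs)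
      + (wedge (D (p - 1) ?\<alpha> x) (\<beta> x) ?vs + - ((-1) ^ p * wedge (?\<alpha> x) (D q \<beta> x) ?vs))" .
  have sub: "set ws \<subseteq> sections" if "set ws \<subseteq> set \<psi>s" for ws using that s(2) by (rule order.trans)
  have "wedge (contraction (\<phi> x) (D p \<alpha> x)) (\<beta> x) ?vs =
      wedge (\<lambda>\<eta>s. - 1 * ?LA \<eta>s + (- 1 * D (p - 1) ?\<alpha> x (?at \<eta>s) + ?RA \<eta>s)) ?B \<psi>s"
    unfolding wedge_map eval using contraction_D[OF Cons.prems(1) s(1) sub]
    by (intro wedge_cong) (simp_all add: eval)
  then have left: "wedge (contraction (\<phi> x) (D p \<alpha> x)) (\<beta> x) ?vs =
      - 1 * wedge ?LA ?B \<psi>s + (- 1 * wedge (D (p - 1) ?\<alpha> x) (\<beta> x) ?vs + wedge ?RA ?B \<psi>s)"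
    unfolding wedge_linear_left by (simp add: wedge_map eval)
  have "wedge (\<alpha> x) (contraction (\<phi> x) (D q \<beta> x)) ?vs =
      wedge ?A (\<lambda>\<eta>s. - 1 * ?LB \<eta>s + (- 1 * D (q - 1) ?\<beta> x (?at \<eta>s) + ?RB \<eta>s)) \<psi>s"
    unfolding wedge_map eval using contraction_D[OF Cons.prems(2) s(1) sub]
    by (intro wedge_cong) (simp_all add: eval)
  then have right: "wedge (\<alpha> x) (contraction (\<phi> x) (D q \<beta> x)) ?vs =
      - 1 * wedge ?A ?LB \<psi>s + (- 1 * wedge (\<alpha> x) (D (q - 1) ?\<beta> x) ?vs + wedge ?A ?RB \<psi>s)"
    unfolding wedge_linear_right by (simp add: wedge_map eval)
  have sign: "(-1) ^ p * ((-1) ^ p * r) = r" for r :: real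
    by (simp flip: mult.assoc power_add)
  have "D_rhs (\<lambda>x. wedge (\<alpha> x) (\<beta> x)) (\<phi> # \<psi>s) x =
      (wedge ?RA ?B \<psi>s + wedge ?A ?RB \<psi>s) - (wedge ?LA ?B \<psi>s + wedge ?A ?LB \<psi>s) -
      ((-1) ^ p * wedge (D p \<alpha> x) (?\<beta> x) ?vs + wedge (\<alpha> x) (D (q - 1) ?\<beta> x) ?vs
      + (wedge (D (p - 1) ?\<alpha> x) (\<beta> x) ?vs - (-1) ^ p * wedge (?\<alpha> x) (D q \<beta> x) ?vs))"
    unfolding D_rhs_Cons[OF wedge_form_section[OF forms]] anchor slot rest by (simp add: distrib_left sign)
  also have "\<dots> = wedge (contraction (\<phi> x) (D p \<alpha> x)) (\<beta> x) ?vs - (-1) ^ p * wedge (D p \<alpha> x) (?\<beta> x) ?vs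
      + ((-1) ^ p * wedge (?\<alpha> x) (D q \<beta> x) ?vs + wedge (\<alpha> x) (contraction (\<phi> x) (D q \<beta> x)) ?vs)"
    unfolding left right by simp
  also have "\<dots> = wedge (D p \<alpha> x) (\<beta> x) (\<phi> x # ?vs) + (-1) ^ p * wedge (\<alpha> x) (D q \<beta> x) (\<phi> x # ?vs)"
    by (simp add: wedge_Cons[OF hom(1)] wedge_Cons[OF hom(2)] contract_def distrib_left sign)
  finally show ?case by simp
qed

lemma D_wedge:
  assumes \<alpha>: "\<alpha> \<in> Omega_ker p" and \<beta>: "\<beta> \<in> Omega_ker q"
  shows "D (p + q) (\<lambda>x. wedge (\<alpha> x) (\<beta> x)) =
    (\<lambda>x ws. wedge (D p \<alpha> x) (\<beta> x) ws + (-1) ^ p * wedge (\<alpha> x) (D q \<beta> x) ws)" (is "_ = ?\<omega>")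
proof -
  note \<alpha>\<beta> = wedge_Omega_ker[OF \<alpha> \<beta>]
  have "(\<lambda>x. wedge (D p \<alpha> x) (\<beta> x)) \<in> form_sections (Suc (p + q))"
    using wedge_form_section[OF D_form_section[OF \<alpha>] Omega_ker_form_section[OF \<beta>]] by simp
  moreover have "(\<lambda>x. wedge (\<alpha> x) (D q \<beta> x)) \<in> form_sections (Suc (p + q))"
    using wedge_form_section[OF Omega_ker_form_section[OF \<alpha>] D_form_section[OF \<beta>]] by simp
  ultimately have "?\<omega> \<in> form_sections (Suc (p + q))"
    using form_sections_combination[of "\<lambda>x. wedge (\<alpha> x) (D q \<beta> x)" _ "\<lambda>x. wedge (D p \<alpha> x) (\<beta> x)" "(-1) ^ p"]
    by (simp add: add.commute)
  then have "?\<omega> = D_form (p + q) (\<lambda>x. wedge (\<alpha> x) (\<beta> x))"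
    by (rule form_section_determined[OF \<alpha>\<beta>]) (simp add: fun_eq_iff eval_form_def D_rhs_wedge[OF \<alpha> \<beta>])
  then show ?thesis by (simp add: D_eq_D_form[OF \<alpha>\<beta>])
qed

end

theorem proposition3p2:
  fixes atlas :: "('m::{t2_space,second_countable_topology} set \<times> ('m \<Rightarrow> 'b::real_inner)) set"
    and E :: "'m \<Rightarrow> 'v::real_vector set"
    and triv :: "('m set \<times> ('m \<Rightarrow> 'v \<Rightarrow> 'f::real_inner)) set"
    and g :: "'m \<Rightarrow> 'v \<Rightarrow> 'v \<Rightarrow> real"
    and \<rho> :: "'m \<Rightarrow> 'v \<Rightarrow> ('m \<Rightarrow> real) \<Rightarrow> real"
    and br :: "('m \<Rightarrow> 'v) \<Rightarrow> ('m \<Rightarrow> 'v) \<Rightarrow> 'm \<Rightarrow> 'v"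
  defines "Cinf \<equiv> smooth_manifold.smooth_functions atlas"
    and "\<Gamma> \<equiv> smooth_vector_bundle.sections atlas E triv"
    and "\<Gamma>_ext \<equiv> metric_anchored_bundle.form_sections atlas E triv"
    and "\<Omega> \<equiv> metric_anchored_bundle.Omega_ker atlas E triv g \<rho>"
    and "eval \<equiv> metric_anchored_bundle.eval_form"
    and "rhs \<equiv> strongly_anchored_almost_courant_algebroid.D_rhs \<rho> br"
    and "\<D> \<equiv> strongly_anchored_almost_courant_algebroid.D atlas E triv \<rho> br"
  assumes "strongly_anchored_almost_courant_algebroid atlas E triv g \<rho> br"
  shows "(\<forall>p. \<forall>\<alpha>\<in>\<Omega> p.
            (\<forall>\<psi>s k. \<forall>\<phi>\<in>\<Gamma>. \<forall>\<eta>\<in>\<Gamma>. \<forall>f\<in>Cinf. length \<psi>s = p + 1 \<and> set \<psi>s \<subseteq> \<Gamma> \<and> k < p + 1 \<longrightarrow>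
               rhs \<alpha> (\<psi>s[k := (\<lambda>x. f x *\<^sub>R \<phi> x + \<eta> x)]) =
               (\<lambda>x. f x * rhs \<alpha> (\<psi>s[k := \<phi>]) x + rhs \<alpha> (\<psi>s[k := \<eta>]) x)) \<and>
            (\<exists>!\<omega>. \<omega> \<in> \<Gamma>_ext (p + 1) \<and>
               (\<forall>\<psi>s. length \<psi>s = p + 1 \<and> set \<psi>s \<subseteq> \<Gamma> \<longrightarrow> eval \<omega> \<psi>s = rhs \<alpha> \<psi>s)) \<and>
            \<D> p \<alpha> \<in> \<Omega> (p + 1)) \<and>
         (\<forall>p q. \<forall>\<alpha>\<in>\<Omega> p. \<forall>\<beta>\<in>\<Omega> q.
            (\<lambda>x. wedge (\<alpha> x) (\<beta> x)) \<in> \<Omega> (p + q) \<and>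
            \<D> (p + q) (\<lambda>x. wedge (\<alpha> x) (\<beta> x)) =
            (\<lambda>x ws. wedge (\<D> p \<alpha> x) (\<beta> x) ws + (-1) ^ p * wedge (\<alpha> x) (\<D> q \<beta> x) ws))"
proof -
  interpret strongly_anchored_almost_courant_algebroid atlas E triv g \<rho> br by fact
  show ?thesis
    unfolding Cinf_def \<Gamma>_def \<Gamma>_ext_def \<Omega>_def eval_def rhs_def \<D>_def Suc_eq_plus1[symmetric]
  proof (intro conjI allI ballI impI)
    fix p \<alpha> assume \<alpha>: "\<alpha> \<in> Omega_ker p"
    show "D_rhs \<alpha> (\<psi>s[k := (\<lambda>x. f x *\<^sub>R \<phi> x + \<eta> x)]) =
        (\<lambda>x. f x * D_rhs \<alpha> (\<psi>s[k := \<phi>]) x + D_rhs \<alpha> (\<psi>s[k := \<eta>]) x)"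
      if "\<phi> \<in> sections" "\<eta> \<in> sections" "f \<in> smooth_functions"
        and "length \<psi>s = Suc p \<and> set \<psi>s \<subseteq> sections \<and> k < Suc p" for \<psi>s k \<phi> \<eta> f
      using that by (intro ext D_rhs_linear[OF \<alpha>]) auto
    show "\<exists>!\<omega>. \<omega> \<in> form_sections (Suc p) \<and>
        (\<forall>\<psi>s. length \<psi>s = Suc p \<and> set \<psi>s \<subseteq> sections \<longrightarrow> eval_form \<omega> \<psi>s = D_rhs \<alpha> \<psi>s)"
      by (rule D_exists_unique[OF \<alpha>])
    show "D p \<alpha> \<in> Omega_ker (Suc p)" by (rule D_Omega_ker[OF \<alpha>])
  qed (fact wedge_Omega_ker, fact D_wedge)
qed

end
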